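(* Let $C$ be a Galois co-object for a commutative Hopf algebra $H$. Then $\widehat{C}$ is a formal dual of the $H$-bimodule $C$, with $\mathrm{ev}=(\varepsilon_C\otimes H)\circ\delta^{-1}$ and $\widehat{\mathrm{ev}}=S\circ\mathrm{ev}$. Furthermore, $C$ is an $H$-$H$ herd with shepherd $$\Delta_C^2=(\Delta_C\otimes C)\circ\Delta_C=(C\otimes\Delta_C)\circ\Delta_C:C\to C\otimes\widehat{C}\otimes C,$$ and pen $\widehat{C}$.
   Context: $k$ is a commutative ring and $\otimes=\otimes_k$. $H$ is a Hopf algebra over $k$, commutative as a $k$-algebra, faithfully flat over $k$, with (bijective, involutive) antipode $S$, unit map $\eta_H:k\to H$, counit $\varepsilon_H$ and coproduct $\Delta_H(h)=h_{(1)}\otimes h_{(2)}$. A right $H$-module coalgebra is a $k$-coalgebra $C$ (coproduct $\Delta_C(c)=c_{(1)}\otimes c_{(2)}$, counit $\varepsilon_C$) that is a right $H$-module with $\Delta_C(ch)=c_{(1)}h_{(1)}\otimes c_{(2)}h_{(2)}$ and $\varepsilon_C(ch)=\varepsilon_C(c)\varepsilon_H(h)$. A right $(H,C)$-Hopf module is a right $H$-module $M$ with a right $C$-coaction $m\mapsto m_{(0)}\otimes m_{(1)}$ such that $(mh)_{(0)}\otimes(mh)_{(1)}=m_{(0)}h_{(1)}\otimes m_{(1)}h_{(2)}$; these form the category $\mathbf{M}^C_H(H)$. $C$ is a (Hopf-)Galois co-object for $H$ if the functor $-\otimes C:\mathbf{M}_k\to\mathbf{M}^C_H(H)$ and its left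 adjoint $-\otimes_H k$ are inverse equivalences. For a Galois co-object $C$ the map $\delta:C\otimes H\to C\otimes C$, $\delta(c\otimes h)=c_{(1)}\otimes c_{(2)}h$, is bijective (known). $C$ is regarded as an $H$-bimodule with equal left and right actions. $\widehat{C}$ has underlying $k$-module $C$ and is an $H$-bimodule with equal left and right actions $h\rightharpoonup\hat{c}=\hat{c}\leftharpoonup h=\hat{c}S^{-1}(h)$. Using $\widehat{C}=C$ as $k$-modules, $\mathrm{ev}$ is viewed as a map $\widehat{C}\otimes C\to H$ and $\widehat{\mathrm{ev}}=S\circ\mathrm{ev}$ as a map $C\otimes\widehat{C}\to H$. Definitions specialised to ring maps $\alpha=\beta=\eta_H:k\to H$: an $H$-bimodule $\widehat{T}$ is a formal dual of an $H$-bimodule $T$ via $H$-bimodule maps $\mathrm{ev}:\widehat{T}\otimes T\to H$, $\widehat{\mathrm{ev}}:T\otimes\widehat{T}\to H$ if $\widehat{\mathrm{ev}}(x\otimes\hat{x})y=x\,\mathrm{ev}(\hat{x}\otimes y)$ and $\hat{x}\,\widehat{\mathrm{ev}}(x\otimes\hat{y})=\mathrm{ev}(\hat{x}\otimes x)\hat{y}$ for all $x,y\in T$, $\hat{x},\hat{y}\in\widehat{T}$. $T$ is an $H$-$H$ herd with pen $\widehat{T}$ and shepherd $\gamma$ if $\gamma:T\to T\otimes\widehat{T}\otimes T$, $\gamma(x)=x^{\langle1\rangle}\otimes x^{\langle2\rangle}\otimes x^{\langle3\rangle}$, is a $k$-linear map with $\widehat{\mathrm{ev}}(x^{\langle1\rangle}\otimes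 x^{\langle2\rangle})\otimes x^{\langle3\rangle}=1_H\otimes x$, $x^{\langle1\rangle}\otimes\mathrm{ev}(x^{\langle2\rangle}\otimes x^{\langle3\rangle})=x\otimes1_H$ and $(\gamma\otimes\widehat{T}\otimes T)\circ\gamma=(T\otimes\widehat{T}\otimes\gamma)\circ\gamma$. *)

theory Defs
  imports "HOL-Library.Infinite_Typeclass" "HOL-Algebra.Module"
begin

text \<open>
  Everything lives in one universe: an arbitrary infinite type \<open>'u\<close>. Rings, modules, coalgebras
  etc. are \<open>HOL-Algebra\<close> records with carrier in \<open>'u\<close>, and ``all modules'' means all modules
  with carrier in \<open>'u\<close>. Since \<open>'u\<close> is infinite, this universe is closed under tensor products,
  which is used to make the tensor product of two modules again a module with carrier in \<open>'u\<close>.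
\<close>

section \<open>Tensor products over a commutative ring\<close>

text \<open>
  \<open>M \<otimes> N\<close> is the set of finite formal sums of pairs (lists over \<open>carrier M \<times> carrier N\<close>) modulo
  the congruence generated by bilinearity.
\<close>

inductive tensor_eq ::
  "('r, 'e) ring_scheme \<Rightarrow> ('r, 'm, 'x) module_scheme \<Rightarrow> ('r, 'n, 'y) module_scheme
    \<Rightarrow> ('m \<times> 'n) list \<Rightarrow> ('m \<times> 'n) list \<Rightarrow> bool"
  for R M N where
  refl: "xs \<in> lists (carrier M \<times> carrier N) \<Longrightarrow> tensor_eq R M N xs xs"
| sym: "tensor_eq R M N xs ys \<Longrightarrow> tensor_eq R M N ys xs"
| trans: "tensor_eq R M N xs ys \<Longrightarrow> tensor_eq R M N ys zs \<Longrightarrow> tensor_eq R M N xs zs"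
| append: "tensor_eq R M N xs xs' \<Longrightarrow> tensor_eq R M N ys ys'
    \<Longrightarrow> tensor_eq R M N (xs @ ys) (xs' @ ys')"
| comm: "xs \<in> lists (carrier M \<times> carrier N) \<Longrightarrow> ys \<in> lists (carrier M \<times> carrier N)
    \<Longrightarrow> tensor_eq R M N (xs @ ys) (ys @ xs)"
| add_left: "m \<in> carrier M \<Longrightarrow> m' \<in> carrier M \<Longrightarrow> n \<in> carrier N
    \<Longrightarrow> tensor_eq R M N [(m \<oplus>\<^bsub>M\<^esub> m', n)] [(m, n), (m', n)]"
| add_right: "m \<in> carrier M \<Longrightarrow> n \<in> carrier N \<Longrightarrow> n' \<in> carrier N
    \<Longrightarrow> tensor_eq R M N [(m, n \<oplus>\<^bsub>N\<^esub> n')] [(m, n), (m, n')]"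
| zero_left: "n \<in> carrier N \<Longrightarrow> tensor_eq R M N [(\<zero>\<^bsub>M\<^esub>, n)] []"
| zero_right: "m \<in> carrier M \<Longrightarrow> tensor_eq R M N [(m, \<zero>\<^bsub>N\<^esub>)] []"
| balanced: "r \<in> carrier R \<Longrightarrow> m \<in> carrier M \<Longrightarrow> n \<in> carrier N
    \<Longrightarrow> tensor_eq R M N [(r \<odot>\<^bsub>M\<^esub> m, n)] [(m, r \<odot>\<^bsub>N\<^esub> n)]"

lemma list_pairs_embed_infinite: "\<exists>e :: ('u::infinite \<times> 'u) list \<Rightarrow> 'u. inj e"
proof -
  include cardinal_syntax
  let ?U = "UNIV :: 'u set" and ?P = "UNIV :: ('u \<times> 'u) set"
  have inf: "infinite ?U" by (rule infinite_UNIV)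
  have UU: "|?U \<times> ?U| \<le>o |?U|"
    by (rule ordIso_imp_ordLeq[OF card_of_Times_same_infinite[OF inf]])
  have P: "|?P| \<le>o |?U|" using UU by simp
  define L where "L n = {xs :: ('u \<times> 'u) list. length xs = n}" for n
  have L: "|L n| \<le>o |?U|" for n
  proof (induction n)
    case 0
    have "|L 0| \<le>o |?U|"
      unfolding card_of_ordLeq[symmetric] by (auto simp: L_def inj_on_def)
    then show ?case .
  next
    case (Suc n)
    have "inj_on (\<lambda>xs. (hd xs, tl xs)) (L (Suc n))"
    proof (rule inj_onI)
      fix xs ys assume "xs \<in> L (Suc n)" "ys \<in> L (Suc n)" "(hd xs, tl xs) = (hd ys, tl ys)"
      then show "xs = ys" by (cases xs; cases ys) (simp_all add: L_def)
    qed
    moreover have "(\<lambda>xs. (hd xs, tl xs)) ` L (Suc n) \<subseteq> ?P \<times> L n"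
      by (auto simp: L_def)
    ultimately have "|L (Suc n)| \<le>o |?P \<times> L n|"
      unfolding card_of_ordLeq[symmetric] by blast
    also have "|?P \<times> L n| \<le>o |?U \<times> ?U|"
      using card_of_Times_mono1[OF P] card_of_Times_mono2[OF Suc] ordLeq_transitive by blast
    also note UU
    finally show ?case .
  qed
  have "|UNIV :: nat set| \<le>o |?U|"
    using inf infinite_iff_card_of_nat by blast
  then have "|\<Union>n. L n| \<le>o |?U|"
    using card_of_UNION_ordLeq_infinite[OF inf] L by blast
  moreover have "(\<Union>n. L n) = UNIV" by (auto simp: L_def)
  ultimately show ?thesis
    unfolding card_of_ordLeq[symmetric] by auto
qed

definition encode :: "('u::infinite \<times> 'u) list \<Rightarrow> 'u" where
  "encode = (SOME e. inj e)"

lemma inj_encode: "inj encode"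
  unfolding encode_def by (rule someI_ex[OF list_pairs_embed_infinite])

text \<open>
  \<open>tensor_sum R M N [(m\<^sub>1, n\<^sub>1), \<dots>]\<close> is the element \<open>m\<^sub>1 \<otimes> n\<^sub>1 + \<dots>\<close> of \<open>M \<otimes>\<^sub>R N\<close>: an equivalence
  class is stored as the code of one of its members. \<open>terms\<close> recovers that member, so that
  every \<open>x\<close> in the tensor product is the sum of the pure tensors listed in \<open>terms x\<close>.
\<close>

definition tensor_sum ::
  "('u::infinite, 'e) ring_scheme \<Rightarrow> ('u, 'u, 'x) module_scheme \<Rightarrow> ('u, 'u, 'y) module_scheme
    \<Rightarrow> ('u \<times> 'u) list \<Rightarrow> 'u" where
  "tensor_sum R M N xs = encode (SOME ys. tensor_eq R M N xs ys)"

definition "terms" :: "'u::infinite \<Rightarrow> ('u \<times> 'u) list" where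
  "terms x = inv_into UNIV encode x"

abbreviation pure ::
  "('u::infinite, 'e) ring_scheme \<Rightarrow> ('u, 'u, 'x) module_scheme \<Rightarrow> ('u, 'u, 'y) module_scheme
    \<Rightarrow> 'u \<Rightarrow> 'u \<Rightarrow> 'u" where
  "pure R M N m n \<equiv> tensor_sum R M N [(m, n)]"

text \<open>
  The bilinear extension of \<open>(a \<otimes> b, c \<otimes> d) \<mapsto> f a c \<otimes> g b d\<close> to a map of two tensor arguments.
\<close>

definition tensor_map2 ::
  "('u::infinite, 'e) ring_scheme \<Rightarrow> ('u, 'u, 'x) module_scheme \<Rightarrow> ('u, 'u, 'y) module_scheme
    \<Rightarrow> ('u \<Rightarrow> 'u \<Rightarrow> 'u) \<Rightarrow> ('u \<Rightarrow> 'u \<Rightarrow> 'u) \<Rightarrow> 'u \<Rightarrow> 'u \<Rightarrow> 'u" where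
  "tensor_map2 R M N f g x y =
    tensor_sum R M N [(f a c, g b d). (a, b) \<leftarrow> terms x, (c, d) \<leftarrow> terms y]"

text \<open>
  \<open>mult\<close> and \<open>one\<close> are the usual structure of a tensor product of algebras; they carry no
  information when the factors are merely modules.
\<close>

definition tensor ::
  "('u::infinite, 'e) ring_scheme \<Rightarrow> ('u, 'u, 'x) module_scheme \<Rightarrow> ('u, 'u, 'y) module_scheme
    \<Rightarrow> ('u, 'u) module" where
  "tensor R M N =
    \<lparr>carrier = tensor_sum R M N ` lists (carrier M \<times> carrier N),
     mult = tensor_map2 R M N (mult M) (mult N),
     one = pure R M N \<one>\<^bsub>M\<^esub> \<one>\<^bsub>N\<^esub>,
     zero = tensor_sum R M N [],
     add = (\<lambda>x y. tensor_sum R M N (terms x @ terms y)),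
     smult = (\<lambda>r x. tensor_sum R M N [(r \<odot>\<^bsub>M\<^esub> m, n). (m, n) \<leftarrow> terms x])\<rparr>"

text \<open>
  The linear map into \<open>P\<close> induced by a bilinear map \<open>b\<close>; the map \<open>f \<otimes> g\<close> into \<open>M \<otimes>\<^sub>R N\<close>; and the
  associativity isomorphisms \<open>(M \<otimes> N) \<otimes> P \<rightarrow> M \<otimes> (N \<otimes> P)\<close> and back.
\<close>

definition tensor_lift :: "('u::infinite, 'x) ring_scheme \<Rightarrow> ('u \<Rightarrow> 'u \<Rightarrow> 'u) \<Rightarrow> 'u \<Rightarrow> 'u" where
  "tensor_lift P b x = foldr (\<lambda>(m, n) s. b m n \<oplus>\<^bsub>P\<^esub> s) (terms x) \<zero>\<^bsub>P\<^esub>"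

definition tensor_map ::
  "('u::infinite, 'e) ring_scheme \<Rightarrow> ('u, 'u, 'x) module_scheme \<Rightarrow> ('u, 'u, 'y) module_scheme
    \<Rightarrow> ('u \<Rightarrow> 'u) \<Rightarrow> ('u \<Rightarrow> 'u) \<Rightarrow> 'u \<Rightarrow> 'u" where
  "tensor_map R M N f g = tensor_lift (tensor R M N) (\<lambda>a b. pure R M N (f a) (g b))"

definition tensor_assoc ::
  "('u::infinite, 'e) ring_scheme \<Rightarrow> ('u, 'u, 'x) module_scheme \<Rightarrow> ('u, 'u, 'y) module_scheme
    \<Rightarrow> ('u, 'u, 'z) module_scheme \<Rightarrow> 'u \<Rightarrow> 'u" where
  "tensor_assoc R M N P =
    tensor_lift (tensor R M (tensor R N P))
      (\<lambda>t p. tensor_lift (tensor R M (tensor R N P))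
        (\<lambda>m n. pure R M (tensor R N P) m (pure R N P n p)) t)"

definition tensor_assoc_inv ::
  "('u::infinite, 'e) ring_scheme \<Rightarrow> ('u, 'u, 'x) module_scheme \<Rightarrow> ('u, 'u, 'y) module_scheme
    \<Rightarrow> ('u, 'u, 'z) module_scheme \<Rightarrow> 'u \<Rightarrow> 'u" where
  "tensor_assoc_inv R M N P =
    tensor_lift (tensor R (tensor R M N) P)
      (\<lambda>m t. tensor_lift (tensor R (tensor R M N) P)
        (\<lambda>n p. pure R (tensor R M N) P (pure R M N m n) p) t)"


section \<open>Modules, flatness\<close>

definition linear_maps ::
  "('r, 'e) ring_scheme \<Rightarrow> ('r, 'm, 'x) module_scheme \<Rightarrow> ('r, 'n, 'y) module_scheme
    \<Rightarrow> ('m \<Rightarrow> 'n) set" where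
  "linear_maps R M N =
    {f \<in> carrier M \<rightarrow> carrier N.
      (\<forall>x\<in>carrier M. \<forall>y\<in>carrier M. f (x \<oplus>\<^bsub>M\<^esub> y) = f x \<oplus>\<^bsub>N\<^esub> f y) \<and>
      (\<forall>r\<in>carrier R. \<forall>x\<in>carrier M. f (r \<odot>\<^bsub>M\<^esub> x) = r \<odot>\<^bsub>N\<^esub> f x)}"

definition exact_at ::
  "('r, 'a, 'x) module_scheme \<Rightarrow> ('r, 'b, 'y) module_scheme \<Rightarrow> ('r, 'c, 'z) module_scheme
    \<Rightarrow> ('a \<Rightarrow> 'b) \<Rightarrow> ('b \<Rightarrow> 'c) \<Rightarrow> bool" where
  "exact_at A B D f g \<longleftrightarrow> f ` carrier A = {b \<in> carrier B. g b = \<zero>\<^bsub>D\<^esub>}"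

definition faithfully_flat ::
  "'u::infinite ring \<Rightarrow> ('u, 'u, 'x) module_scheme \<Rightarrow> bool" where
  "faithfully_flat k H \<longleftrightarrow> Module.module k H \<and>
    (\<forall>(A :: ('u, 'u) module) (B :: ('u, 'u) module) (D :: ('u, 'u) module) f g.
      Module.module k A \<longrightarrow> Module.module k B \<longrightarrow> Module.module k D \<longrightarrow>
      f \<in> linear_maps k A B \<longrightarrow> g \<in> linear_maps k B D \<longrightarrow>
      (exact_at A B D f g \<longleftrightarrow>
       exact_at (tensor k A H) (tensor k B H) (tensor k D H)
         (tensor_map k B H f (\<lambda>h. h)) (tensor_map k D H g (\<lambda>h. h))))"

definition regular_module :: "'r ring \<Rightarrow> ('r, 'r) module" where
  "regular_module k = ring.extend k (module.fields (mult k))"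

text \<open>The \<open>k\<close>-module underlying an \<open>H\<close>-module, by restriction along the unit map of \<open>H\<close>.\<close>

definition restrict_unit ::
  "('u, 'u) module \<Rightarrow> ('u, 'u) module \<Rightarrow> ('u, 'u) module" where
  "restrict_unit H M = M\<lparr>smult := (\<lambda>r m. (r \<odot>\<^bsub>H\<^esub> \<one>\<^bsub>H\<^esub>) \<odot>\<^bsub>M\<^esub> m)\<rparr>"


section \<open>Coalgebras, Hopf algebras, Hopf modules\<close>

locale coalgebra = Module.module k C
  for k :: "'u::infinite ring" and C :: "('u, 'u) module" +
  fixes \<Delta> :: "'u \<Rightarrow> 'u" and \<epsilon> :: "'u \<Rightarrow> 'u"
  assumes comult_linear: "\<Delta> \<in> linear_maps k C (tensor k C C)"
    and counit_linear: "\<epsilon> \<in> linear_maps k C (regular_module k)"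
    and coassoc: "c \<in> carrier C \<Longrightarrow>
      tensor_assoc k C C C (tensor_map k (tensor k C C) C \<Delta> (\<lambda>x. x) (\<Delta> c))
      = tensor_map k C (tensor k C C) (\<lambda>x. x) \<Delta> (\<Delta> c)"
    and counit_left: "c \<in> carrier C \<Longrightarrow> tensor_lift C (\<lambda>a b. \<epsilon> a \<odot>\<^bsub>C\<^esub> b) (\<Delta> c) = c"
    and counit_right: "c \<in> carrier C \<Longrightarrow> tensor_lift C (\<lambda>a b. \<epsilon> b \<odot>\<^bsub>C\<^esub> a) (\<Delta> c) = c"

text \<open>The library locale \<open>algebra\<close> already includes commutativity of both \<open>k\<close> and \<open>H\<close>.\<close>

locale commutative_hopf_algebra = Module.algebra k H + coalgebra k H \<Delta> \<epsilon>
  for k :: "'u::infinite ring" and H :: "('u, 'u) module"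
    and \<Delta> :: "'u \<Rightarrow> 'u" and \<epsilon> :: "'u \<Rightarrow> 'u" +
  fixes S :: "'u \<Rightarrow> 'u"
  assumes comult_ring_hom: "\<Delta> \<in> ring_hom H (tensor k H H)"
    and counit_ring_hom: "\<epsilon> \<in> ring_hom H k"
    and antipode_linear: "S \<in> linear_maps k H H"
    and antipode_left: "h \<in> carrier H \<Longrightarrow>
      tensor_lift H (\<lambda>a b. S a \<otimes>\<^bsub>H\<^esub> b) (\<Delta> h) = \<epsilon> h \<odot>\<^bsub>H\<^esub> \<one>\<^bsub>H\<^esub>"
    and antipode_right: "h \<in> carrier H \<Longrightarrow>
      tensor_lift H (\<lambda>a b. a \<otimes>\<^bsub>H\<^esub> S b) (\<Delta> h) = \<epsilon> h \<odot>\<^bsub>H\<^esub> \<one>\<^bsub>H\<^esub>"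

text \<open>
  As \<open>H\<close> is commutative, a right \<open>H\<close>-module is a module over the commutative ring \<open>H\<close>, and
  \<open>m h\<close> is written \<open>h \<odot> m\<close>. The \<open>k\<close>-module underlying such a module is always the one given by
  \<open>restrict_unit\<close>.
\<close>

locale module_coalgebra = act: Module.module H C + coalgebra k "restrict_unit H C" \<Delta>\<^sub>C \<epsilon>\<^sub>C
  for k :: "'u::infinite ring" and H :: "('u, 'u) module"
    and \<Delta>\<^sub>H :: "'u \<Rightarrow> 'u" and \<epsilon>\<^sub>H :: "'u \<Rightarrow> 'u"
    and C :: "('u, 'u) module" and \<Delta>\<^sub>C :: "'u \<Rightarrow> 'u" and \<epsilon>\<^sub>C :: "'u \<Rightarrow> 'u" +
  assumes comult_act: "c \<in> carrier C \<Longrightarrow> h \<in> carrier H \<Longrightarrow>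
      \<Delta>\<^sub>C (h \<odot>\<^bsub>C\<^esub> c)
      = tensor_map2 k (restrict_unit H C) (restrict_unit H C)
          (\<lambda>c h. h \<odot>\<^bsub>C\<^esub> c) (\<lambda>c h. h \<odot>\<^bsub>C\<^esub> c) (\<Delta>\<^sub>C c) (\<Delta>\<^sub>H h)"
    and counit_act: "c \<in> carrier C \<Longrightarrow> h \<in> carrier H \<Longrightarrow>
      \<epsilon>\<^sub>C (h \<odot>\<^bsub>C\<^esub> c) = \<epsilon>\<^sub>C c \<otimes>\<^bsub>k\<^esub> \<epsilon>\<^sub>H h"

locale hopf_module = Module.module H M
  for k :: "'u::infinite ring" and H :: "('u, 'u) module" and \<Delta>\<^sub>H :: "'u \<Rightarrow> 'u"
    and C :: "('u, 'u) module" and \<Delta>\<^sub>C :: "'u \<Rightarrow> 'u" and \<epsilon>\<^sub>C :: "'u \<Rightarrow> 'u"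
    and M :: "('u, 'u) module" +
  fixes \<rho> :: "'u \<Rightarrow> 'u"
  assumes coaction_linear:
      "\<rho> \<in> linear_maps k (restrict_unit H M) (tensor k (restrict_unit H M) (restrict_unit H C))"
    and coaction_coassoc: "m \<in> carrier M \<Longrightarrow>
      tensor_assoc k (restrict_unit H M) (restrict_unit H C) (restrict_unit H C)
        (tensor_map k (tensor k (restrict_unit H M) (restrict_unit H C)) (restrict_unit H C)
          \<rho> (\<lambda>c. c) (\<rho> m))
      = tensor_map k (restrict_unit H M) (tensor k (restrict_unit H C) (restrict_unit H C))
          (\<lambda>m. m) \<Delta>\<^sub>C (\<rho> m)"
    and coaction_counit: "m \<in> carrier M \<Longrightarrow>
      tensor_lift M (\<lambda>m c. \<epsilon>\<^sub>C c \<odot>\<^bsub>restrict_unit H M\<^esub> m) (\<rho> m) = m"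
    and coaction_act: "m \<in> carrier M \<Longrightarrow> h \<in> carrier H \<Longrightarrow>
      \<rho> (h \<odot>\<^bsub>M\<^esub> m)
      = tensor_map2 k (restrict_unit H M) (restrict_unit H C)
          (\<lambda>m h. h \<odot>\<^bsub>M\<^esub> m) (\<lambda>c h. h \<odot>\<^bsub>C\<^esub> c) (\<rho> m) (\<Delta>\<^sub>H h)"


section \<open>Equivalences of concrete categories\<close>

text \<open>
  Morphisms are functions, identified when they agree on the underlying set \<open>pts X\<close> of their
  domain; composition is composition of functions.
\<close>

record ('o, 'u) concrete_category =
  obj :: "'o set"
  pts :: "'o \<Rightarrow> 'u set"
  homs :: "'o \<Rightarrow> 'o \<Rightarrow> ('u \<Rightarrow> 'u) set"

record ('a, 'b, 'u) concrete_functor =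
  on_obj :: "'a \<Rightarrow> 'b"
  on_hom :: "'a \<Rightarrow> 'a \<Rightarrow> ('u \<Rightarrow> 'u) \<Rightarrow> 'u \<Rightarrow> 'u"

definition eq_on :: "'a set \<Rightarrow> ('a \<Rightarrow> 'b) \<Rightarrow> ('a \<Rightarrow> 'b) \<Rightarrow> bool" where
  "eq_on X f g \<longleftrightarrow> (\<forall>x\<in>X. f x = g x)"

definition is_functor ::
  "('a, 'u) concrete_category \<Rightarrow> ('b, 'u) concrete_category
    \<Rightarrow> ('a, 'b, 'u) concrete_functor \<Rightarrow> bool" where
  "is_functor \<A> \<B> F \<longleftrightarrow>
    (\<forall>X\<in>obj \<A>. on_obj F X \<in> obj \<B>) \<and>
    (\<forall>X\<in>obj \<A>. \<forall>Y\<in>obj \<A>. \<forall>f\<in>homs \<A> X Y.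
      on_hom F X Y f \<in> homs \<B> (on_obj F X) (on_obj F Y)) \<and>
    (\<forall>X\<in>obj \<A>. \<forall>Y\<in>obj \<A>. \<forall>f\<in>homs \<A> X Y. \<forall>g\<in>homs \<A> X Y.
      eq_on (pts \<A> X) f g \<longrightarrow>
      eq_on (pts \<B> (on_obj F X)) (on_hom F X Y f) (on_hom F X Y g)) \<and>
    (\<forall>X\<in>obj \<A>. eq_on (pts \<B> (on_obj F X)) (on_hom F X X (\<lambda>x. x)) (\<lambda>x. x)) \<and>
    (\<forall>X\<in>obj \<A>. \<forall>Y\<in>obj \<A>. \<forall>Z\<in>obj \<A>. \<forall>f\<in>homs \<A> X Y. \<forall>g\<in>homs \<A> Y Z.
      eq_on (pts \<B> (on_obj F X)) (on_hom F X Z (g \<circ> f)) (on_hom F Y Z g \<circ> on_hom F X Y f))"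

definition id_functor :: "('a, 'a, 'u) concrete_functor" where
  "id_functor = \<lparr>on_obj = (\<lambda>X. X), on_hom = (\<lambda>X Y f. f)\<rparr>"

definition comp_functor ::
  "('b, 'c, 'u) concrete_functor \<Rightarrow> ('a, 'b, 'u) concrete_functor
    \<Rightarrow> ('a, 'c, 'u) concrete_functor" where
  "comp_functor G F =
    \<lparr>on_obj = (\<lambda>X. on_obj G (on_obj F X)),
     on_hom = (\<lambda>X Y f. on_hom G (on_obj F X) (on_obj F Y) (on_hom F X Y f))\<rparr>"

definition isomorphisms ::
  "('a, 'u) concrete_category \<Rightarrow> 'a \<Rightarrow> 'a \<Rightarrow> ('u \<Rightarrow> 'u) set" where
  "isomorphisms \<A> X Y =
    {f \<in> homs \<A> X Y. \<exists>g\<in>homs \<A> Y X.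
      eq_on (pts \<A> X) (g \<circ> f) (\<lambda>x. x) \<and> eq_on (pts \<A> Y) (f \<circ> g) (\<lambda>y. y)}"

definition naturally_isomorphic ::
  "('a, 'u) concrete_category \<Rightarrow> ('b, 'u) concrete_category
    \<Rightarrow> ('a, 'b, 'u) concrete_functor \<Rightarrow> ('a, 'b, 'u) concrete_functor \<Rightarrow> bool" where
  "naturally_isomorphic \<A> \<B> F G \<longleftrightarrow>
    (\<exists>\<phi>. (\<forall>X\<in>obj \<A>. \<phi> X \<in> isomorphisms \<B> (on_obj F X) (on_obj G X)) \<and>
      (\<forall>X\<in>obj \<A>. \<forall>Y\<in>obj \<A>. \<forall>f\<in>homs \<A> X Y.
        eq_on (pts \<B> (on_obj F X)) (\<phi> Y \<circ> on_hom F X Y f) (on_hom G X Y f \<circ> \<phi> X)))"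

definition inverse_equivalences ::
  "('a, 'u) concrete_category \<Rightarrow> ('b, 'u) concrete_category
    \<Rightarrow> ('a, 'b, 'u) concrete_functor \<Rightarrow> ('b, 'a, 'u) concrete_functor \<Rightarrow> bool" where
  "inverse_equivalences \<A> \<B> F G \<longleftrightarrow>
    is_functor \<A> \<B> F \<and> is_functor \<B> \<A> G \<and>
    naturally_isomorphic \<A> \<A> (comp_functor G F) id_functor \<and>
    naturally_isomorphic \<B> \<B> (comp_functor F G) id_functor"


section \<open>Galois co-objects\<close>

definition module_category :: "'u ring \<Rightarrow> (('u, 'u) module, 'u) concrete_category" where
  "module_category k =
    \<lparr>obj = {N. Module.module k N}, pts = carrier, homs = linear_maps k\<rparr>"

definition hopf_module_category ::
  "'u::infinite ring \<Rightarrow> ('u, 'u) module \<Rightarrow> ('u \<Rightarrow> 'u)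
    \<Rightarrow> ('u, 'u) module \<Rightarrow> ('u \<Rightarrow> 'u) \<Rightarrow> ('u \<Rightarrow> 'u)
    \<Rightarrow> (('u, 'u) module \<times> ('u \<Rightarrow> 'u), 'u) concrete_category" where
  "hopf_module_category k H \<Delta>\<^sub>H C \<Delta>\<^sub>C \<epsilon>\<^sub>C =
    \<lparr>obj = {(M, \<rho>). hopf_module k H \<Delta>\<^sub>H C \<Delta>\<^sub>C \<epsilon>\<^sub>C M \<rho>},
     pts = (\<lambda>(M, \<rho>). carrier M),
     homs = (\<lambda>(M, \<rho>) (M', \<rho>').
       {f \<in> linear_maps H M M'. \<forall>m\<in>carrier M.
         \<rho>' (f m) = tensor_map k (restrict_unit H M') (restrict_unit H C) f (\<lambda>c. c) (\<rho> m)})\<rparr>"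

text \<open>
  \<open>N \<mapsto> N \<otimes>\<^sub>k C\<close> with action \<open>(n \<otimes> c) h = n \<otimes> c h\<close> and coaction \<open>n \<otimes> c \<mapsto> (n \<otimes> c\<^sub>1) \<otimes> c\<^sub>2\<close>.
\<close>

definition free_hopf_module_functor ::
  "'u::infinite ring \<Rightarrow> ('u, 'u) module \<Rightarrow> ('u, 'u) module \<Rightarrow> ('u \<Rightarrow> 'u)
    \<Rightarrow> (('u, 'u) module, ('u, 'u) module \<times> ('u \<Rightarrow> 'u), 'u) concrete_functor" where
  "free_hopf_module_functor k H C \<Delta>\<^sub>C =
    (let C\<^sub>k = restrict_unit H C in
     \<lparr>on_obj = (\<lambda>N.
        ((tensor k N C\<^sub>k)\<lparr>smult := (\<lambda>h. tensor_map k N C\<^sub>k (\<lambda>n. n) (\<lambda>c. h \<odot>\<^bsub>C\<^esub> c))\<rparr>,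
         \<lambda>x. tensor_assoc_inv k N C\<^sub>k C\<^sub>k
           (tensor_map k N (tensor k C\<^sub>k C\<^sub>k) (\<lambda>n. n) \<Delta>\<^sub>C x))),
      on_hom = (\<lambda>N N' f. tensor_map k N' C\<^sub>k f (\<lambda>c. c))\<rparr>)"

text \<open>
  \<open>(M, \<rho>) \<mapsto> M \<otimes>\<^sub>H k\<close>, where \<open>k\<close> is an \<open>H\<close>-module through the counit \<open>\<epsilon>\<^sub>H\<close>.
\<close>

definition counit_module ::
  "'u ring \<Rightarrow> ('u \<Rightarrow> 'u) \<Rightarrow> ('u, 'u) module" where
  "counit_module k \<epsilon>\<^sub>H = ring.extend k (module.fields (\<lambda>h a. \<epsilon>\<^sub>H h \<otimes>\<^bsub>k\<^esub> a))"

definition coinvariant_functor ::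
  "'u::infinite ring \<Rightarrow> ('u, 'u) module \<Rightarrow> ('u \<Rightarrow> 'u)
    \<Rightarrow> (('u, 'u) module \<times> ('u \<Rightarrow> 'u), ('u, 'u) module, 'u) concrete_functor" where
  "coinvariant_functor k H \<epsilon>\<^sub>H =
    \<lparr>on_obj = (\<lambda>(M, \<rho>). restrict_unit H (tensor H M (counit_module k \<epsilon>\<^sub>H))),
     on_hom = (\<lambda>(M, \<rho>) (M', \<rho>') f. tensor_map H M' (counit_module k \<epsilon>\<^sub>H) f (\<lambda>a. a))\<rparr>"

definition galois_coobject ::
  "'u::infinite ring \<Rightarrow> ('u, 'u) module \<Rightarrow> ('u \<Rightarrow> 'u) \<Rightarrow> ('u \<Rightarrow> 'u)
    \<Rightarrow> ('u, 'u) module \<Rightarrow> ('u \<Rightarrow> 'u) \<Rightarrow> ('u \<Rightarrow> 'u) \<Rightarrow> bool" where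
  "galois_coobject k H \<Delta>\<^sub>H \<epsilon>\<^sub>H C \<Delta>\<^sub>C \<epsilon>\<^sub>C \<longleftrightarrow>
    module_coalgebra k H \<Delta>\<^sub>H \<epsilon>\<^sub>H C \<Delta>\<^sub>C \<epsilon>\<^sub>C \<and>
    inverse_equivalences (module_category k) (hopf_module_category k H \<Delta>\<^sub>H C \<Delta>\<^sub>C \<epsilon>\<^sub>C)
      (free_hopf_module_functor k H C \<Delta>\<^sub>C) (coinvariant_functor k H \<epsilon>\<^sub>H)"

text \<open>\<open>\<delta> (c \<otimes> h) = c\<^sub>1 \<otimes> c\<^sub>2 h\<close> and \<open>ev = (\<epsilon>\<^sub>C \<otimes> H) \<circ> \<delta>\<inverse>\<close>, with \<open>k \<otimes> H\<close> identified with \<open>H\<close>.\<close>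

definition galois_map ::
  "'u::infinite ring \<Rightarrow> ('u, 'u) module \<Rightarrow> ('u, 'u) module \<Rightarrow> ('u \<Rightarrow> 'u) \<Rightarrow> 'u \<Rightarrow> 'u" where
  "galois_map k H C \<Delta>\<^sub>C =
    (let C\<^sub>k = restrict_unit H C in
     tensor_lift (tensor k C\<^sub>k C\<^sub>k)
       (\<lambda>c h. tensor_map k C\<^sub>k C\<^sub>k (\<lambda>a. a) (\<lambda>b. h \<odot>\<^bsub>C\<^esub> b) (\<Delta>\<^sub>C c)))"

definition galois_ev ::
  "'u::infinite ring \<Rightarrow> ('u, 'u) module \<Rightarrow> ('u, 'u) module \<Rightarrow> ('u \<Rightarrow> 'u) \<Rightarrow> ('u \<Rightarrow> 'u)
    \<Rightarrow> 'u \<Rightarrow> 'u" where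
  "galois_ev k H C \<Delta>\<^sub>C \<epsilon>\<^sub>C =
    tensor_lift H (\<lambda>c h. \<epsilon>\<^sub>C c \<odot>\<^bsub>H\<^esub> h)
      \<circ> inv_into (carrier (tensor k (restrict_unit H C) H)) (galois_map k H C \<Delta>\<^sub>C)"


section \<open>Bimodules, formal duals, herds\<close>

record 'u bimodule = "('u, 'u) module" +
  lact :: "'u \<Rightarrow> 'u \<Rightarrow> 'u"
  ract :: "'u \<Rightarrow> 'u \<Rightarrow> 'u"

text \<open>
  \<open>smult\<close> is the action of \<open>k\<close>; \<open>lact T h x = h x\<close> and \<open>ract T x h = x h\<close> both extend it along the
  unit map of \<open>H\<close>.
\<close>

definition is_bimodule ::
  "'u::infinite ring \<Rightarrow> ('u, 'u) module \<Rightarrow> 'u bimodule \<Rightarrow> bool" where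
  "is_bimodule k H T \<longleftrightarrow>
    Module.module k T \<and>
    Module.module H (T\<lparr>smult := lact T\<rparr>) \<and>
    Module.module H (T\<lparr>smult := (\<lambda>h x. ract T x h)\<rparr>) \<and>
    (\<forall>g\<in>carrier H. \<forall>h\<in>carrier H. \<forall>x\<in>carrier T.
      ract T (lact T g x) h = lact T g (ract T x h)) \<and>
    (\<forall>r\<in>carrier k. \<forall>x\<in>carrier T.
      lact T (r \<odot>\<^bsub>H\<^esub> \<one>\<^bsub>H\<^esub>) x = r \<odot>\<^bsub>T\<^esub> x \<and> ract T x (r \<odot>\<^bsub>H\<^esub> \<one>\<^bsub>H\<^esub>) = r \<odot>\<^bsub>T\<^esub> x)"

definition bimodule_maps ::
  "'u ring \<Rightarrow> ('u, 'u) module \<Rightarrow> 'u bimodule \<Rightarrow> 'u bimodule \<Rightarrow> ('u \<Rightarrow> 'u) set" where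
  "bimodule_maps k H T U =
    {f \<in> linear_maps k T U. \<forall>h\<in>carrier H. \<forall>x\<in>carrier T.
      f (lact T h x) = lact U h (f x) \<and> f (ract T x h) = ract U (f x) h}"

definition regular_bimodule :: "('u, 'u) module \<Rightarrow> 'u bimodule" where
  "regular_bimodule H = module.extend H (bimodule.fields (mult H) (mult H))"

definition tensor_bimodule ::
  "'u::infinite ring \<Rightarrow> 'u bimodule \<Rightarrow> 'u bimodule \<Rightarrow> 'u bimodule" where
  "tensor_bimodule k T U =
    module.extend (tensor k T U)
      (bimodule.fields
        (\<lambda>h. tensor_map k T U (lact T h) (\<lambda>u. u))
        (\<lambda>x h. tensor_map k T U (\<lambda>t. t) (\<lambda>u. ract U u h) x))"

locale formal_dual =
  fixes k :: "'u::infinite ring" and H :: "('u, 'u) module"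
    and T :: "'u bimodule" and T' :: "'u bimodule"
    and ev :: "'u \<Rightarrow> 'u" and ev' :: "'u \<Rightarrow> 'u"
  assumes bimodule: "is_bimodule k H T"
    and bimodule_dual: "is_bimodule k H T'"
    and ev_map: "ev \<in> bimodule_maps k H (tensor_bimodule k T' T) (regular_bimodule H)"
    and ev'_map: "ev' \<in> bimodule_maps k H (tensor_bimodule k T T') (regular_bimodule H)"
    and ev'_ev: "x \<in> carrier T \<Longrightarrow> y \<in> carrier T \<Longrightarrow> x' \<in> carrier T' \<Longrightarrow>
      lact T (ev' (pure k T T' x x')) y = ract T x (ev (pure k T' T x' y))"
    and ev_ev': "x \<in> carrier T \<Longrightarrow> x' \<in> carrier T' \<Longrightarrow> y' \<in> carrier T' \<Longrightarrow>
      ract T' x' (ev' (pure k T T' x y')) = lact T' (ev (pure k T' T x' x)) y'"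

text \<open>
  Iterated tensor products are bracketed to the right: \<open>\<gamma>\<close> takes values in \<open>T \<otimes> (T' \<otimes> T)\<close>, and
  the last axiom is an equation in \<open>T \<otimes> (T' \<otimes> (T \<otimes> (T' \<otimes> T)))\<close>, so that the value of
  \<open>\<gamma> \<otimes> T' \<otimes> T\<close> has to be rebracketed from \<open>(T \<otimes> (T' \<otimes> T)) \<otimes> (T' \<otimes> T)\<close>.
\<close>

locale herd = formal_dual k H T T' ev ev'
  for k :: "'u::infinite ring" and H :: "('u, 'u) module"
    and T :: "'u bimodule" and T' :: "'u bimodule"
    and ev :: "'u \<Rightarrow> 'u" and ev' :: "'u \<Rightarrow> 'u" +
  fixes \<gamma> :: "'u \<Rightarrow> 'u"
  assumes shepherd_linear: "\<gamma> \<in> linear_maps k T (tensor k T (tensor k T' T))"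
    and shepherd_left: "x \<in> carrier T \<Longrightarrow>
      tensor_map k H T ev' (\<lambda>t. t) (tensor_assoc_inv k T T' T (\<gamma> x)) = pure k H T \<one>\<^bsub>H\<^esub> x"
    and shepherd_right: "x \<in> carrier T \<Longrightarrow>
      tensor_map k T H (\<lambda>t. t) ev (\<gamma> x) = pure k T H x \<one>\<^bsub>H\<^esub>"
    and shepherd_coassoc: "x \<in> carrier T \<Longrightarrow>
      tensor_map k T (tensor k T' (tensor k T (tensor k T' T)))
        (\<lambda>t. t) (tensor_assoc k T' T (tensor k T' T))
        (tensor_assoc k T (tensor k T' T) (tensor k T' T)
          (tensor_map k (tensor k T (tensor k T' T)) (tensor k T' T) \<gamma> (\<lambda>t. t) (\<gamma> x)))
      = tensor_map k T (tensor k T' (tensor k T (tensor k T' T)))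
          (\<lambda>t. t) (tensor_map k T' (tensor k T (tensor k T' T)) (\<lambda>t. t) \<gamma>) (\<gamma> x)"

text \<open>
  \<open>C\<close> as \<open>H\<close>-bimodule with equal left and right actions, and the bimodule ``\<open>C\<close> hat'' on the same
  \<open>k\<close>-module, on which \<open>h\<close> acts from either side as \<open>S\<inverse> h\<close> does on \<open>C\<close>.
\<close>

definition symmetric_bimodule :: "('u, 'u) module \<Rightarrow> ('u, 'u) module \<Rightarrow> 'u bimodule" where
  "symmetric_bimodule H C =
    module.extend (restrict_unit H C)
      (bimodule.fields (\<lambda>h c. h \<odot>\<^bsub>C\<^esub> c) (\<lambda>c h. h \<odot>\<^bsub>C\<^esub> c))"

definition hat_bimodule ::
  "('u, 'u) module \<Rightarrow> ('u \<Rightarrow> 'u) \<Rightarrow> ('u, 'u) module \<Rightarrow> 'u bimodule" where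
  "hat_bimodule H S C =
    module.extend (restrict_unit H C)
      (bimodule.fields
        (\<lambda>h c. inv_into (carrier H) S h \<odot>\<^bsub>C\<^esub> c)
        (\<lambda>c h. inv_into (carrier H) S h \<odot>\<^bsub>C\<^esub> c))"

definition iterated_comult_left ::
  "'u::infinite ring \<Rightarrow> ('u, 'u, 'x) module_scheme \<Rightarrow> ('u \<Rightarrow> 'u) \<Rightarrow> 'u \<Rightarrow> 'u" where
  "iterated_comult_left k C \<Delta> c =
    tensor_assoc k C C C (tensor_map k (tensor k C C) C \<Delta> (\<lambda>x. x) (\<Delta> c))"

definition iterated_comult_right ::
  "'u::infinite ring \<Rightarrow> ('u, 'u, 'x) module_scheme \<Rightarrow> ('u \<Rightarrow> 'u) \<Rightarrow> 'u \<Rightarrow> 'u" where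
  "iterated_comult_right k C \<Delta> c = tensor_map k C (tensor k C C) (\<lambda>x. x) \<Delta> (\<Delta> c)"

end

theory Submission
  imports Defs
begin

text \<open>
  The functor \<open>- \<otimes> C\<close> enters only through the bijectivity of \<open>\<delta>\<close>. A natural isomorphism between the two
  composites and the identity gives first a \<open>k\<close>-linear isomorphism \<open>C \<otimes>\<^sub>H k \<cong> k\<close>, which
  forces the one induced by \<open>\<epsilon>\<^sub>C\<close> to be bijective, and secondly an isomorphism of the Hopf module \<open>C \<otimes> H\<close>
  with some \<open>N \<otimes> C\<close>. Under the latter \<open>\<delta>\<close> becomes \<open>p \<otimes> C\<close> for a \<open>k\<close>-linear isomorphism \<open>p : N \<rightarrow> C\<close>.

  Since \<open>\<delta>\<close> is surjective, an identity between linear maps on \<open>C \<otimes> C\<close> may be checked on the elements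
  \<open>\<delta> (c \<otimes> h) = c\<^sub>1 \<otimes> c\<^sub>2 h\<close>, where \<open>ev\<close> is \<open>\<epsilon>(c) h\<close>. This yields in turn the linearity of \<open>ev\<close> in the second
  argument, \<open>ev (c h\<^sub>1 \<otimes> d h\<^sub>2) = \<epsilon>(h) ev (c \<otimes> d)\<close>, hence \<open>ev (c h \<otimes> d) = S(h) ev (c \<otimes> d)\<close>, then
  \<open>c\<^sub>1 ev (c\<^sub>2 \<otimes> d) = \<epsilon>(c) d\<close>, and finally \<open>y S(ev (x \<otimes> z)) = x ev (z \<otimes> y)\<close>, which is both duality axioms
  because \<open>S\<close> is an involution. The herd axioms are coassociativity and \<open>ev (c\<^sub>1 \<otimes> c\<^sub>2) = \<epsilon>(c)\<close>.
\<close>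

section \<open>Linear and bilinear maps\<close>

text \<open>The model is \<open>C = H\<close>: there \<delta> has the inverse sending c \<otimes> d
  to c1 \<otimes> S(c2) d, so ev (c \<otimes> d) = S(c) d, and the last identity of the overview
  reads y S(S(x) z) = x S(z) y. A general \<open>C\<close> has neither product nor antipode, so all
  such formulas must be recovered from the values of ev on the image of \<delta>. The obstacle to
  bijectivity of \<delta> is that \<open>inverse_equivalences\<close> provides some isomorphisms,
  not the canonical maps of an adjunction. Even an unknown isomorphism C \<otimes>_H k \<cong> k
  makes every functional on \<open>C\<close> that is equivariant along the counit of
  \<open>H\<close> a multiple of a single one, \<chi>. So the counit of \<open>C\<close> is s \<chi>
  for a scalar s, and the counit law forces s to be invertible. The isomorphism between C \<otimes>
  H and N \<otimes> C may then be arbitrary too: p is what it induces after applying - \<otimes>_H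
  k, and by colinearity p determines the whole map to C \<otimes> C. Tensors are codes of chosen
  representatives, and a sum over \<open>terms x\<close> is independent of that choice only for
  bilinear summands; hence the many linearity conditions.\<close>

lemma linear_mapsI:
  assumes "\<And>x. x \<in> carrier M \<Longrightarrow> f x \<in> carrier N"
    and "\<And>x y. x \<in> carrier M \<Longrightarrow> y \<in> carrier M \<Longrightarrow> f (x \<oplus>\<^bsub>M\<^esub> y) = f x \<oplus>\<^bsub>N\<^esub> f y"
    and "\<And>r x. r \<in> carrier R \<Longrightarrow> x \<in> carrier M \<Longrightarrow> f (r \<odot>\<^bsub>M\<^esub> x) = r \<odot>\<^bsub>N\<^esub> f x"
  shows "f \<in> linear_maps R M N"
  using assms by (auto simp: linear_maps_def)

lemma linear_mapsD:
  assumes "f \<in> linear_maps R M N"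
  shows "x \<in> carrier M \<Longrightarrow> f x \<in> carrier N"
    and "x \<in> carrier M \<Longrightarrow> y \<in> carrier M \<Longrightarrow> f (x \<oplus>\<^bsub>M\<^esub> y) = f x \<oplus>\<^bsub>N\<^esub> f y"
    and "r \<in> carrier R \<Longrightarrow> x \<in> carrier M \<Longrightarrow> f (r \<odot>\<^bsub>M\<^esub> x) = r \<odot>\<^bsub>N\<^esub> f x"
  using assms by (auto simp: linear_maps_def)

lemma linear_map_zero:
  assumes "f \<in> linear_maps R M N" "Module.module R M" "Module.module R N"
  shows "f \<zero>\<^bsub>M\<^esub> = \<zero>\<^bsub>N\<^esub>"
proof -
  interpret M: Module.module R M by fact
  interpret N: Module.module R N by fact
  have "f \<zero>\<^bsub>M\<^esub> = f (\<zero>\<^bsub>R\<^esub> \<odot>\<^bsub>M\<^esub> \<zero>\<^bsub>M\<^esub>)" by simp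
  also have "\<dots> = \<zero>\<^bsub>R\<^esub> \<odot>\<^bsub>N\<^esub> f \<zero>\<^bsub>M\<^esub>"
    by (rule linear_mapsD(3)[OF assms(1)]) simp_all
  also have "\<dots> = \<zero>\<^bsub>N\<^esub>" using linear_mapsD(1)[OF assms(1)] by simp
  finally show ?thesis .
qed

lemma linear_ident: "(\<lambda>x. x) \<in> linear_maps R M M"
  by (simp add: linear_maps_def)

lemma linear_comp:
  assumes "f \<in> linear_maps R N P" "g \<in> linear_maps R M N"
  shows "(\<lambda>x. f (g x)) \<in> linear_maps R M P"
  by (rule linear_mapsI) (simp_all add: linear_mapsD[OF assms(1)] linear_mapsD[OF assms(2)])

lemma (in Module.module) smult_left_commute:
  assumes "r \<in> carrier R" "s \<in> carrier R" "x \<in> carrier M"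
  shows "r \<odot>\<^bsub>M\<^esub> (s \<odot>\<^bsub>M\<^esub> x) = s \<odot>\<^bsub>M\<^esub> (r \<odot>\<^bsub>M\<^esub> x)"
  using assms by (metis R.m_comm smult_assoc1)

lemma linear_smult:
  assumes "f \<in> linear_maps R M N" "r \<in> carrier R" "Module.module R N"
  shows "(\<lambda>x. r \<odot>\<^bsub>N\<^esub> f x) \<in> linear_maps R M N"
proof -
  interpret N: Module.module R N by fact
  show ?thesis
    by (rule linear_mapsI)
      (use assms(2) in \<open>simp_all add: linear_mapsD[OF assms(1)] N.smult_r_distr
        N.smult_left_commute\<close>)
qed

lemma linear_add:
  assumes "f \<in> linear_maps R M N" "g \<in> linear_maps R M N" "Module.module R N"
  shows "(\<lambda>x. f x \<oplus>\<^bsub>N\<^esub> g x) \<in> linear_maps R M N"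
proof -
  interpret N: Module.module R N by fact
  show ?thesis
    by (rule linear_mapsI)
      (simp_all add: linear_mapsD[OF assms(1)] linear_mapsD[OF assms(2)] N.smult_r_distr N.M.a_ac)
qed

lemma linear_inv_into:
  assumes f: "f \<in> linear_maps R M N" and bij: "bij_betw f (carrier M) (carrier N)"
    and M: "Module.module R M"
  shows "inv_into (carrier M) f \<in> linear_maps R N M"
proof -
  interpret M: Module.module R M by fact
  let ?g = "inv_into (carrier M) f"
  have g: "?g y \<in> carrier M" "f (?g y) = y" if "y \<in> carrier N" for y
    using bij that by (simp_all add: bij_betw_def inv_into_into f_inv_into_f)
  have gI: "?g y = x" if "x \<in> carrier M" "f x = y" for x y
    using bij that by (auto simp: bij_betw_def)
  show ?thesis
    by (intro linear_mapsI g gI) (simp_all add: g linear_mapsD[OF f])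
qed

text \<open>Stated as linearity of the two partial maps, so that facts about
  \<open>linear_maps\<close> apply to one argument while the other is fixed.\<close>

definition bilinear_maps ::
  "('r, 'e) ring_scheme \<Rightarrow> ('r, 'm, 'x) module_scheme \<Rightarrow> ('r, 'n, 'y) module_scheme
    \<Rightarrow> ('r, 'p, 'z) module_scheme \<Rightarrow> ('m \<Rightarrow> 'n \<Rightarrow> 'p) set" where
  "bilinear_maps R M N P =
    {b. (\<forall>m\<in>carrier M. (\<lambda>n. b m n) \<in> linear_maps R N P) \<and>
        (\<forall>n\<in>carrier N. (\<lambda>m. b m n) \<in> linear_maps R M P)}"

lemma bilinear_mapsI:
  assumes "\<And>m. m \<in> carrier M \<Longrightarrow> (\<lambda>n. b m n) \<in> linear_maps R N P"
    and "\<And>n. n \<in> carrier N \<Longrightarrow> (\<lambda>m. b m n) \<in> linear_maps R M P"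
  shows "(\<lambda>m n. b m n) \<in> bilinear_maps R M N P"
  using assms by (auto simp: bilinear_maps_def)

lemma bilinear_mapsD:
  assumes "b \<in> bilinear_maps R M N P"
  shows "m \<in> carrier M \<Longrightarrow> (\<lambda>n. b m n) \<in> linear_maps R N P"
    and "n \<in> carrier N \<Longrightarrow> (\<lambda>m. b m n) \<in> linear_maps R M P"
    and "m \<in> carrier M \<Longrightarrow> n \<in> carrier N \<Longrightarrow> b m n \<in> carrier P"
  using assms by (auto simp: bilinear_maps_def dest: linear_mapsD(1))

lemma bilinear_maps_Pi:
  "b \<in> bilinear_maps R M N P \<Longrightarrow> b \<in> carrier M \<rightarrow> carrier N \<rightarrow> carrier P"
  by (auto dest: bilinear_mapsD(3))

text \<open>The inner map \<open>f\<close> gives the rule the shape for backward chaining: linearity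
  of a nested expression in one variable is proved by peeling off one bilinear operation at a
  time.\<close>

lemma linear_bilinear_left:
  assumes "b \<in> bilinear_maps R M N P" "f \<in> linear_maps R Z M" "n \<in> carrier N"
  shows "(\<lambda>z. b (f z) n) \<in> linear_maps R Z P"
  using linear_comp[OF bilinear_mapsD(2)[OF assms(1,3)] assms(2)] .

lemma linear_bilinear_right:
  assumes "b \<in> bilinear_maps R M N P" "f \<in> linear_maps R Z N" "m \<in> carrier M"
  shows "(\<lambda>z. b m (f z)) \<in> linear_maps R Z P"
  using linear_comp[OF bilinear_mapsD(1)[OF assms(1,3)] assms(2)] .

lemma regular_module_simps [simp]:
  "carrier (regular_module k) = carrier k" "add (regular_module k) = add k"
  "zero (regular_module k) = zero k" "mult (regular_module k) = mult k"
  "one (regular_module k) = one k" "smult (regular_module k) = mult k"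
  by (simp_all add: regular_module_def ring.defs module.defs)

lemma regular_module: "cring k \<Longrightarrow> Module.module k (regular_module k)"
proof -
  assume "cring k"
  then interpret cring k .
  have "\<exists>y\<in>carrier k. y \<oplus>\<^bsub>k\<^esub> x = \<zero>\<^bsub>k\<^esub>" if "x \<in> carrier k" for x
    using that by (intro bexI[of _ "\<ominus>\<^bsub>k\<^esub> x"]) (simp_all add: l_neg)
  then show ?thesis
    by (intro moduleI abelian_groupI cring_axioms) (simp_all add: a_ac m_assoc l_distr r_distr)
qed

text \<open>With the base ring viewed as a module over itself, a counit value in scalar position
  becomes an argument in which linearity can be asserted.\<close>

lemma bilinear_smult:
  assumes "Module.module R M"
  shows "(\<lambda>r x. r \<odot>\<^bsub>M\<^esub> x) \<in> bilinear_maps R (regular_module R) M M"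
proof -
  interpret M: Module.module R M by fact
  show ?thesis
    by (intro bilinear_mapsI linear_mapsI)
      (auto simp: regular_module_def ring.defs module.defs M.smult_l_distr M.smult_r_distr
        M.smult_assoc1 M.smult_left_commute)
qed

lemma linear_scalar:
  assumes "f \<in> linear_maps k Z (regular_module k)" "Module.module k P" "x \<in> carrier P"
  shows "(\<lambda>z. f z \<odot>\<^bsub>P\<^esub> x) \<in> linear_maps k Z P"
  by (rule linear_bilinear_left[OF bilinear_smult[OF assms(2)] assms(1,3)])

section \<open>Sums over formal sums of pairs\<close>

declare in_lists_conv_set [simp del] in_listsD [rule del] in_listsI [rule del]

text \<open>This is \<open>tensor_lift\<close> with the list made explicit. Identities are proved by
  induction on an arbitrary list and then applied to the stored representative.\<close>

definition pair_sum :: "('u, 'x) ring_scheme \<Rightarrow> ('a \<Rightarrow> 'b \<Rightarrow> 'u) \<Rightarrow> ('a \<times> 'b) list \<Rightarrow> 'u" where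
  "pair_sum P b xs = foldr (\<lambda>(m, n) s. b m n \<oplus>\<^bsub>P\<^esub> s) xs \<zero>\<^bsub>P\<^esub>"

lemma pair_sum_simps [simp]:
  "pair_sum P b [] = \<zero>\<^bsub>P\<^esub>"
  "pair_sum P b ((m, n) # xs) = b m n \<oplus>\<^bsub>P\<^esub> pair_sum P b xs"
  by (simp_all add: pair_sum_def)

lemma tensor_lift_pair_sum: "tensor_lift P b x = pair_sum P b (terms x)"
  by (simp add: tensor_lift_def pair_sum_def)

lemma pair_list_induct [consumes 1, case_names Nil Cons]:
  assumes "xs \<in> lists (A \<times> B)" "Q []"
    and "\<And>a b xs. a \<in> A \<Longrightarrow> b \<in> B \<Longrightarrow> xs \<in> lists (A \<times> B) \<Longrightarrow> Q xs \<Longrightarrow> Q ((a, b) # xs)"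
  shows "Q xs"
  using assms(1) by (induction rule: lists.induct) (use assms(2,3) in blast)+

lemma map_fst_in_lists:
  assumes "xs \<in> lists (A \<times> B)" "\<And>m. m \<in> A \<Longrightarrow> g m \<in> A"
  shows "map (\<lambda>(m, n). (g m, n)) xs \<in> lists (A \<times> B)"
  using assms(1) by (induction rule: pair_list_induct) (simp_all add: assms(2))

lemma pair_sum_cong:
  assumes "xs \<in> lists (A \<times> B)" "\<And>a b. a \<in> A \<Longrightarrow> b \<in> B \<Longrightarrow> f a b = g a b"
  shows "pair_sum P f xs = pair_sum P g xs"
  using assms(1) by (induction xs) (auto simp: assms(2))

lemma pair_sum_closed:
  assumes "abelian_monoid P" "f \<in> A \<rightarrow> B \<rightarrow> carrier P" "xs \<in> lists (A \<times> B)"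
  shows "pair_sum P f xs \<in> carrier P"
proof -
  interpret abelian_monoid P by fact
  show ?thesis using assms(3) assms(2)
    by (induction rule: pair_list_induct) (simp_all add: Pi_iff)
qed

lemma pair_sum_append:
  assumes "abelian_monoid P" "f \<in> A \<rightarrow> B \<rightarrow> carrier P" "xs \<in> lists (A \<times> B)" "ys \<in> lists (A \<times> B)"
  shows "pair_sum P f (xs @ ys) = pair_sum P f xs \<oplus>\<^bsub>P\<^esub> pair_sum P f ys"
proof -
  interpret abelian_monoid P by fact
  note closed = pair_sum_closed[OF assms(1,2)]
  show ?thesis using assms(3) assms(2)
    by (induction rule: pair_list_induct)
      (simp_all add: Pi_iff closed assms(4) a_assoc)
qed

lemma pair_sum_add:
  assumes "abelian_monoid P" "f \<in> A \<rightarrow> B \<rightarrow> carrier P" "g \<in> A \<rightarrow> B \<rightarrow> carrier P"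
    and "xs \<in> lists (A \<times> B)"
  shows "pair_sum P (\<lambda>a b. f a b \<oplus>\<^bsub>P\<^esub> g a b) xs = pair_sum P f xs \<oplus>\<^bsub>P\<^esub> pair_sum P g xs"
proof -
  interpret abelian_monoid P by fact
  note closed = pair_sum_closed[OF assms(1,2)] pair_sum_closed[OF assms(1,3)]
  show ?thesis using assms(4) assms(2,3)
    by (induction rule: pair_list_induct)
      (simp_all add: Pi_iff closed a_ac)
qed

lemma pair_sum_zero:
  assumes "abelian_monoid P"
  shows "pair_sum P (\<lambda>a b. \<zero>\<^bsub>P\<^esub>) xs = \<zero>\<^bsub>P\<^esub>"
proof -
  interpret abelian_monoid P by fact
  show ?thesis by (induction xs) auto
qed

lemma linear_pair_sum:
  assumes "g \<in> linear_maps R P Q" "Module.module R P" "Module.module R Q"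
    and "f \<in> A \<rightarrow> B \<rightarrow> carrier P" "xs \<in> lists (A \<times> B)"
  shows "g (pair_sum P f xs) = pair_sum Q (\<lambda>a b. g (f a b)) xs"
proof -
  interpret P: Module.module R P by fact
  note closed = pair_sum_closed[OF P.abelian_monoid_axioms assms(4)]
  show ?thesis using assms(5,4)
    by (induction rule: pair_list_induct)
      (simp_all add: linear_map_zero[OF assms(1,2,3)] linear_mapsD[OF assms(1)]
        Pi_iff closed)
qed

text \<open>Interchange of two finite sums, needed when the coproducts of two coalgebras occur
  nested.\<close>

lemma pair_sum_swap:
  assumes "abelian_monoid P" "f \<in> A \<rightarrow> B \<rightarrow> A' \<rightarrow> B' \<rightarrow> carrier P"
    and "xs \<in> lists (A \<times> B)" and ys: "ys \<in> lists (A' \<times> B')"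
  shows "pair_sum P (\<lambda>a b. pair_sum P (\<lambda>c d. f a b c d) ys) xs
    = pair_sum P (\<lambda>c d. pair_sum P (\<lambda>a b. f a b c d) xs) ys"
  using assms(3)
proof (induction rule: pair_list_induct)
  case Nil
  then show ?case by (simp add: pair_sum_zero[OF assms(1)])
next
  case (Cons a b xs)
  have "(\<lambda>c d. pair_sum P (\<lambda>a b. f a b c d) xs) \<in> A' \<rightarrow> B' \<rightarrow> carrier P"
  proof (intro Pi_I)
    fix c d assume "c \<in> A'" "d \<in> B'"
    then show "pair_sum P (\<lambda>a b. f a b c d) xs \<in> carrier P"
      using assms(2) by (intro pair_sum_closed[OF assms(1) _ Cons.hyps(3)]) auto
  qed
  moreover have "f a b \<in> A' \<rightarrow> B' \<rightarrow> carrier P" using assms(2) Cons by auto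
  ultimately have "pair_sum P (\<lambda>c d. f a b c d \<oplus>\<^bsub>P\<^esub> pair_sum P (\<lambda>a b. f a b c d) xs) ys
    = pair_sum P (\<lambda>c d. f a b c d) ys
      \<oplus>\<^bsub>P\<^esub> pair_sum P (\<lambda>c d. pair_sum P (\<lambda>a b. f a b c d) xs) ys"
    by (intro pair_sum_add[OF assms(1) _ _ ys])
  then show ?case using Cons by simp
qed

section \<open>Tensor products\<close>

lemma tensor_eq_lists:
  assumes "tensor_eq R M N xs ys" "Module.module R M" "Module.module R N"
  shows "xs \<in> lists (carrier M \<times> carrier N) \<and> ys \<in> lists (carrier M \<times> carrier N)"
proof -
  interpret M: Module.module R M by fact
  interpret N: Module.module R N by fact
  show ?thesis using assms(1) by induction auto
qed

text \<open>Each generating relation of the congruence is respected by a bilinear \<open>b\<close>.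
  This is what makes \<open>tensor_lift\<close> meaningful although it is defined through a chosen
  list.\<close>

lemma tensor_eq_pair_sum:
  assumes "tensor_eq R M N xs ys" "Module.module R M" "Module.module R N" "Module.module R P"
    and b: "b \<in> bilinear_maps R M N P"
  shows "pair_sum P b xs = pair_sum P b ys"
proof -
  interpret M: Module.module R M by fact
  interpret N: Module.module R N by fact
  interpret P: Module.module R P by fact
  note lists = tensor_eq_lists[OF _ assms(2,3)]
  note closed = bilinear_mapsD(3)[OF b]
  note app = pair_sum_append[OF P.abelian_monoid_axioms bilinear_maps_Pi[OF b]]
  note cl = pair_sum_closed[OF P.abelian_monoid_axioms bilinear_maps_Pi[OF b]]
  show ?thesis using assms(1)
  proof induction
    case (append xs xs' ys ys')
    then show ?case using lists by (simp add: app)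
  next
    case (comm xs ys)
    then show ?case by (simp add: app P.a_comm cl)
  next
    case (add_left m m' n)
    then show ?case using linear_mapsD(2)[OF bilinear_mapsD(2)[OF b]] closed by simp
  next
    case (add_right m n n')
    then show ?case using linear_mapsD(2)[OF bilinear_mapsD(1)[OF b]] closed by simp
  next
    case (zero_left n)
    then show ?case
      using linear_map_zero[OF bilinear_mapsD(2)[OF b] assms(2,4)] by simp
  next
    case (zero_right n)
    then show ?case
      using linear_map_zero[OF bilinear_mapsD(1)[OF b] assms(3,4)] by simp
  next
    case (balanced r m n)
    then show ?case
      using linear_mapsD(3)[OF bilinear_mapsD(1)[OF b]] linear_mapsD(3)[OF bilinear_mapsD(2)[OF b]]
        closed by simp
  qed auto
qed

section \<open>The module structure on classes of formal sums\<close>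

lemma terms_encode [simp]: "terms (encode xs) = xs"
  by (simp add: terms_def inj_encode inv_f_f)

context
  fixes R :: "('u::infinite, 'e) ring_scheme" and M :: "('u, 'u, 'x) module_scheme"
    and N :: "('u, 'u, 'y) module_scheme"
  assumes M: "Module.module R M" and N: "Module.module R N"
begin

interpretation M: Module.module R M by (fact M)
interpretation N: Module.module R N by (fact N)

text \<open>The stored list is one that \<open>SOME\<close> picks from the class, in general not the
  list given to \<open>tensor_sum\<close>. Equivalence with the given list is all that can be said
  about it.\<close>

lemma tensor_eq_terms:
  assumes "xs \<in> lists (carrier M \<times> carrier N)"
  shows "tensor_eq R M N xs (terms (tensor_sum R M N xs))"
  unfolding tensor_sum_def terms_encode
  by (rule someI[of "tensor_eq R M N xs"]) (rule tensor_eq.refl[OF assms])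

text \<open>Equivalent lists define the same predicate \<open>tensor_eq R M N xs\<close>, so
  \<open>SOME\<close> makes the same choice for both and the codes are equal.\<close>

lemma tensor_sum_eqI: "tensor_eq R M N xs ys \<Longrightarrow> tensor_sum R M N xs = tensor_sum R M N ys"
proof -
  assume *: "tensor_eq R M N xs ys"
  then have "tensor_eq R M N xs = tensor_eq R M N ys"
    by (blast intro: tensor_eq.sym tensor_eq.trans)
  then show ?thesis by (simp add: tensor_sum_def)
qed

lemma terms_in_lists:
  assumes "x \<in> carrier (tensor R M N)"
  shows "terms x \<in> lists (carrier M \<times> carrier N)"
  using assms tensor_eq_lists[OF tensor_eq_terms M N] by (auto simp: tensor_def)

lemma tensor_sum_closed:
  "xs \<in> lists (carrier M \<times> carrier N) \<Longrightarrow> tensor_sum R M N xs \<in> carrier (tensor R M N)"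
  by (simp add: tensor_def)

lemma tensor_sum_append:
  assumes "xs \<in> lists (carrier M \<times> carrier N)" "ys \<in> lists (carrier M \<times> carrier N)"
  shows "tensor_sum R M N xs \<oplus>\<^bsub>tensor R M N\<^esub> tensor_sum R M N ys = tensor_sum R M N (xs @ ys)"
  using tensor_sum_eqI[OF tensor_eq.append[OF tensor_eq_terms[OF assms(1)] tensor_eq_terms[OF assms(2)]]]
  by (simp add: tensor_def)

lemma tensor_lift_sum:
  assumes "Module.module R P" "b \<in> bilinear_maps R M N P" "xs \<in> lists (carrier M \<times> carrier N)"
  shows "tensor_lift P b (tensor_sum R M N xs) = pair_sum P b xs"
  using tensor_eq_pair_sum[OF tensor_eq_terms[OF assms(3)] M N assms(1,2)]
  by (simp add: tensor_lift_pair_sum)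

lemma pure_closed:
  "m \<in> carrier M \<Longrightarrow> n \<in> carrier N \<Longrightarrow> pure R M N m n \<in> carrier (tensor R M N)"
  by (simp add: tensor_sum_closed)

lemma tensor_sum_cases:
  assumes "x \<in> carrier (tensor R M N)"
  obtains xs where "xs \<in> lists (carrier M \<times> carrier N)" "x = tensor_sum R M N xs"
  using assms by (auto simp: tensor_def)

text \<open>Induction on the length of a formal sum. Scalar multiples need no case of their own,
  since a multiple of a pure tensor is pure.\<close>

lemma tensor_induct [consumes 1, case_names zero pure add]:
  assumes "x \<in> carrier (tensor R M N)"
    and "Q \<zero>\<^bsub>tensor R M N\<^esub>"
    and "\<And>m n. m \<in> carrier M \<Longrightarrow> n \<in> carrier N \<Longrightarrow> Q (pure R M N m n)"
    and "\<And>x y. x \<in> carrier (tensor R M N) \<Longrightarrow> y \<in> carrier (tensor R M N) \<Longrightarrow> Q x \<Longrightarrow> Q y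
      \<Longrightarrow> Q (x \<oplus>\<^bsub>tensor R M N\<^esub> y)"
  shows "Q x"
proof -
  obtain xs where xs: "xs \<in> lists (carrier M \<times> carrier N)" "x = tensor_sum R M N xs"
    using tensor_sum_cases[OF assms(1)] .
  have "Q (tensor_sum R M N xs)" using xs(1)
  proof (induction xs)
    case Nil
    then show ?case using assms(2) by (simp add: tensor_def)
  next
    case (Cons p xs)
    obtain m n where p: "p = (m, n)" by (cases p)
    then have "tensor_sum R M N (p # xs) = pure R M N m n \<oplus>\<^bsub>tensor R M N\<^esub> tensor_sum R M N xs"
      using Cons by (simp add: tensor_sum_append)
    moreover have "m \<in> carrier M" "n \<in> carrier N" "xs \<in> lists (carrier M \<times> carrier N)"
      using Cons p by auto
    ultimately show ?case
      using Cons by (simp add: assms(3,4) pure_closed tensor_sum_closed)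
  qed
  then show ?thesis using xs by simp
qed

text \<open>Negatives are not among the generating relations. They come from additivity in the left
  factor together with \<open>\<ominus> m \<oplus> m = \<zero>\<close> and
  \<open>zero_left\<close>.\<close>

lemma tensor_eq_inverse:
  assumes "xs \<in> lists (carrier M \<times> carrier N)"
  shows "tensor_eq R M N (map (\<lambda>(m, n). (\<ominus>\<^bsub>M\<^esub> m, n)) xs @ xs) []"
  using assms
proof (induction xs)
  case Nil
  then show ?case using tensor_eq.refl[of "[]"] by simp
next
  case (Cons p xs)
  obtain m n where p: "p = (m, n)" "m \<in> carrier M" "n \<in> carrier N" using Cons by auto
  let ?ys = "map (\<lambda>(m, n). (\<ominus>\<^bsub>M\<^esub> m, n)) xs"
  have ys: "?ys \<in> lists (carrier M \<times> carrier N)" using Cons(2) by (simp add: map_fst_in_lists)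
  have "tensor_eq R M N [(\<ominus>\<^bsub>M\<^esub> m, n), (m, n)] [(\<ominus>\<^bsub>M\<^esub> m \<oplus>\<^bsub>M\<^esub> m, n)]"
    by (rule tensor_eq.sym, rule tensor_eq.add_left) (use p in auto)
  then have 1: "tensor_eq R M N [(\<ominus>\<^bsub>M\<^esub> m, n), (m, n)] []"
    using p tensor_eq.zero_left[of n N R M] by (auto simp: M.l_neg intro: tensor_eq.trans)
  \<comment> \<open>Moves the pair next to its own negative, past the negatives of the other
    entries.\<close>
  have "tensor_eq R M N (?ys @ [(m, n)]) ([(m, n)] @ ?ys)"
    by (rule tensor_eq.comm) (use p ys in auto)
  from tensor_eq.append[OF tensor_eq.append[OF tensor_eq.refl[of "[(\<ominus>\<^bsub>M\<^esub> m, n)]"] this]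
      tensor_eq.refl[of xs]]
  have "tensor_eq R M N (([(\<ominus>\<^bsub>M\<^esub> m, n)] @ (?ys @ [(m, n)])) @ xs)
      (([(\<ominus>\<^bsub>M\<^esub> m, n)] @ ([(m, n)] @ ?ys)) @ xs)"
    using p Cons(2) by simp
  moreover have "tensor_eq R M N ([(\<ominus>\<^bsub>M\<^esub> m, n), (m, n)] @ (?ys @ xs)) ([] @ [])"
    by (rule tensor_eq.append[OF 1 Cons.IH])
  ultimately show ?case using p by (auto intro: tensor_eq.trans)
qed

text \<open>Makes the scalar action, which is computed on the stored list, well defined on classes.
  In the balanced relation two scalars change places, which is where commutativity of
  \<open>R\<close> enters.\<close>

lemma tensor_eq_smult:
  assumes "tensor_eq R M N xs ys" "r \<in> carrier R"
  shows "tensor_eq R M N (map (\<lambda>(m, n). (r \<odot>\<^bsub>M\<^esub> m, n)) xs) (map (\<lambda>(m, n). (r \<odot>\<^bsub>M\<^esub> m, n)) ys)"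
  using assms(1)
proof induction
  case (balanced s m n)
  then show ?case
    using tensor_eq.balanced[of s R "r \<odot>\<^bsub>M\<^esub> m" M n N] assms(2)
    by (simp add: M.R.m_comm flip: M.smult_assoc1)
next
  case (add_left m m' n)
  then show ?case
    using tensor_eq.add_left[of "r \<odot>\<^bsub>M\<^esub> m" M "r \<odot>\<^bsub>M\<^esub> m'" n N R] assms(2)
    by (simp add: M.smult_r_distr)
next
  case (refl xs)
  then show ?case using assms(2) by (simp add: tensor_eq.refl map_fst_in_lists)
next
  case (comm xs ys)
  then show ?case
    using assms(2) by (simp add: tensor_eq.comm map_fst_in_lists)
next
  case (append xs xs' ys ys')
  then show ?case by (simp add: tensor_eq.append)
qed (use assms(2) in \<open>auto intro: tensor_eq.intros\<close>)

lemma tensor_smult_sum: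
  assumes "xs \<in> lists (carrier M \<times> carrier N)" "r \<in> carrier R"
  shows "r \<odot>\<^bsub>tensor R M N\<^esub> tensor_sum R M N xs
    = tensor_sum R M N (map (\<lambda>(m, n). (r \<odot>\<^bsub>M\<^esub> m, n)) xs)"
  using tensor_sum_eqI[OF tensor_eq_smult[OF tensor_eq_terms[OF assms(1)] assms(2)]]
  by (simp add: tensor_def)

lemma tensor_abelian_group: "abelian_group (tensor R M N)"
proof (rule abelian_groupI)
  let ?L = "lists (carrier M \<times> carrier N)"
  have zero: "\<zero>\<^bsub>tensor R M N\<^esub> = tensor_sum R M N []" by (simp add: tensor_def)
  show "\<zero>\<^bsub>tensor R M N\<^esub> \<in> carrier (tensor R M N)" by (simp add: zero tensor_sum_closed)
  fix x assume "x \<in> carrier (tensor R M N)"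
  then obtain xs where xs: "xs \<in> ?L" "x = tensor_sum R M N xs" by (rule tensor_sum_cases)
  show "\<zero>\<^bsub>tensor R M N\<^esub> \<oplus>\<^bsub>tensor R M N\<^esub> x = x"
    using xs by (simp add: zero tensor_sum_append)
  show "\<exists>y\<in>carrier (tensor R M N). y \<oplus>\<^bsub>tensor R M N\<^esub> x = \<zero>\<^bsub>tensor R M N\<^esub>"
  proof (rule bexI)
    have n: "map (\<lambda>(m, n). (\<ominus>\<^bsub>M\<^esub> m, n)) xs \<in> ?L" using xs by (simp add: map_fst_in_lists)
    then show "tensor_sum R M N (map (\<lambda>(m, n). (\<ominus>\<^bsub>M\<^esub> m, n)) xs) \<in> carrier (tensor R M N)"
      by (rule tensor_sum_closed)
    show "tensor_sum R M N (map (\<lambda>(m, n). (\<ominus>\<^bsub>M\<^esub> m, n)) xs) \<oplus>\<^bsub>tensor R M N\<^esub> x = \<zero>\<^bsub>tensor R M N\<^esub>"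
      using xs n tensor_sum_eqI[OF tensor_eq_inverse[OF xs(1)]] by (simp add: zero tensor_sum_append)
  qed
  fix y assume "y \<in> carrier (tensor R M N)"
  then obtain ys where ys: "ys \<in> ?L" "y = tensor_sum R M N ys" by (rule tensor_sum_cases)
  show "x \<oplus>\<^bsub>tensor R M N\<^esub> y \<in> carrier (tensor R M N)"
    using xs ys by (simp add: tensor_sum_append tensor_sum_closed)
  show "x \<oplus>\<^bsub>tensor R M N\<^esub> y = y \<oplus>\<^bsub>tensor R M N\<^esub> x"
    using xs ys tensor_sum_eqI[OF tensor_eq.comm] by (simp add: tensor_sum_append)
  fix z assume "z \<in> carrier (tensor R M N)"
  then obtain zs where zs: "zs \<in> ?L" "z = tensor_sum R M N zs" by (rule tensor_sum_cases)
  show "x \<oplus>\<^bsub>tensor R M N\<^esub> y \<oplus>\<^bsub>tensor R M N\<^esub> z = x \<oplus>\<^bsub>tensor R M N\<^esub> (y \<oplus>\<^bsub>tensor R M N\<^esub> z)"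
    using xs ys zs by (simp add: tensor_sum_append)
qed

lemma pure_add_left:
  "m \<in> carrier M \<Longrightarrow> m' \<in> carrier M \<Longrightarrow> n \<in> carrier N
    \<Longrightarrow> pure R M N (m \<oplus>\<^bsub>M\<^esub> m') n = pure R M N m n \<oplus>\<^bsub>tensor R M N\<^esub> pure R M N m' n"
  using tensor_sum_eqI[OF tensor_eq.add_left] by (simp add: tensor_sum_append)

lemma pure_add_right:
  "m \<in> carrier M \<Longrightarrow> n \<in> carrier N \<Longrightarrow> n' \<in> carrier N
    \<Longrightarrow> pure R M N m (n \<oplus>\<^bsub>N\<^esub> n') = pure R M N m n \<oplus>\<^bsub>tensor R M N\<^esub> pure R M N m n'"
  using tensor_sum_eqI[OF tensor_eq.add_right] by (simp add: tensor_sum_append)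

lemma pure_smult_left:
  "r \<in> carrier R \<Longrightarrow> m \<in> carrier M \<Longrightarrow> n \<in> carrier N
    \<Longrightarrow> pure R M N (r \<odot>\<^bsub>M\<^esub> m) n = r \<odot>\<^bsub>tensor R M N\<^esub> pure R M N m n"
  by (simp add: tensor_smult_sum)

lemma pure_balanced:
  "r \<in> carrier R \<Longrightarrow> m \<in> carrier M \<Longrightarrow> n \<in> carrier N
    \<Longrightarrow> pure R M N m (r \<odot>\<^bsub>N\<^esub> n) = pure R M N (r \<odot>\<^bsub>M\<^esub> m) n"
  using tensor_sum_eqI[OF tensor_eq.balanced] by simp

lemma tensor_module: "Module.module R (tensor R M N)"
proof (rule moduleI)
  show "cring R" by (rule M.R.cring_axioms)
  show "abelian_group (tensor R M N)" by (rule tensor_abelian_group)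
  interpret T: abelian_group "tensor R M N" by (rule tensor_abelian_group)
  let ?L = "lists (carrier M \<times> carrier N)"
  have cl: "map (\<lambda>(m, n). (r \<odot>\<^bsub>M\<^esub> m, n)) xs \<in> ?L" if "xs \<in> ?L" "r \<in> carrier R" for xs r
    using that by (simp add: map_fst_in_lists)
  show closed: "a \<odot>\<^bsub>tensor R M N\<^esub> x \<in> carrier (tensor R M N)"
    if "a \<in> carrier R" "x \<in> carrier (tensor R M N)" for a x
    using that(2,1)
    by (elim tensor_sum_cases) (simp add: tensor_smult_sum tensor_sum_closed cl)
  show tadd: "a \<odot>\<^bsub>tensor R M N\<^esub> (x \<oplus>\<^bsub>tensor R M N\<^esub> y)
      = a \<odot>\<^bsub>tensor R M N\<^esub> x \<oplus>\<^bsub>tensor R M N\<^esub> a \<odot>\<^bsub>tensor R M N\<^esub> y"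
    if "a \<in> carrier R" "x \<in> carrier (tensor R M N)" "y \<in> carrier (tensor R M N)" for a x y
    using that(2,3,1)
    by (elim tensor_sum_cases) (simp add: tensor_smult_sum tensor_sum_append cl)
  have tzero: "a \<odot>\<^bsub>tensor R M N\<^esub> \<zero>\<^bsub>tensor R M N\<^esub> = \<zero>\<^bsub>tensor R M N\<^esub>" if "a \<in> carrier R" for a
  proof -
    have "\<zero>\<^bsub>tensor R M N\<^esub> = tensor_sum R M N []" by (simp add: tensor_def)
    then show ?thesis using that by (simp add: tensor_smult_sum)
  qed
  note tpure = pure_smult_left[symmetric] pure_closed
  \<comment> \<open>Not an identity between lists: scaling termwise gives one entry on the left
    where the right side has two. Hence the induction down to pure tensors.\<close>
  show "(a \<oplus>\<^bsub>R\<^esub> b) \<odot>\<^bsub>tensor R M N\<^esub> x = a \<odot>\<^bsub>tensor R M N\<^esub> x \<oplus>\<^bsub>tensor R M N\<^esub> b \<odot>\<^bsub>tensor R M N\<^esub> x"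
    if ab: "a \<in> carrier R" "b \<in> carrier R" and x: "x \<in> carrier (tensor R M N)" for a b x
    using x
  proof (induction rule: tensor_induct)
    case zero
    then show ?case using ab by (simp add: tzero)
  next
    case (pure m n)
    then show ?case using ab by (simp add: tpure M.smult_l_distr pure_add_left)
  next
    case (add x y)
    then show ?case using ab by (simp add: tadd add closed T.a_ac)
  qed
  show "(a \<otimes>\<^bsub>R\<^esub> b) \<odot>\<^bsub>tensor R M N\<^esub> x = a \<odot>\<^bsub>tensor R M N\<^esub> (b \<odot>\<^bsub>tensor R M N\<^esub> x)"
    if ab: "a \<in> carrier R" "b \<in> carrier R" and x: "x \<in> carrier (tensor R M N)" for a b x
    using x
  proof (induction rule: tensor_induct)
    case zero
    then show ?case using ab by (simp add: tzero)
  next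
    case (pure m n)
    then show ?case using ab by (simp add: tpure M.smult_assoc1)
  next
    case (add x y)
    then show ?case using ab by (simp add: tadd add closed)
  qed
  show "\<one>\<^bsub>R\<^esub> \<odot>\<^bsub>tensor R M N\<^esub> x = x" if x: "x \<in> carrier (tensor R M N)" for x
    using x
  proof (induction rule: tensor_induct)
    case zero
    then show ?case by (simp add: tzero)
  next
    case (pure m n)
    then show ?case by (simp add: tpure)
  next
    case (add x y)
    then show ?case by (simp add: tadd add)
  qed
qed

interpretation T: Module.module R "tensor R M N" by (rule tensor_module)

section \<open>The universal property\<close>

lemma bilinear_pure: "(\<lambda>m n. pure R M N m n) \<in> bilinear_maps R M N (tensor R M N)"
  by (intro bilinear_mapsI linear_mapsI)
    (simp_all add: pure_closed pure_add_left pure_add_right pure_smult_left pure_balanced)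

lemma tensor_lift_closed:
  assumes "abelian_monoid P" "x \<in> carrier (tensor R M N)"
    and "\<And>m n. m \<in> carrier M \<Longrightarrow> n \<in> carrier N \<Longrightarrow> b m n \<in> carrier P"
  shows "tensor_lift P b x \<in> carrier P"
  unfolding tensor_lift_pair_sum
  by (rule pair_sum_closed[OF assms(1) _ terms_in_lists[OF assms(2)]]) (simp add: assms(3))

lemma tensor_lift_cong:
  assumes "x \<in> carrier (tensor R M N)"
    and "\<And>m n. m \<in> carrier M \<Longrightarrow> n \<in> carrier N \<Longrightarrow> b m n = b' m n"
  shows "tensor_lift P b x = tensor_lift P b' x"
  unfolding tensor_lift_pair_sum
  by (rule pair_sum_cong[OF terms_in_lists[OF assms(1)] assms(2)])

lemma linear_tensor_lift:
  assumes P: "Module.module R P" and b: "b \<in> bilinear_maps R M N P"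
  shows "tensor_lift P b \<in> linear_maps R (tensor R M N) P"
proof (rule linear_mapsI)
  interpret P: Module.module R P by fact
  note closed = bilinear_mapsD(3)[OF b]
  show "tensor_lift P b x \<in> carrier P" if "x \<in> carrier (tensor R M N)" for x
    using that by (intro tensor_lift_closed[OF P.abelian_monoid_axioms] closed)
  show "tensor_lift P b (x \<oplus>\<^bsub>tensor R M N\<^esub> y) = tensor_lift P b x \<oplus>\<^bsub>P\<^esub> tensor_lift P b y"
    if "x \<in> carrier (tensor R M N)" "y \<in> carrier (tensor R M N)" for x y
    using that
    by (elim tensor_sum_cases)
      (simp add: tensor_sum_append tensor_lift_sum[OF P b] pair_sum_append[OF P.abelian_monoid_axioms bilinear_maps_Pi[OF b]])
  show "tensor_lift P b (r \<odot>\<^bsub>tensor R M N\<^esub> x) = r \<odot>\<^bsub>P\<^esub> tensor_lift P b x"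
    if r: "r \<in> carrier R" and x: "x \<in> carrier (tensor R M N)" for r x
  proof -
    obtain xs where xs: "xs \<in> lists (carrier M \<times> carrier N)" "x = tensor_sum R M N xs"
      using tensor_sum_cases[OF x] .
    have "map (\<lambda>(m, n). (r \<odot>\<^bsub>M\<^esub> m, n)) xs \<in> lists (carrier M \<times> carrier N)"
      using xs r by (simp add: map_fst_in_lists)
    moreover have "pair_sum P b (map (\<lambda>(m, n). (r \<odot>\<^bsub>M\<^esub> m, n)) xs) = r \<odot>\<^bsub>P\<^esub> pair_sum P b xs"
      using xs(1)
      by (induction rule: pair_list_induct)
        (simp_all add: r linear_mapsD(3)[OF bilinear_mapsD(2)[OF b]] P.smult_r_distr closed
          pair_sum_closed[OF P.abelian_monoid_axioms bilinear_maps_Pi[OF b]])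
    ultimately show ?thesis using xs r by (simp add: tensor_smult_sum tensor_lift_sum[OF P b])
  qed
qed

lemma tensor_lift_pure:
  assumes "Module.module R P" "b \<in> bilinear_maps R M N P" "m \<in> carrier M" "n \<in> carrier N"
  shows "tensor_lift P b (pure R M N m n) = b m n"
proof -
  interpret P: Module.module R P by fact
  show ?thesis using assms by (simp add: tensor_lift_sum bilinear_mapsD(3))
qed

text \<open>A linear map commutes with the finite sum over the stored list. The ring
  \<open>R'\<close> of \<open>g\<close> may differ from the ring over which the tensor product is
  formed.\<close>

lemma linear_of_tensor_lift:
  assumes "g \<in> linear_maps R' P Q" "Module.module R' P" "Module.module R' Q"
    and "x \<in> carrier (tensor R M N)"
    and "\<And>m n. m \<in> carrier M \<Longrightarrow> n \<in> carrier N \<Longrightarrow> b m n \<in> carrier P"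
  shows "g (tensor_lift P b x) = tensor_lift Q (\<lambda>m n. g (b m n)) x"
  unfolding tensor_lift_pair_sum
  by (rule linear_pair_sum[OF assms(1-3) _ terms_in_lists[OF assms(4)]]) (simp add: assms(5))

text \<open>Linearity in a parameter of the summand rather than in the tensor: the tool for
  multilinearity of nested sums.\<close>

lemma linear_tensor_lift_param:
  assumes "Module.module R' P" "x \<in> carrier (tensor R M N)"
    and "\<And>m n. m \<in> carrier M \<Longrightarrow> n \<in> carrier N \<Longrightarrow> (\<lambda>z. b z m n) \<in> linear_maps R' Z P"
  shows "(\<lambda>z. tensor_lift P (b z) x) \<in> linear_maps R' Z P"
proof (rule linear_mapsI)
  interpret P: Module.module R' P by fact
  note cl = linear_mapsD(1)[OF assms(3)]
  show "tensor_lift P (b z) x \<in> carrier P" if "z \<in> carrier Z" for z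
    by (rule tensor_lift_closed[OF P.abelian_monoid_axioms assms(2) cl]) (use that in auto)
  note xs = terms_in_lists[OF assms(2)]
  show "tensor_lift P (b (y \<oplus>\<^bsub>Z\<^esub> z)) x = tensor_lift P (b y) x \<oplus>\<^bsub>P\<^esub> tensor_lift P (b z) x"
    if "y \<in> carrier Z" "z \<in> carrier Z" for y z
    unfolding tensor_lift_pair_sum using that xs
    by (subst pair_sum_add[OF P.abelian_monoid_axioms _ _ xs, symmetric])
      (auto intro!: cl pair_sum_cong[OF xs] linear_mapsD(2)[OF assms(3)])
  show "tensor_lift P (b (r \<odot>\<^bsub>Z\<^esub> z)) x = r \<odot>\<^bsub>P\<^esub> tensor_lift P (b z) x"
    if "r \<in> carrier R'" "z \<in> carrier Z" for r z
    unfolding tensor_lift_pair_sum using that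
    by (subst linear_pair_sum[OF linear_smult[OF linear_ident] _ _ _ xs])
      (auto intro!: cl assms(1) pair_sum_cong[OF xs] linear_mapsD(3)[OF assms(3)])
qed

lemma tensor_lift_of_terms:
  assumes "x \<in> carrier (tensor R M N)"
  shows "tensor_lift (tensor R M N) (\<lambda>m n. pure R M N m n) x = x"
  using assms
proof (elim tensor_sum_cases)
  fix xs assume xs: "xs \<in> lists (carrier M \<times> carrier N)" "x = tensor_sum R M N xs"
  have "pair_sum (tensor R M N) (\<lambda>m n. pure R M N m n) xs = tensor_sum R M N xs"
    using xs(1)
  proof (induction xs)
    case Nil
    then show ?case by (simp add: tensor_def)
  next
    case (Cons p xs)
    then show ?case by (cases p) (simp add: tensor_sum_append)
  qed
  then show ?thesis using xs by (simp add: tensor_lift_sum[OF tensor_module bilinear_pure])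
qed

lemma tensor_ext:
  assumes "Module.module R P" "f \<in> linear_maps R (tensor R M N) P" "g \<in> linear_maps R (tensor R M N) P"
    and "\<And>m n. m \<in> carrier M \<Longrightarrow> n \<in> carrier N \<Longrightarrow> f (pure R M N m n) = g (pure R M N m n)"
    and "x \<in> carrier (tensor R M N)"
  shows "f x = g x"
  using assms(5)
  by (induction rule: tensor_induct)
    (simp_all add: assms(4) linear_map_zero[OF assms(2) tensor_module assms(1)]
      linear_map_zero[OF assms(3) tensor_module assms(1)]
      linear_mapsD(2)[OF assms(2)] linear_mapsD(2)[OF assms(3)])

end

lemmas tensor_module_induct = tensor_induct [consumes 3, case_names zero pure add]

lemma tensor_lift_swap:
  assumes "abelian_monoid P"
    and "Module.module R M" "Module.module R N" "x \<in> carrier (tensor R M N)"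
    and "Module.module R' M'" "Module.module R' N'" "y \<in> carrier (tensor R' M' N')"
    and "\<And>a b c d. a \<in> carrier M \<Longrightarrow> b \<in> carrier N \<Longrightarrow> c \<in> carrier M' \<Longrightarrow> d \<in> carrier N'
      \<Longrightarrow> f a b c d \<in> carrier P"
  shows "tensor_lift P (\<lambda>a b. tensor_lift P (\<lambda>c d. f a b c d) y) x
    = tensor_lift P (\<lambda>c d. tensor_lift P (\<lambda>a b. f a b c d) x) y"
  unfolding tensor_lift_pair_sum
  by (rule pair_sum_swap[OF assms(1) _ terms_in_lists[OF assms(2-4)] terms_in_lists[OF assms(5-7)]])
    (simp add: assms(8))

section \<open>Maps between tensor products\<close>

lemma linear_pure_left:
  assumes "Module.module R M" "Module.module R N" "n \<in> carrier N" "f \<in> linear_maps R Z M"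
  shows "(\<lambda>z. pure R M N (f z) n) \<in> linear_maps R Z (tensor R M N)"
  by (rule linear_bilinear_left[OF bilinear_pure[OF assms(1,2)] assms(4,3)])

lemma linear_pure_right:
  assumes "Module.module R M" "Module.module R N" "m \<in> carrier M" "f \<in> linear_maps R Z N"
  shows "(\<lambda>z. pure R M N m (f z)) \<in> linear_maps R Z (tensor R M N)"
  by (rule linear_bilinear_right[OF bilinear_pure[OF assms(1,2)] assms(4,3)])

lemma bilinear_pure_comp:
  assumes "Module.module R M'" "Module.module R N'"
    and "f \<in> linear_maps R M M'" "g \<in> linear_maps R N N'"
  shows "(\<lambda>m n. pure R M' N' (f m) (g n)) \<in> bilinear_maps R M N (tensor R M' N')"
  by (intro bilinear_mapsI linear_pure_left linear_pure_right assms)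
    (simp_all add: linear_mapsD(1)[OF assms(3)] linear_mapsD(1)[OF assms(4)])

lemma tensor_map_closed:
  assumes "Module.module R M" "Module.module R N" "Module.module R M'" "Module.module R N'"
    and "x \<in> carrier (tensor R M N)"
    and "\<And>m. m \<in> carrier M \<Longrightarrow> f m \<in> carrier M'" "\<And>n. n \<in> carrier N \<Longrightarrow> g n \<in> carrier N'"
  shows "tensor_map R M' N' f g x \<in> carrier (tensor R M' N')"
proof -
  interpret T: Module.module R "tensor R M' N'" by (rule tensor_module) fact+
  show ?thesis unfolding tensor_map_def
    by (rule tensor_lift_closed[OF assms(1,2) T.abelian_monoid_axioms assms(5)])
      (simp add: pure_closed assms)
qed

lemma linear_tensor_map:
  assumes "Module.module R M" "Module.module R N" "Module.module R M'" "Module.module R N'"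
    and "f \<in> linear_maps R M M'" "g \<in> linear_maps R N N'"
  shows "tensor_map R M' N' f g \<in> linear_maps R (tensor R M N) (tensor R M' N')"
  unfolding tensor_map_def
  by (rule linear_tensor_lift[OF assms(1,2) tensor_module[OF assms(3,4)]
      bilinear_pure_comp[OF assms(3-6)]])

lemma tensor_map_pure:
  assumes "Module.module R M" "Module.module R N" "Module.module R M'" "Module.module R N'"
    and "f \<in> linear_maps R M M'" "g \<in> linear_maps R N N'" "m \<in> carrier M" "n \<in> carrier N"
  shows "tensor_map R M' N' f g (pure R M N m n) = pure R M' N' (f m) (g n)"
  unfolding tensor_map_def
  by (rule tensor_lift_pure[OF assms(1,2) tensor_module[OF assms(3,4)]
      bilinear_pure_comp[OF assms(3-6)] assms(7,8)])

lemma lift_lift: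
  assumes "Module.module R M" "Module.module R N" "Module.module R M'" "Module.module R N'"
    and "Module.module R P" "b \<in> bilinear_maps R M' N' P" "x \<in> carrier (tensor R M N)"
    and "\<And>m n. m \<in> carrier M \<Longrightarrow> n \<in> carrier N \<Longrightarrow> F m n \<in> carrier (tensor R M' N')"
  shows "tensor_lift P b (tensor_lift (tensor R M' N') F x)
    = tensor_lift P (\<lambda>m n. tensor_lift P b (F m n)) x"
  by (rule linear_of_tensor_lift[OF assms(1,2) linear_tensor_lift[OF assms(3-6)]
      tensor_module[OF assms(3,4)] assms(5,7,8)])

lemma lift_tensor_map:
  assumes "Module.module R M" "Module.module R N" "Module.module R M'" "Module.module R N'"
    and "Module.module R P" "b \<in> bilinear_maps R M' N' P" "x \<in> carrier (tensor R M N)"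
    and "\<And>m. m \<in> carrier M \<Longrightarrow> f m \<in> carrier M'" "\<And>n. n \<in> carrier N \<Longrightarrow> g n \<in> carrier N'"
  shows "tensor_lift P b (tensor_map R M' N' f g x) = tensor_lift P (\<lambda>m n. b (f m) (g n)) x"
  unfolding tensor_map_def
  by (subst lift_lift[OF assms(1-7)])
    (auto simp: assms pure_closed[OF assms(3,4)] tensor_lift_pure[OF assms(3-6)]
      intro!: tensor_lift_cong[OF assms(1,2,7)])

text \<open>\<open>tensor_map2\<close> lists all pairs of entries of the two stored lists, so
  summing over the concatenated list is a double sum. This turns the multiplication of H \<otimes> H
  and the diagonal actions into iterated lifts.\<close>

lemma lift_tensor_map2:
  assumes "Module.module R M" "Module.module R N" "Module.module R M'" "Module.module R N'"
    and "Module.module R A" "Module.module R B"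
    and "Module.module R P" "b \<in> bilinear_maps R A B P"
    and x: "x \<in> carrier (tensor R M N)" and y: "y \<in> carrier (tensor R M' N')"
    and f: "\<And>m m'. m \<in> carrier M \<Longrightarrow> m' \<in> carrier M' \<Longrightarrow> f m m' \<in> carrier A"
    and g: "\<And>n n'. n \<in> carrier N \<Longrightarrow> n' \<in> carrier N' \<Longrightarrow> g n n' \<in> carrier B"
  shows "tensor_lift P b (tensor_map2 R A B f g x y)
    = tensor_lift P (\<lambda>m n. tensor_lift P (\<lambda>m' n'. b (f m m') (g n n')) y) x"
    and "tensor_map2 R A B f g x y \<in> carrier (tensor R A B)"
proof -
  interpret P: Module.module R P by fact
  note app = pair_sum_append[OF P.abelian_monoid_axioms bilinear_maps_Pi[OF assms(8)]]
  have row: "map (\<lambda>(c, d). (f m c, g n d)) ys \<in> lists (carrier A \<times> carrier B) \<and>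
      pair_sum P b (map (\<lambda>(c, d). (f m c, g n d)) ys) = pair_sum P (\<lambda>m' n'. b (f m m') (g n n')) ys"
    if "ys \<in> lists (carrier M' \<times> carrier N')" "m \<in> carrier M" "n \<in> carrier N" for m n ys
    using that by (induction rule: pair_list_induct) (simp_all add: f g)
  have all: "concat (map (\<lambda>(m, n). map (\<lambda>(c, d). (f m c, g n d)) ys) xs)
        \<in> lists (carrier A \<times> carrier B) \<and>
      pair_sum P b (concat (map (\<lambda>(m, n). map (\<lambda>(c, d). (f m c, g n d)) ys) xs))
        = pair_sum P (\<lambda>m n. pair_sum P (\<lambda>m' n'. b (f m m') (g n n')) ys) xs"
    if "xs \<in> lists (carrier M \<times> carrier N)" "ys \<in> lists (carrier M' \<times> carrier N')" for xs ys
    using that by (induction rule: pair_list_induct) (simp_all add: row app)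
  note all = all[OF terms_in_lists[OF assms(1,2) x] terms_in_lists[OF assms(3,4) y]]
  then show "tensor_map2 R A B f g x y \<in> carrier (tensor R A B)"
    using tensor_sum_closed[OF assms(5,6)] by (simp add: tensor_map2_def)
  show "tensor_lift P b (tensor_map2 R A B f g x y)
    = tensor_lift P (\<lambda>m n. tensor_lift P (\<lambda>m' n'. b (f m m') (g n n')) y) x"
    using all unfolding tensor_map2_def
    by (subst tensor_lift_sum[OF assms(5-8)]) (simp_all add: tensor_lift_pair_sum)
qed

lemma tensor_map2_lift:
  assumes "Module.module R M" "Module.module R N" "Module.module R M'" "Module.module R N'"
    and "Module.module R A" "Module.module R B"
    and "x \<in> carrier (tensor R M N)" "y \<in> carrier (tensor R M' N')"
    and "\<And>m m'. m \<in> carrier M \<Longrightarrow> m' \<in> carrier M' \<Longrightarrow> f m m' \<in> carrier A"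
    and "\<And>n n'. n \<in> carrier N \<Longrightarrow> n' \<in> carrier N' \<Longrightarrow> g n n' \<in> carrier B"
  shows "tensor_map2 R A B f g x y = tensor_lift (tensor R A B)
    (\<lambda>m n. tensor_lift (tensor R A B) (\<lambda>m' n'. pure R A B (f m m') (g n n')) y) x"
  using lift_tensor_map2[OF assms(1-6) tensor_module[OF assms(5,6)] bilinear_pure[OF assms(5,6)]
      assms(7-10)] tensor_lift_of_terms[OF assms(5,6)] by simp

subsection \<open>Associativity\<close>

context
  fixes R :: "('u::infinite, 'e) ring_scheme" and M :: "('u, 'u, 'x) module_scheme"
    and N :: "('u, 'u, 'y) module_scheme" and P :: "('u, 'u, 'z) module_scheme"
  assumes M: "Module.module R M" and N: "Module.module R N" and P: "Module.module R P"
begin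

private lemmas MN = tensor_module[OF M N]
private lemmas NP = tensor_module[OF N P]
private lemmas MN_P = tensor_module[OF MN P]
private lemmas M_NP = tensor_module[OF M NP]

lemma lift_lift_bilinear:
  fixes Q :: "('u, 'u, 'q) module_scheme"
  assumes Q: "Module.module R Q"
    and "\<And>n p. n \<in> carrier N \<Longrightarrow> p \<in> carrier P \<Longrightarrow> (\<lambda>m. f m n p) \<in> linear_maps R M Q"
    and "\<And>m p. m \<in> carrier M \<Longrightarrow> p \<in> carrier P \<Longrightarrow> (\<lambda>n. f m n p) \<in> linear_maps R N Q"
    and "\<And>m n. m \<in> carrier M \<Longrightarrow> n \<in> carrier N \<Longrightarrow> (\<lambda>p. f m n p) \<in> linear_maps R P Q"
  shows "(\<lambda>t p. tensor_lift Q (\<lambda>m n. f m n p) t) \<in> bilinear_maps R (tensor R M N) P Q"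
    and "(\<lambda>m t. tensor_lift Q (\<lambda>n p. f m n p) t) \<in> bilinear_maps R M (tensor R N P) Q"
proof -
  show "(\<lambda>t p. tensor_lift Q (\<lambda>m n. f m n p) t) \<in> bilinear_maps R (tensor R M N) P Q"
    by (intro bilinear_mapsI linear_tensor_lift[OF M N Q] linear_tensor_lift_param[OF M N Q] assms)
  show "(\<lambda>m t. tensor_lift Q (\<lambda>n p. f m n p) t) \<in> bilinear_maps R M (tensor R N P) Q"
    by (intro bilinear_mapsI linear_tensor_lift[OF N P Q] linear_tensor_lift_param[OF N P Q] assms)
qed

lemma assoc_bilinear:
  "(\<lambda>t p. tensor_lift (tensor R M (tensor R N P))
      (\<lambda>m n. pure R M (tensor R N P) m (pure R N P n p)) t)
    \<in> bilinear_maps R (tensor R M N) P (tensor R M (tensor R N P))"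
  by (rule lift_lift_bilinear(1))
    (auto intro!: linear_pure_left linear_pure_right linear_ident M N P NP M_NP pure_closed)

lemma linear_tensor_assoc:
  "tensor_assoc R M N P \<in> linear_maps R (tensor R (tensor R M N) P) (tensor R M (tensor R N P))"
  unfolding tensor_assoc_def by (rule linear_tensor_lift[OF MN P M_NP assoc_bilinear])

lemma tensor_assoc_pure:
  assumes "m \<in> carrier M" "n \<in> carrier N" "p \<in> carrier P"
  shows "tensor_assoc R M N P (pure R (tensor R M N) P (pure R M N m n) p)
    = pure R M (tensor R N P) m (pure R N P n p)"
  unfolding tensor_assoc_def
  by (subst tensor_lift_pure[OF MN P M_NP assoc_bilinear pure_closed[OF M N] assms(3)])
    (auto simp: assms intro!: tensor_lift_pure[OF M N M_NP] bilinear_mapsI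
      linear_pure_left linear_pure_right linear_ident M N P NP M_NP pure_closed)

lemma assoc_inv_bilinear:
  "(\<lambda>m t. tensor_lift (tensor R (tensor R M N) P)
      (\<lambda>n p. pure R (tensor R M N) P (pure R M N m n) p) t)
    \<in> bilinear_maps R M (tensor R N P) (tensor R (tensor R M N) P)"
  by (rule lift_lift_bilinear(2))
    (auto intro!: linear_pure_left linear_pure_right linear_ident M N P MN MN_P pure_closed)

lemma linear_tensor_assoc_inv:
  "tensor_assoc_inv R M N P \<in> linear_maps R (tensor R M (tensor R N P)) (tensor R (tensor R M N) P)"
  unfolding tensor_assoc_inv_def by (rule linear_tensor_lift[OF M NP MN_P assoc_inv_bilinear])

text \<open>The second factor is an arbitrary tensor \<open>t\<close>, because the map will be
  applied to coproducts.\<close>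

lemma tensor_assoc_inv_pure:
  assumes "m \<in> carrier M" "t \<in> carrier (tensor R N P)"
  shows "tensor_assoc_inv R M N P (pure R M (tensor R N P) m t)
    = tensor_lift (tensor R (tensor R M N) P) (\<lambda>n p. pure R (tensor R M N) P (pure R M N m n) p) t"
  unfolding tensor_assoc_inv_def
  by (rule tensor_lift_pure[OF M NP MN_P assoc_inv_bilinear assms])

text \<open>The bridge from coassociativity, an equation of tensors up to rebracketing, to an
  equation between iterated sums of a trilinear map.\<close>

lemma lift_tensor_assoc:
  fixes Q :: "('u, 'u, 'q) module_scheme"
  assumes Q: "Module.module R Q"
    and "\<And>n p. n \<in> carrier N \<Longrightarrow> p \<in> carrier P \<Longrightarrow> (\<lambda>m. f m n p) \<in> linear_maps R M Q"
    and "\<And>m p. m \<in> carrier M \<Longrightarrow> p \<in> carrier P \<Longrightarrow> (\<lambda>n. f m n p) \<in> linear_maps R N Q"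
    and "\<And>m n. m \<in> carrier M \<Longrightarrow> n \<in> carrier N \<Longrightarrow> (\<lambda>p. f m n p) \<in> linear_maps R P Q"
    and x: "x \<in> carrier (tensor R (tensor R M N) P)"
  shows "tensor_lift Q (\<lambda>m t. tensor_lift Q (\<lambda>n p. f m n p) t) (tensor_assoc R M N P x)
    = tensor_lift Q (\<lambda>t p. tensor_lift Q (\<lambda>m n. f m n p) t) x"
proof -
  note bil = lift_lift_bilinear[of Q f, OF assms(1-4)]
  have NPb: "(\<lambda>n p. f m n p) \<in> bilinear_maps R N P Q" if "m \<in> carrier M" for m
    using that by (intro bilinear_mapsI assms)
  have MNb: "(\<lambda>m n. f m n p) \<in> bilinear_maps R M N Q" if "p \<in> carrier P" for p
    using that by (intro bilinear_mapsI assms)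
  \<comment> \<open>A pure tensor of (M \<otimes> N) \<otimes> P still has a general tensor
    \<open>t\<close> on the left, so the extension principle is used twice, here in
    \<open>t\<close>.\<close>
  have *: "tensor_lift Q (\<lambda>m t. tensor_lift Q (\<lambda>n p. f m n p) t)
        (tensor_assoc R M N P (pure R (tensor R M N) P t p))
      = tensor_lift Q (\<lambda>t p. tensor_lift Q (\<lambda>m n. f m n p) t) (pure R (tensor R M N) P t p)"
    if t: "t \<in> carrier (tensor R M N)" and p: "p \<in> carrier P" for t p
    by (rule tensor_ext[OF M N Q _ _ _ t])
      (auto intro!: linear_comp[OF linear_tensor_lift[OF M NP Q bil(2)]]
          linear_comp[OF linear_tensor_lift[OF MN P Q bil(1)]]
          linear_comp[OF linear_tensor_assoc] linear_pure_left MN P linear_ident p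
        simp: tensor_assoc_pure pure_closed M N P NP MN p tensor_lift_pure[OF M NP Q bil(2)]
          tensor_lift_pure[OF MN P Q bil(1)] tensor_lift_pure[OF N P Q NPb]
          tensor_lift_pure[OF M N Q MNb])
  show ?thesis
    by (rule tensor_ext[OF MN P Q _ _ _ x])
      (auto intro!: * linear_comp[OF linear_tensor_lift[OF M NP Q bil(2)]] linear_tensor_assoc
        linear_tensor_lift[OF MN P Q bil(1)])
qed

end

subsection \<open>Modules with the same underlying module\<close>

text \<open>
  Replacing the factors by records that agree on the carrier does not change the elements \<open>tensor_sum\<close>,
  although the resulting records may differ outside of the carrier.
\<close>

definition same_module ::
  "('r, 'e) ring_scheme \<Rightarrow> ('r, 'm, 'x) module_scheme \<Rightarrow> ('r, 'm, 'y) module_scheme \<Rightarrow> bool" where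
  "same_module R A B \<longleftrightarrow> carrier A = carrier B \<and> add A = add B \<and> zero A = zero B \<and>
    (\<forall>r\<in>carrier R. \<forall>x\<in>carrier B. r \<odot>\<^bsub>A\<^esub> x = r \<odot>\<^bsub>B\<^esub> x)"

lemma same_module_refl: "same_module R A A"
  by (simp add: same_module_def)

lemma same_module_sym: "same_module R A B \<Longrightarrow> same_module R B A"
  by (simp add: same_module_def)

lemma tensor_eq_same_module:
  assumes "same_module R A B" "same_module R A' B'" "tensor_eq R A A' xs ys"
  shows "tensor_eq R B B' xs ys"
  using assms(3)
proof induction
  case (balanced r m n)
  then show ?case using assms(1,2) tensor_eq.balanced[of r R m B n B'] by (simp add: same_module_def)
next
  case (add_left m m' n)
  then show ?case using assms(1,2) tensor_eq.add_left[of m B m' n B' R] by (simp add: same_module_def)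
next
  case (add_right m n n')
  then show ?case using assms(1,2) tensor_eq.add_right[of m B n B' n' R] by (simp add: same_module_def)
next
  case (zero_left n)
  then show ?case using assms(1,2) tensor_eq.zero_left[of n B' R B] by (simp add: same_module_def)
next
  case (zero_right n)
  then show ?case using assms(1,2) tensor_eq.zero_right[of n B R B'] by (simp add: same_module_def)
qed (use assms(1,2) in \<open>auto simp: same_module_def intro: tensor_eq.intros\<close>)

text \<open>The two congruences coincide as predicates, hence so do the choices made by
  \<open>SOME\<close>: the tensors are equal as elements of the universe, rather than corresponding
  under an isomorphism.\<close>

lemma tensor_sum_same_module:
  assumes "same_module R A B" "same_module R A' B'"
  shows "tensor_sum R A A' xs = tensor_sum R B B' xs"
proof -
  have "tensor_eq R A A' xs ys = tensor_eq R B B' xs ys" for ys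
    using tensor_eq_same_module[OF assms] tensor_eq_same_module[OF assms[THEN same_module_sym]]
    by blast
  then have "tensor_eq R A A' xs = tensor_eq R B B' xs" by blast
  then show ?thesis by (simp add: tensor_sum_def)
qed

text \<open>The scalar actions agree only on the carriers, while the action on a tensor is computed
  from \<open>terms x\<close>; that this list lies over the carriers closes the gap. The fields
  \<open>mult\<close> and \<open>one\<close>, which may still differ, are disregarded by
  \<open>same_module\<close>.\<close>

lemma same_module_tensor:
  assumes "same_module R A B" "same_module R A' B'" "Module.module R B" "Module.module R B'"
  shows "same_module R (tensor R A A') (tensor R B B')"
  unfolding same_module_def
proof (intro conjI ballI)
  note * = tensor_sum_same_module[OF assms(1,2)]
  have "carrier A = carrier B" "carrier A' = carrier B'" using assms(1,2) by (auto simp: same_module_def)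
  then show "carrier (tensor R A A') = carrier (tensor R B B')" by (simp add: tensor_def *)
  show "add (tensor R A A') = add (tensor R B B')" by (simp add: tensor_def *)
  show "\<zero>\<^bsub>tensor R A A'\<^esub> = \<zero>\<^bsub>tensor R B B'\<^esub>" by (simp add: tensor_def *)
  fix r x assume r: "r \<in> carrier R" and "x \<in> carrier (tensor R B B')"
  then have "terms x \<in> lists (carrier B \<times> carrier B')" using terms_in_lists[OF assms(3,4)] by blast
  then have "map (\<lambda>(m, n). (r \<odot>\<^bsub>A\<^esub> m, n)) (terms x) = map (\<lambda>(m, n). (r \<odot>\<^bsub>B\<^esub> m, n)) (terms x)"
    using assms(1) r by (induction rule: pair_list_induct) (simp_all add: same_module_def)
  note ** = this
  have "r \<odot>\<^bsub>tensor R A A'\<^esub> x = tensor_sum R B B' (map (\<lambda>(m, n). (r \<odot>\<^bsub>A\<^esub> m, n)) (terms x))"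
    by (simp add: tensor_def *)
  also have "\<dots> = r \<odot>\<^bsub>tensor R B B'\<^esub> x" unfolding ** by (simp add: tensor_def)
  finally show "r \<odot>\<^bsub>tensor R A A'\<^esub> x = r \<odot>\<^bsub>tensor R B B'\<^esub> x" .
qed

lemma tensor_lift_same_module:
  "same_module R A B \<Longrightarrow> tensor_lift A b = tensor_lift B b"
  by (rule ext) (simp add: tensor_lift_def same_module_def)

lemma tensor_map_same_module:
  assumes "same_module R A B" "same_module R A' B'" "Module.module R B" "Module.module R B'"
  shows "tensor_map R A A' f g = tensor_map R B B' f g"
  by (simp add: tensor_map_def tensor_lift_same_module[OF same_module_tensor[OF assms]]
    tensor_sum_same_module[OF assms(1,2)])

lemma tensor_map2_same_module:
  assumes "same_module R A B" "same_module R A' B'"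
  shows "tensor_map2 R A A' f g x y = tensor_map2 R B B' f g x y"
  by (simp add: tensor_map2_def tensor_sum_same_module[OF assms])

lemma tensor_assoc_same_module:
  assumes "same_module R A B" "same_module R A' B'" "same_module R A'' B''"
    and "Module.module R B" "Module.module R B'" "Module.module R B''"
  shows "tensor_assoc R A A' A'' = tensor_assoc R B B' B''"
    "tensor_assoc_inv R A A' A'' = tensor_assoc_inv R B B' B''"
proof -
  note * = same_module_tensor[OF assms(2,3,5,6)] same_module_tensor[OF assms(1,2,4,5)]
  note ** = same_module_tensor[OF assms(1) *(1) assms(4) tensor_module[OF assms(5,6)]]
    same_module_tensor[OF *(2) assms(3) tensor_module[OF assms(4,5)] assms(6)]
  show "tensor_assoc R A A' A'' = tensor_assoc R B B' B''"
    "tensor_assoc_inv R A A' A'' = tensor_assoc_inv R B B' B''"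
    by (simp_all add: tensor_assoc_def tensor_assoc_inv_def tensor_lift_same_module[OF **(1)]
      tensor_lift_same_module[OF **(2)] tensor_sum_same_module[OF assms(1,2)]
      tensor_sum_same_module[OF assms(2,3)] tensor_sum_same_module[OF assms(1) *(1)]
      tensor_sum_same_module[OF *(2) assms(3)])
qed

lemma linear_maps_same_module_subset:
  assumes "same_module R A B" "same_module R A' B'"
  shows "linear_maps R A A' \<subseteq> linear_maps R B B'"
  using assms unfolding linear_maps_def same_module_def by (auto simp: Pi_iff)

lemma linear_maps_same_module:
  assumes "same_module R A B" "same_module R A' B'"
  shows "linear_maps R A A' = linear_maps R B B'"
  using linear_maps_same_module_subset[OF assms]
    linear_maps_same_module_subset[OF assms[THEN same_module_sym]] by blast

section \<open>Sweedler sums\<close>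

context coalgebra
begin

lemma module_k: "Module.module k (regular_module k)"
  by (rule regular_module) (rule R.cring_axioms)

lemma module_C: "Module.module k C" ..

lemma comult_closed: "c \<in> carrier C \<Longrightarrow> \<Delta> c \<in> carrier (tensor k C C)"
  by (rule linear_mapsD(1)[OF comult_linear])

lemma counit_closed: "c \<in> carrier C \<Longrightarrow> \<epsilon> c \<in> carrier k"
  using linear_mapsD(1)[OF counit_linear] by simp

text \<open>\<open>sweedler P c b\<close> is the sum of all \<open>b c\<^sub>(\<^sub>1\<^sub>) c\<^sub>(\<^sub>2\<^sub>)\<close>.\<close>

abbreviation sweedler :: "('u, 'x) ring_scheme \<Rightarrow> 'u \<Rightarrow> ('u \<Rightarrow> 'u \<Rightarrow> 'u) \<Rightarrow> 'u" where
  "sweedler P c b \<equiv> tensor_lift P b (\<Delta> c)"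

lemma sweedler_closed:
  assumes "Module.module R P" "c \<in> carrier C"
    and "\<And>a b. a \<in> carrier C \<Longrightarrow> b \<in> carrier C \<Longrightarrow> f a b \<in> carrier P"
  shows "sweedler P c f \<in> carrier P"
proof -
  interpret P: Module.module R P by fact
  show ?thesis
    by (rule tensor_lift_closed[OF module_C module_C P.abelian_monoid_axioms comult_closed]) (fact assms)+
qed

lemma sweedler_cong:
  assumes "c \<in> carrier C"
    and "\<And>a b. a \<in> carrier C \<Longrightarrow> b \<in> carrier C \<Longrightarrow> f a b = g a b"
  shows "sweedler P c f = sweedler P c g"
  by (rule tensor_lift_cong[OF module_C module_C comult_closed]) (fact assms)+

lemma linear_sweedler_arg:
  assumes "Module.module k P" "b \<in> bilinear_maps k C C P" "f \<in> linear_maps k Z C"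
  shows "(\<lambda>z. sweedler P (f z) b) \<in> linear_maps k Z P"
  by (rule linear_comp[OF linear_tensor_lift[OF module_C module_C assms(1,2)]
      linear_comp[OF comult_linear assms(3)]])

lemma linear_sweedler_param:
  assumes "Module.module R P" "c \<in> carrier C"
    and "\<And>a b. a \<in> carrier C \<Longrightarrow> b \<in> carrier C \<Longrightarrow> (\<lambda>z. f z a b) \<in> linear_maps R Z P"
  shows "(\<lambda>z. sweedler P c (f z)) \<in> linear_maps R Z P"
  by (rule linear_tensor_lift_param[OF module_C module_C assms(1) comult_closed]) (fact assms)+

lemma linear_of_sweedler:
  assumes "g \<in> linear_maps R P Q" "Module.module R P" "Module.module R Q" "c \<in> carrier C"
    and "\<And>a b. a \<in> carrier C \<Longrightarrow> b \<in> carrier C \<Longrightarrow> f a b \<in> carrier P"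
  shows "g (sweedler P c f) = sweedler Q c (\<lambda>a b. g (f a b))"
  by (rule linear_of_tensor_lift[OF module_C module_C assms(1-3) comult_closed]) (fact assms)+

text \<open>This justifies the unbracketed notation f(c1, c2, c3), for trilinear \<open>f\<close>
  with values in any module.\<close>

lemma sweedler_coassoc:
  fixes P :: "('u, 'u, 'p) module_scheme"
  assumes P: "Module.module k P" and c: "c \<in> carrier C"
    and f1: "\<And>q r. q \<in> carrier C \<Longrightarrow> r \<in> carrier C \<Longrightarrow> (\<lambda>p. f p q r) \<in> linear_maps k C P"
    and f2: "\<And>p r. p \<in> carrier C \<Longrightarrow> r \<in> carrier C \<Longrightarrow> (\<lambda>q. f p q r) \<in> linear_maps k C P"
    and f3: "\<And>p q. p \<in> carrier C \<Longrightarrow> q \<in> carrier C \<Longrightarrow> (\<lambda>r. f p q r) \<in> linear_maps k C P"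
  shows "sweedler P c (\<lambda>a b. sweedler P a (\<lambda>p q. f p q b))
    = sweedler P c (\<lambda>a b. sweedler P b (\<lambda>q r. f a q r))"
proof -
  note C = module_C and CC = tensor_module[OF module_C module_C]
  note bil = lift_lift_bilinear[of k C C C P f, OF C C C P f1 f2 f3]
  have "sweedler P c (\<lambda>a b. sweedler P a (\<lambda>p q. f p q b))
    = tensor_lift P (\<lambda>t b. tensor_lift P (\<lambda>p q. f p q b) t)
        (tensor_map k (tensor k C C) C \<Delta> (\<lambda>x. x) (\<Delta> c))"
    by (rule lift_tensor_map[symmetric, OF C C CC C P bil(1)]) (simp_all add: c comult_closed)
  also have "\<dots> = tensor_lift P (\<lambda>m t. tensor_lift P (\<lambda>n p. f m n p) t)
      (tensor_assoc k C C C (tensor_map k (tensor k C C) C \<Delta> (\<lambda>x. x) (\<Delta> c)))"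
    by (rule lift_tensor_assoc[symmetric, OF C C C P f1 f2 f3])
      (simp_all add: tensor_map_closed[OF C C CC C] c comult_closed)
  also have "\<dots> = tensor_lift P (\<lambda>m t. tensor_lift P (\<lambda>n p. f m n p) t)
      (tensor_map k C (tensor k C C) (\<lambda>x. x) \<Delta> (\<Delta> c))"
    by (simp add: coassoc c)
  also have "\<dots> = sweedler P c (\<lambda>a b. sweedler P b (\<lambda>q r. f a q r))"
    by (rule lift_tensor_map[OF C C C CC P bil(2)]) (simp_all add: c comult_closed)
  finally show ?thesis .
qed

text \<open>The counit law pushed through a linear map, so that a counit factor can be removed
  inside any module \<open>P\<close> and not only in \<open>C\<close>.\<close>

lemma sweedler_counit_left:
  assumes "Module.module k P" "f \<in> linear_maps k C P" "c \<in> carrier C"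
  shows "sweedler P c (\<lambda>a b. \<epsilon> a \<odot>\<^bsub>P\<^esub> f b) = f c"
proof -
  have "sweedler P c (\<lambda>a b. \<epsilon> a \<odot>\<^bsub>P\<^esub> f b) = sweedler P c (\<lambda>a b. f (\<epsilon> a \<odot>\<^bsub>C\<^esub> b))"
    by (rule sweedler_cong) (simp_all add: assms(3) linear_mapsD[OF assms(2)] counit_closed)
  also have "\<dots> = f c"
    using linear_of_sweedler[OF assms(2) module_C assms(1,3), of "\<lambda>a b. \<epsilon> a \<odot>\<^bsub>C\<^esub> b"]
    by (simp add: counit_left assms(3) counit_closed)
  finally show ?thesis .
qed

lemma sweedler_counit_right:
  assumes "Module.module k P" "f \<in> linear_maps k C P" "c \<in> carrier C"
  shows "sweedler P c (\<lambda>a b. \<epsilon> b \<odot>\<^bsub>P\<^esub> f a) = f c"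
proof -
  have "sweedler P c (\<lambda>a b. \<epsilon> b \<odot>\<^bsub>P\<^esub> f a) = sweedler P c (\<lambda>a b. f (\<epsilon> b \<odot>\<^bsub>C\<^esub> a))"
    by (rule sweedler_cong) (simp_all add: assms(3) linear_mapsD[OF assms(2)] counit_closed)
  also have "\<dots> = f c"
    using linear_of_sweedler[OF assms(2) module_C assms(1,3), of "\<lambda>a b. \<epsilon> b \<odot>\<^bsub>C\<^esub> a"]
    by (simp add: counit_right assms(3) counit_closed)
  finally show ?thesis .
qed

lemma sweedler_swap:
  assumes "Module.module R P" "c \<in> carrier C" "coalgebra k' D \<Delta>' \<epsilon>'" "d \<in> carrier D"
    and "\<And>a b p q. a \<in> carrier C \<Longrightarrow> b \<in> carrier C \<Longrightarrow> p \<in> carrier D \<Longrightarrow> q \<in> carrier D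
      \<Longrightarrow> f a b p q \<in> carrier P"
  shows "sweedler P c (\<lambda>a b. tensor_lift P (\<lambda>p q. f a b p q) (\<Delta>' d))
    = tensor_lift P (\<lambda>p q. sweedler P c (\<lambda>a b. f a b p q)) (\<Delta>' d)"
proof -
  interpret P: Module.module R P by fact
  interpret D: coalgebra k' D \<Delta>' \<epsilon>' by fact
  show ?thesis
    by (rule tensor_lift_swap[OF P.abelian_monoid_axioms module_C module_C comult_closed
        D.module_C D.module_C D.comult_closed]) (fact assms)+
qed

text \<open>Coassociativity of the tensor product of two coalgebras.\<close>

lemma sweedler_coassoc2:
  fixes P :: "('u, 'u, 'p) module_scheme"
  assumes P: "Module.module k P" and c: "c \<in> carrier C"
    and D: "coalgebra k D \<Delta>' \<epsilon>'" and d: "d \<in> carrier D"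
    and F: "\<And>a2 a3 d1 d2 d3. a2 \<in> carrier C \<Longrightarrow> a3 \<in> carrier C \<Longrightarrow> d1 \<in> carrier D \<Longrightarrow>
      d2 \<in> carrier D \<Longrightarrow> d3 \<in> carrier D \<Longrightarrow> (\<lambda>a1. F a1 a2 a3 d1 d2 d3) \<in> linear_maps k C P"
      "\<And>a1 a3 d1 d2 d3. a1 \<in> carrier C \<Longrightarrow> a3 \<in> carrier C \<Longrightarrow> d1 \<in> carrier D \<Longrightarrow>
      d2 \<in> carrier D \<Longrightarrow> d3 \<in> carrier D \<Longrightarrow> (\<lambda>a2. F a1 a2 a3 d1 d2 d3) \<in> linear_maps k C P"
      "\<And>a1 a2 d1 d2 d3. a1 \<in> carrier C \<Longrightarrow> a2 \<in> carrier C \<Longrightarrow> d1 \<in> carrier D \<Longrightarrow>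
      d2 \<in> carrier D \<Longrightarrow> d3 \<in> carrier D \<Longrightarrow> (\<lambda>a3. F a1 a2 a3 d1 d2 d3) \<in> linear_maps k C P"
      "\<And>a1 a2 a3 d2 d3. a1 \<in> carrier C \<Longrightarrow> a2 \<in> carrier C \<Longrightarrow> a3 \<in> carrier C \<Longrightarrow>
      d2 \<in> carrier D \<Longrightarrow> d3 \<in> carrier D \<Longrightarrow> (\<lambda>d1. F a1 a2 a3 d1 d2 d3) \<in> linear_maps k D P"
      "\<And>a1 a2 a3 d1 d3. a1 \<in> carrier C \<Longrightarrow> a2 \<in> carrier C \<Longrightarrow> a3 \<in> carrier C \<Longrightarrow>
      d1 \<in> carrier D \<Longrightarrow> d3 \<in> carrier D \<Longrightarrow> (\<lambda>d2. F a1 a2 a3 d1 d2 d3) \<in> linear_maps k D P"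
      "\<And>a1 a2 a3 d1 d2. a1 \<in> carrier C \<Longrightarrow> a2 \<in> carrier C \<Longrightarrow> a3 \<in> carrier C \<Longrightarrow>
      d1 \<in> carrier D \<Longrightarrow> d2 \<in> carrier D \<Longrightarrow> (\<lambda>d3. F a1 a2 a3 d1 d2 d3) \<in> linear_maps k D P"
  shows "sweedler P c (\<lambda>a b. tensor_lift P (\<lambda>p q. sweedler P a (\<lambda>a1 a2.
      tensor_lift P (\<lambda>p1 p2. F a1 a2 b p1 p2 q) (\<Delta>' p))) (\<Delta>' d))
    = sweedler P c (\<lambda>a b. tensor_lift P (\<lambda>p q. sweedler P b (\<lambda>b1 b2.
      tensor_lift P (\<lambda>q1 q2. F a b1 b2 p q1 q2) (\<Delta>' q))) (\<Delta>' d))"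
proof -
  interpret D: coalgebra k D \<Delta>' \<epsilon>' by fact
  note closed = linear_mapsD(1)[OF F(1)] sweedler_closed[OF P] D.sweedler_closed[OF P]
  note swap = sweedler_swap[OF P _ D]
  \<comment> \<open>Interchanging sums puts both coproducts of \<open>D\<close> inside those of
    \<open>C\<close>; then coassociativity applies to each coalgebra separately.\<close>
  have "sweedler P c (\<lambda>a b. D.sweedler P d (\<lambda>p q. sweedler P a (\<lambda>a1 a2.
      D.sweedler P p (\<lambda>p1 p2. F a1 a2 b p1 p2 q))))
    = sweedler P c (\<lambda>a b. sweedler P a (\<lambda>a1 a2. D.sweedler P d (\<lambda>p q.
      D.sweedler P p (\<lambda>p1 p2. F a1 a2 b p1 p2 q))))"
    by (intro sweedler_cong swap[symmetric] c d) (simp_all add: closed)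
  also have "\<dots> = sweedler P c (\<lambda>a b. sweedler P a (\<lambda>a1 a2. D.sweedler P d (\<lambda>p q.
      D.sweedler P q (\<lambda>q1 q2. F a1 a2 b p q1 q2))))"
    by (intro sweedler_cong D.sweedler_coassoc[OF P] c d F)
  also have "\<dots> = sweedler P c (\<lambda>a b. sweedler P b (\<lambda>b1 b2. D.sweedler P d (\<lambda>p q.
      D.sweedler P q (\<lambda>q1 q2. F a b1 b2 p q1 q2))))"
    by (intro sweedler_coassoc[OF P] D.linear_sweedler_param[OF P] c d F)
  also have "\<dots> = sweedler P c (\<lambda>a b. D.sweedler P d (\<lambda>p q. sweedler P b (\<lambda>b1 b2.
      D.sweedler P q (\<lambda>q1 q2. F a b1 b2 p q1 q2))))"
    by (intro sweedler_cong swap c d) (simp_all add: closed)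
  finally show ?thesis .
qed

lemma sweedler_pure: "c \<in> carrier C \<Longrightarrow> sweedler (tensor k C C) c (\<lambda>a b. pure k C C a b) = \<Delta> c"
  by (rule tensor_lift_of_terms[OF module_C module_C comult_closed])

end

section \<open>The antipode of a commutative Hopf algebra\<close>

context commutative_hopf_algebra
begin

lemmas H_module = module_C

lemma linear_mult_left:
  "f \<in> linear_maps k Z H \<Longrightarrow> x \<in> carrier H \<Longrightarrow> (\<lambda>z. f z \<otimes>\<^bsub>H\<^esub> x) \<in> linear_maps k Z H"
  by (rule linear_mapsI) (simp_all add: linear_mapsD l_distr smult_assoc2)

lemma mult_smult:
  "r \<in> carrier k \<Longrightarrow> x \<in> carrier H \<Longrightarrow> y \<in> carrier H \<Longrightarrow> x \<otimes>\<^bsub>H\<^esub> (r \<odot>\<^bsub>H\<^esub> y) = r \<odot>\<^bsub>H\<^esub> (x \<otimes>\<^bsub>H\<^esub> y)"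
  using smult_assoc2[of r y x] by (simp add: m_comm)

lemma linear_mult_right:
  "f \<in> linear_maps k Z H \<Longrightarrow> x \<in> carrier H \<Longrightarrow> (\<lambda>z. x \<otimes>\<^bsub>H\<^esub> f z) \<in> linear_maps k Z H"
  by (rule linear_mapsI) (simp_all add: linear_mapsD r_distr mult_smult)

lemma counit_mult: "g \<in> carrier H \<Longrightarrow> h \<in> carrier H \<Longrightarrow> \<epsilon> (g \<otimes>\<^bsub>H\<^esub> h) = \<epsilon> g \<otimes>\<^bsub>k\<^esub> \<epsilon> h"
  using counit_ring_hom by (rule ring_hom_mult)

lemma counit_one: "\<epsilon> \<one>\<^bsub>H\<^esub> = \<one>\<^bsub>k\<^esub>"
  using counit_ring_hom by (rule ring_hom_one)

lemma antipode_closed [simp]: "h \<in> carrier H \<Longrightarrow> S h \<in> carrier H"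
  by (rule linear_mapsD(1)[OF antipode_linear])

lemma linear_antipode: "f \<in> linear_maps k Z H \<Longrightarrow> (\<lambda>z. S (f z)) \<in> linear_maps k Z H"
  by (rule linear_comp[OF antipode_linear])

lemma sweedler_mult:
  assumes "Module.module k P" "b \<in> bilinear_maps k H H P" "g \<in> carrier H" "h \<in> carrier H"
  shows "sweedler P (g \<otimes>\<^bsub>H\<^esub> h) b
    = sweedler P g (\<lambda>p q. sweedler P h (\<lambda>r s. b (p \<otimes>\<^bsub>H\<^esub> r) (q \<otimes>\<^bsub>H\<^esub> s)))"
proof -
  have "\<Delta> (g \<otimes>\<^bsub>H\<^esub> h) = tensor_map2 k H H (mult H) (mult H) (\<Delta> g) (\<Delta> h)"
    using ring_hom_mult[OF comult_ring_hom assms(3,4)] by (simp add: tensor_def)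
  then show ?thesis
    using H_module assms
    by (simp add: lift_tensor_map2(1)[where M=H and N=H and M'=H and N'=H] comult_closed)
qed

text \<open>The convolution product on linear maps from H \<otimes> H to H, where H \<otimes> H is
  the tensor product coalgebra and the maps are represented by bilinear functions.\<close>

definition convolution :: "('u \<Rightarrow> 'u \<Rightarrow> 'u) \<Rightarrow> ('u \<Rightarrow> 'u \<Rightarrow> 'u) \<Rightarrow> 'u \<Rightarrow> 'u \<Rightarrow> 'u" where
  "convolution A B g h = sweedler H g (\<lambda>p q. sweedler H h (\<lambda>r s. A p r \<otimes>\<^bsub>H\<^esub> B q s))"

text \<open>Coassociativity of H \<otimes> H and associativity of the product of \<open>H\<close>:
  both sides are brought to sums of the triple product \<open>F\<close>.\<close>

lemma convolution_assoc:
  assumes A: "A \<in> bilinear_maps k H H H" and B: "B \<in> bilinear_maps k H H H"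
    and D: "D \<in> bilinear_maps k H H H" and g: "g \<in> carrier H" and h: "h \<in> carrier H"
  shows "convolution (convolution A B) D g h = convolution A (convolution B D) g h"
proof -
  note closed = bilinear_mapsD(3)[OF A] bilinear_mapsD(3)[OF B] bilinear_mapsD(3)[OF D]
    sweedler_closed[OF H_module]
  note lin = linear_mult_left linear_mult_right
    bilinear_mapsD(1,2)[OF A] bilinear_mapsD(1,2)[OF B] bilinear_mapsD(1,2)[OF D]
  define F where "F p q r u v w = A p u \<otimes>\<^bsub>H\<^esub> B q v \<otimes>\<^bsub>H\<^esub> D r w" for p q r u v w
  have "convolution (convolution A B) D g h
    = sweedler H g (\<lambda>a b. sweedler H h (\<lambda>c d. sweedler H a (\<lambda>p q. sweedler H c (\<lambda>u v. F p q b u v d))))"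
  proof (unfold convolution_def, intro sweedler_cong g h)
    fix a b c d assume abcd: "a \<in> carrier H" "b \<in> carrier H" "c \<in> carrier H" "d \<in> carrier H"
    have l: "(\<lambda>x. x \<otimes>\<^bsub>H\<^esub> D b d) \<in> linear_maps k H H"
      using abcd by (intro linear_mult_left linear_ident) (simp add: closed)
    show "sweedler H a (\<lambda>p q. sweedler H c (\<lambda>r s. A p r \<otimes>\<^bsub>H\<^esub> B q s)) \<otimes>\<^bsub>H\<^esub> D b d
      = sweedler H a (\<lambda>p q. sweedler H c (\<lambda>u v. F p q b u v d))"
      unfolding F_def using abcd
      by (subst linear_of_sweedler[OF l H_module H_module], simp, simp add: closed,
        intro sweedler_cong linear_of_sweedler[OF l H_module H_module]) (simp_all add: closed)
  qed
  also have "\<dots> = sweedler H g (\<lambda>a b. sweedler H h (\<lambda>c d. sweedler H b (\<lambda>q r.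
      sweedler H d (\<lambda>v w. F a q r c v w))))"
    by (intro sweedler_coassoc2[OF H_module _ coalgebra_axioms] g h; unfold F_def, intro lin)
      (simp_all add: closed)
  also have "\<dots> = convolution A (convolution B D) g h"
  proof (unfold convolution_def, intro sweedler_cong g h)
    fix a b c d assume abcd: "a \<in> carrier H" "b \<in> carrier H" "c \<in> carrier H" "d \<in> carrier H"
    have l: "(\<lambda>x. A a c \<otimes>\<^bsub>H\<^esub> x) \<in> linear_maps k H H"
      using abcd by (intro linear_mult_right linear_ident) (simp add: closed)
    have F: "F a q r c v w = A a c \<otimes>\<^bsub>H\<^esub> (B q v \<otimes>\<^bsub>H\<^esub> D r w)"
      if "q \<in> carrier H" "r \<in> carrier H" "v \<in> carrier H" "w \<in> carrier H" for q r v w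
      using that abcd by (simp add: F_def closed m_assoc)
    show "sweedler H b (\<lambda>q r. sweedler H d (\<lambda>v w. F a q r c v w))
      = A a c \<otimes>\<^bsub>H\<^esub> sweedler H b (\<lambda>p q. sweedler H d (\<lambda>r s. B p r \<otimes>\<^bsub>H\<^esub> D q s))"
      using abcd
      by (subst linear_of_sweedler[OF l H_module H_module], simp, simp add: closed,
        intro sweedler_cong, simp, subst linear_of_sweedler[OF l H_module H_module])
        (simp_all add: closed F cong: sweedler_cong)
  qed
  finally show ?thesis .
qed

lemma bilinear_mult: "(\<lambda>x y. x \<otimes>\<^bsub>H\<^esub> y) \<in> bilinear_maps k H H H"
  by (intro bilinear_mapsI linear_mult_left linear_mult_right linear_ident)

lemma smult_one_mult: "r \<in> carrier k \<Longrightarrow> h \<in> carrier H \<Longrightarrow> (r \<odot>\<^bsub>H\<^esub> \<one>\<^bsub>H\<^esub>) \<otimes>\<^bsub>H\<^esub> h = r \<odot>\<^bsub>H\<^esub> h"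
  by (simp add: smult_assoc2)

lemma mult_smult_one: "r \<in> carrier k \<Longrightarrow> h \<in> carrier H \<Longrightarrow> h \<otimes>\<^bsub>H\<^esub> (r \<odot>\<^bsub>H\<^esub> \<one>\<^bsub>H\<^esub>) = r \<odot>\<^bsub>H\<^esub> h"
  using smult_one_mult by (simp add: m_comm)

lemma linear_smult_H: "f \<in> linear_maps k Z H \<Longrightarrow> r \<in> carrier k \<Longrightarrow> (\<lambda>z. r \<odot>\<^bsub>H\<^esub> f z) \<in> linear_maps k Z H"
  by (rule linear_smult[OF _ _ H_module])

text \<open>
  On \<open>H \<otimes> H\<close> both \<open>g \<otimes> h \<mapsto> S (g h)\<close> and \<open>g \<otimes> h \<mapsto> S g S h\<close> are convolution inverses of the multiplication.
\<close>

lemma antipode_mult: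
  assumes g: "g \<in> carrier H" and h: "h \<in> carrier H"
  shows "S (g \<otimes>\<^bsub>H\<^esub> h) = S g \<otimes>\<^bsub>H\<^esub> S h"
proof -
  let ?A = "\<lambda>x y. S (x \<otimes>\<^bsub>H\<^esub> y)" and ?D = "\<lambda>x y. S x \<otimes>\<^bsub>H\<^esub> S y"
  \<comment> \<open>The neutral element of convolution: the unit of \<open>H\<close> after the
    counit of H \<otimes> H.\<close>
  let ?u = "\<lambda>x y. (\<epsilon> x \<otimes>\<^bsub>k\<^esub> \<epsilon> y) \<odot>\<^bsub>H\<^esub> \<one>\<^bsub>H\<^esub>"
  have A: "?A \<in> bilinear_maps k H H H"
    by (intro bilinear_mapsI linear_antipode linear_mult_left linear_mult_right linear_ident)
  have D: "?D \<in> bilinear_maps k H H H"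
    by (intro bilinear_mapsI linear_antipode linear_mult_left linear_mult_right linear_ident) simp_all
  \<comment> \<open>Since the coproduct is multiplicative, this is the left antipode identity at the
    product of \<open>x\<close> and \<open>y\<close>.\<close>
  have AM: "convolution ?A (mult H) x y = ?u x y" if xy: "x \<in> carrier H" "y \<in> carrier H" for x y
  proof -
    have "convolution ?A (mult H) x y = sweedler H (x \<otimes>\<^bsub>H\<^esub> y) (\<lambda>a b. S a \<otimes>\<^bsub>H\<^esub> b)"
      unfolding convolution_def
      by (rule sweedler_mult[symmetric, OF H_module _ xy])
        (intro bilinear_mapsI linear_antipode linear_mult_left linear_mult_right linear_ident; simp)
    then show ?thesis using xy by (simp add: antipode_left counit_mult)
  qed
  \<comment> \<open>Commutativity of \<open>H\<close> regroups (p r)(S q S s) as (p S q)(r S s), so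
    the double sum splits into two right antipode identities.\<close>
  have MD: "convolution (mult H) ?D x y = ?u x y" if xy: "x \<in> carrier H" "y \<in> carrier H" for x y
  proof -
    have "convolution (mult H) ?D x y
      = sweedler H x (\<lambda>p q. (p \<otimes>\<^bsub>H\<^esub> S q) \<otimes>\<^bsub>H\<^esub> sweedler H y (\<lambda>r s. r \<otimes>\<^bsub>H\<^esub> S s))"
      unfolding convolution_def
      by (intro sweedler_cong xy, subst linear_of_sweedler[OF linear_mult_right[OF linear_ident]
            H_module H_module xy(2)])
        (auto simp: m_assoc m_lcomm m_comm intro!: sweedler_cong xy)
    also have "\<dots> = sweedler H x (\<lambda>p q. p \<otimes>\<^bsub>H\<^esub> S q) \<otimes>\<^bsub>H\<^esub> sweedler H y (\<lambda>r s. r \<otimes>\<^bsub>H\<^esub> S s)"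
      by (rule linear_of_sweedler[symmetric, OF linear_mult_left[OF linear_ident]
            H_module H_module xy(1)]) (auto intro: sweedler_closed[OF H_module] xy)
    also have "\<dots> = ?u x y"
      using xy by (simp add: antipode_right counit_closed smult_one_mult smult_assoc1)
    finally show ?thesis .
  qed
  have "S (g \<otimes>\<^bsub>H\<^esub> h) = convolution ?A ?u g h"
  proof -
    have 1: "sweedler H h (\<lambda>r s. S (p \<otimes>\<^bsub>H\<^esub> r) \<otimes>\<^bsub>H\<^esub> ?u q s) = \<epsilon> q \<odot>\<^bsub>H\<^esub> S (p \<otimes>\<^bsub>H\<^esub> h)"
      if "p \<in> carrier H" "q \<in> carrier H" for p q
    proof -
      have "sweedler H h (\<lambda>r s. S (p \<otimes>\<^bsub>H\<^esub> r) \<otimes>\<^bsub>H\<^esub> ?u q s)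
        = sweedler H h (\<lambda>r s. \<epsilon> s \<odot>\<^bsub>H\<^esub> (\<epsilon> q \<odot>\<^bsub>H\<^esub> S (p \<otimes>\<^bsub>H\<^esub> r)))"
        using that by (intro sweedler_cong h)
          (simp add: mult_smult counit_closed smult_assoc1 smult_left_commute)
      also have "\<dots> = \<epsilon> q \<odot>\<^bsub>H\<^esub> S (p \<otimes>\<^bsub>H\<^esub> h)"
        using that by (intro sweedler_counit_right[OF H_module] linear_smult_H linear_antipode
            linear_mult_right linear_ident h counit_closed)
      finally show ?thesis .
    qed
    have "convolution ?A ?u g h = sweedler H g (\<lambda>p q. \<epsilon> q \<odot>\<^bsub>H\<^esub> S (p \<otimes>\<^bsub>H\<^esub> h))"
      unfolding convolution_def by (intro sweedler_cong g 1)
    also have "\<dots> = S (g \<otimes>\<^bsub>H\<^esub> h)"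
      by (intro sweedler_counit_right[OF H_module] linear_antipode linear_mult_left linear_ident g h)
    finally show ?thesis by simp
  qed
  also have "\<dots> = convolution ?A (convolution (mult H) ?D) g h"
    unfolding convolution_def[of ?A] by (intro sweedler_cong g h) (simp add: MD)
  also have "\<dots> = convolution (convolution ?A (mult H)) ?D g h"
    using convolution_assoc[OF A _ D g h, of "mult H"] bilinear_mult by simp
  also have "\<dots> = convolution ?u ?D g h"
    unfolding convolution_def[of _ ?D] by (intro sweedler_cong g h) (simp add: AM)
  also have "\<dots> = S g \<otimes>\<^bsub>H\<^esub> S h"
  proof -
    have 1: "sweedler H h (\<lambda>r s. ?u p r \<otimes>\<^bsub>H\<^esub> (S q \<otimes>\<^bsub>H\<^esub> S s)) = \<epsilon> p \<odot>\<^bsub>H\<^esub> (S q \<otimes>\<^bsub>H\<^esub> S h)"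
      if "p \<in> carrier H" "q \<in> carrier H" for p q
    proof -
      have "sweedler H h (\<lambda>r s. ?u p r \<otimes>\<^bsub>H\<^esub> (S q \<otimes>\<^bsub>H\<^esub> S s))
        = sweedler H h (\<lambda>r s. \<epsilon> r \<odot>\<^bsub>H\<^esub> (\<epsilon> p \<odot>\<^bsub>H\<^esub> (S q \<otimes>\<^bsub>H\<^esub> S s)))"
        using that by (intro sweedler_cong h)
          (simp add: smult_assoc2 counit_closed smult_assoc1 smult_left_commute)
      also have "\<dots> = \<epsilon> p \<odot>\<^bsub>H\<^esub> (S q \<otimes>\<^bsub>H\<^esub> S h)"
        using that by (intro sweedler_counit_left[OF H_module] linear_smult_H linear_antipode
            linear_mult_right linear_ident h counit_closed antipode_closed)
      finally show ?thesis .
    qed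
    have "convolution ?u ?D g h = sweedler H g (\<lambda>p q. \<epsilon> p \<odot>\<^bsub>H\<^esub> (S q \<otimes>\<^bsub>H\<^esub> S h))"
      unfolding convolution_def by (intro sweedler_cong g 1)
    also have "\<dots> = S g \<otimes>\<^bsub>H\<^esub> S h"
      by (intro sweedler_counit_left[OF H_module] linear_antipode linear_mult_left linear_ident g h
          antipode_closed)
    finally show ?thesis .
  qed
  finally show ?thesis .
qed

lemma antipode_one: "S \<one>\<^bsub>H\<^esub> = \<one>\<^bsub>H\<^esub>"
proof -
  have "\<Delta> \<one>\<^bsub>H\<^esub> = pure k H H \<one>\<^bsub>H\<^esub> \<one>\<^bsub>H\<^esub>"
    using ring_hom_one[OF comult_ring_hom] by (simp add: tensor_def)
  moreover have "(\<lambda>x y. S x \<otimes>\<^bsub>H\<^esub> y) \<in> bilinear_maps k H H H"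
    by (intro bilinear_mapsI linear_antipode linear_mult_left linear_mult_right linear_ident) simp
  ultimately have "sweedler H \<one>\<^bsub>H\<^esub> (\<lambda>x y. S x \<otimes>\<^bsub>H\<^esub> y) = S \<one>\<^bsub>H\<^esub>"
    by (simp add: tensor_lift_pure[OF H_module H_module H_module])
  then show ?thesis using antipode_left[of "\<one>\<^bsub>H\<^esub>"] by (simp add: counit_one)
qed

lemma antipode_smult_one: "r \<in> carrier k \<Longrightarrow> S (r \<odot>\<^bsub>H\<^esub> \<one>\<^bsub>H\<^esub>) = r \<odot>\<^bsub>H\<^esub> \<one>\<^bsub>H\<^esub>"
  by (simp add: linear_mapsD(3)[OF antipode_linear] antipode_one)

text \<open>The sum of S(S h1) S(h2) h3 is evaluated in both bracketings. Collapsing S(h2) h3 leaves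
  S(S h); by multiplicativity the first two factors are S(S(h1) h2), which collapses and leaves
  h.\<close>

lemma antipode_antipode:
  assumes h: "h \<in> carrier H"
  shows "S (S h) = h"
proof -
  let ?f = "\<lambda>p q r. S (S p) \<otimes>\<^bsub>H\<^esub> (S q \<otimes>\<^bsub>H\<^esub> r)"
  have "S (S h) = sweedler H h (\<lambda>a b. sweedler H b (\<lambda>q r. ?f a q r))"
  proof -
    have "sweedler H b (\<lambda>q r. ?f a q r) = \<epsilon> b \<odot>\<^bsub>H\<^esub> S (S a)"
      if "a \<in> carrier H" "b \<in> carrier H" for a b
      using that linear_of_sweedler[OF linear_mult_right[OF linear_ident, of "S (S a)"]
          H_module H_module, of b "\<lambda>q r. S q \<otimes>\<^bsub>H\<^esub> r"]
      by (simp add: antipode_left mult_smult_one counit_closed)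
    then have "sweedler H h (\<lambda>a b. sweedler H b (\<lambda>q r. ?f a q r))
        = sweedler H h (\<lambda>a b. \<epsilon> b \<odot>\<^bsub>H\<^esub> S (S a))"
      by (intro sweedler_cong h)
    also have "\<dots> = S (S h)"
      by (intro sweedler_counit_right[OF H_module] linear_antipode linear_ident h)
    finally show ?thesis by simp
  qed
  also have "\<dots> = sweedler H h (\<lambda>a b. sweedler H a (\<lambda>p q. ?f p q b))"
    by (intro sweedler_coassoc[symmetric, OF H_module] h linear_mult_left linear_mult_right
        linear_antipode linear_ident) simp_all
  also have "\<dots> = sweedler H h (\<lambda>a b. \<epsilon> a \<odot>\<^bsub>H\<^esub> b)"
  proof (intro sweedler_cong h)
    fix a b assume ab: "a \<in> carrier H" "b \<in> carrier H"
    have l: "(\<lambda>x. S x \<otimes>\<^bsub>H\<^esub> b) \<in> linear_maps k H H"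
      by (intro linear_mult_left linear_antipode linear_ident ab)
    have "sweedler H a (\<lambda>p q. ?f p q b) = sweedler H a (\<lambda>p q. S (S p \<otimes>\<^bsub>H\<^esub> q) \<otimes>\<^bsub>H\<^esub> b)"
      using ab by (intro sweedler_cong) (simp_all add: antipode_mult m_assoc)
    also have "\<dots> = \<epsilon> a \<odot>\<^bsub>H\<^esub> b"
      using linear_of_sweedler[OF l H_module H_module ab(1), of "\<lambda>p q. S p \<otimes>\<^bsub>H\<^esub> q"] ab
      by (simp add: antipode_left antipode_smult_one counit_closed smult_one_mult)
    finally show "sweedler H a (\<lambda>p q. ?f p q b) = \<epsilon> a \<odot>\<^bsub>H\<^esub> b" .
  qed
  also have "\<dots> = h" by (simp add: counit_left h)
  finally show ?thesis .
qed

text \<open>The hat bimodule is defined through \<open>inv_into\<close>; as S is an involution, its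
  action can be computed with S itself.\<close>

lemma inv_antipode: "h \<in> carrier H \<Longrightarrow> inv_into (carrier H) S h = S h"
  by (rule inv_into_f_eq) (auto simp: antipode_antipode intro: inj_on_inverseI[of _ S])

end

section \<open>Module coalgebras\<close>

lemma restrict_unit_simps [simp]:
  "carrier (restrict_unit H M) = carrier M" "add (restrict_unit H M) = add M"
  "zero (restrict_unit H M) = zero M"
  "r \<odot>\<^bsub>restrict_unit H M\<^esub> m = (r \<odot>\<^bsub>H\<^esub> \<one>\<^bsub>H\<^esub>) \<odot>\<^bsub>M\<^esub> m"
  by (simp_all add: restrict_unit_def)

lemma counit_module_simps [simp]:
  "carrier (counit_module k e) = carrier k" "add (counit_module k e) = add k"
  "zero (counit_module k e) = zero k" "h \<odot>\<^bsub>counit_module k e\<^esub> a = e h \<otimes>\<^bsub>k\<^esub> a"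
  by (simp_all add: counit_module_def ring.defs module.defs)

lemma abelian_group_cong:
  assumes "abelian_group A" "carrier B = carrier A" "add B = add A" "zero B = zero A"
  shows "abelian_group B"
proof -
  interpret A: abelian_group A by fact
  have "\<exists>y\<in>carrier A. y \<oplus>\<^bsub>A\<^esub> x = \<zero>\<^bsub>A\<^esub>" if "x \<in> carrier A" for x
    using that by (intro bexI[of _ "\<ominus>\<^bsub>A\<^esub> x"]) (simp_all add: A.l_neg)
  then show ?thesis
    by (intro abelian_groupI) (simp_all add: assms(2-4) A.a_ac)
qed

lemma same_module_module:
  assumes "same_module R A B" "Module.module R B"
  shows "Module.module R A"
proof -
  interpret B: Module.module R B by fact
  have "abelian_group A"
    using assms(1) by (intro abelian_group_cong[OF B.abelian_group_axioms]) (simp_all add: same_module_def)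
  then show ?thesis
    using assms(1)
    by (intro moduleI B.R.cring_axioms)
      (simp_all add: same_module_def B.smult_l_distr B.smult_r_distr B.smult_assoc1)
qed

context commutative_hopf_algebra
begin

lemma linear_maps_restrict_unit:
  assumes "f \<in> linear_maps H M N"
  shows "f \<in> linear_maps k (restrict_unit H M) (restrict_unit H N)"
  by (rule linear_mapsI) (simp_all add: linear_mapsD[OF assms])

lemma counit_smult_one: "r \<in> carrier k \<Longrightarrow> \<epsilon> (r \<odot>\<^bsub>H\<^esub> \<one>\<^bsub>H\<^esub>) = r"
  using linear_mapsD(3)[OF counit_linear, of r "\<one>\<^bsub>H\<^esub>"] by (simp add: counit_one)

text \<open>Makes a k-linear map that is equivariant along the counit into an
  \<open>H\<close>-linear one, which can then be extended over a tensor product over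
  \<open>H\<close>.\<close>

lemma counit_pullback_module:
  fixes X :: "('u, 'u, 'x) module_scheme"
  assumes "Module.module k X"
  shows "Module.module H (X\<lparr>smult := (\<lambda>h x. \<epsilon> h \<odot>\<^bsub>X\<^esub> x)\<rparr>)"
proof -
  interpret X: Module.module k X by fact
  have eadd: "\<epsilon> (g \<oplus>\<^bsub>H\<^esub> h) = \<epsilon> g \<oplus>\<^bsub>k\<^esub> \<epsilon> h" if "g \<in> carrier H" "h \<in> carrier H" for g h
    using ring_hom_add[OF counit_ring_hom that] .
  have "abelian_group (X\<lparr>smult := (\<lambda>h x. \<epsilon> h \<odot>\<^bsub>X\<^esub> x)\<rparr>)"
    by (rule abelian_group_cong[OF X.abelian_group_axioms]) simp_all
  then show ?thesis
    by (intro moduleI M_cring)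
      (simp_all add: counit_closed eadd counit_mult counit_one X.smult_l_distr X.smult_r_distr
        X.smult_assoc1)
qed

lemma counit_module: "Module.module H (counit_module k \<epsilon>)"
proof -
  have "same_module H (counit_module k \<epsilon>) ((regular_module k)\<lparr>smult := (\<lambda>h x. \<epsilon> h \<odot>\<^bsub>regular_module k\<^esub> x)\<rparr>)"
    by (simp add: same_module_def)
  then show ?thesis by (rule same_module_module) (rule counit_pullback_module[OF module_k])
qed

text \<open>In \<open>tensor\<close> the scalars act on the first factor, in the Hopf modules N
  \<otimes> A the algebra \<open>H\<close> acts on the second. On multiples of the unit the two
  agree by balancing, so restriction to \<open>k\<close> gives back the tensor product.\<close>

lemma same_module_second_action:
  fixes N A :: "('u, 'u) module"
  assumes N: "Module.module k N" and A: "Module.module k A"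
    and lin: "\<And>h. h \<in> carrier H \<Longrightarrow> act h \<in> linear_maps k A A"
    and unit: "\<And>r a. r \<in> carrier k \<Longrightarrow> a \<in> carrier A \<Longrightarrow> act (r \<odot>\<^bsub>H\<^esub> \<one>\<^bsub>H\<^esub>) a = r \<odot>\<^bsub>A\<^esub> a"
  shows "same_module k
    (restrict_unit H ((tensor k N A)\<lparr>smult := \<lambda>h. tensor_map k N A (\<lambda>n. n) (act h)\<rparr>)) (tensor k N A)"
proof -
  note NA = tensor_module[OF N A]
  have "tensor_map k N A (\<lambda>n. n) (act (r \<odot>\<^bsub>H\<^esub> \<one>\<^bsub>H\<^esub>)) x = r \<odot>\<^bsub>tensor k N A\<^esub> x"
    if r: "r \<in> carrier k" and x: "x \<in> carrier (tensor k N A)" for r x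
  proof -
    have r1: "r \<odot>\<^bsub>H\<^esub> \<one>\<^bsub>H\<^esub> \<in> carrier H" using r by simp
    show ?thesis
      by (rule tensor_ext[OF N A NA linear_tensor_map[OF N A N A linear_ident lin[OF r1]]
            linear_smult[OF linear_ident r NA] _ x])
        (simp add: tensor_map_pure[OF N A N A linear_ident lin[OF r1]] unit r
          pure_balanced[OF N A] pure_smult_left[OF N A])
  qed
  then show ?thesis by (simp add: same_module_def)
qed

end

locale hopf_module_coalgebra =
  H: commutative_hopf_algebra k H \<Delta>\<^sub>H \<epsilon>\<^sub>H S + C: module_coalgebra k H \<Delta>\<^sub>H \<epsilon>\<^sub>H C \<Delta>\<^sub>C \<epsilon>\<^sub>C
  for k :: "'u::infinite ring" and H :: "('u, 'u) module"
    and \<Delta>\<^sub>H \<epsilon>\<^sub>H S :: "'u \<Rightarrow> 'u" and C :: "('u, 'u) module" and \<Delta>\<^sub>C \<epsilon>\<^sub>C :: "'u \<Rightarrow> 'u"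
begin

abbreviation Ck :: "('u, 'u) module" where "Ck \<equiv> restrict_unit H C"
abbreviation CC :: "('u, 'u) module" where "CC \<equiv> tensor k Ck Ck"
abbreviation CH :: "('u, 'u) module" where "CH \<equiv> tensor k Ck H"

lemmas Ck_module = C.module_C
lemmas CC_module = tensor_module[OF Ck_module Ck_module]
lemmas CH_module = tensor_module[OF Ck_module H.H_module]

lemma act_closed [simp]: "h \<in> carrier H \<Longrightarrow> c \<in> carrier C \<Longrightarrow> h \<odot>\<^bsub>C\<^esub> c \<in> carrier C"
  by (rule C.act.smult_closed)

lemma linear_act_left:
  "f \<in> linear_maps k Z H \<Longrightarrow> c \<in> carrier C \<Longrightarrow> (\<lambda>z. f z \<odot>\<^bsub>C\<^esub> c) \<in> linear_maps k Z Ck"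
proof (rule linear_mapsI)
  fix r z assume f: "f \<in> linear_maps k Z H" and z: "r \<in> carrier k" "z \<in> carrier Z" "c \<in> carrier C"
  have "r \<odot>\<^bsub>H\<^esub> f z = (r \<odot>\<^bsub>H\<^esub> \<one>\<^bsub>H\<^esub>) \<otimes>\<^bsub>H\<^esub> f z"
    using z linear_mapsD(1)[OF f] by (simp add: H.smult_one_mult)
  then show "f (r \<odot>\<^bsub>Z\<^esub> z) \<odot>\<^bsub>C\<^esub> c = r \<odot>\<^bsub>Ck\<^esub> (f z \<odot>\<^bsub>C\<^esub> c)"
    using z by (simp add: linear_mapsD[OF f] C.act.smult_assoc1)
qed (simp_all add: linear_mapsD C.act.smult_l_distr)

lemma linear_act_right:
  "f \<in> linear_maps k Z Ck \<Longrightarrow> h \<in> carrier H \<Longrightarrow> (\<lambda>z. h \<odot>\<^bsub>C\<^esub> f z) \<in> linear_maps k Z Ck"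
  using linear_mapsD[of f k Z Ck]
  by (intro linear_mapsI) (simp_all add: C.act.smult_r_distr C.act.smult_left_commute)

lemma linear_act: "h \<in> carrier H \<Longrightarrow> (\<lambda>c. h \<odot>\<^bsub>C\<^esub> c) \<in> linear_maps k Ck Ck"
  by (rule linear_act_right[OF linear_ident])

lemma sweedler_act:
  assumes "Module.module k P" "b \<in> bilinear_maps k Ck Ck P" "c \<in> carrier C" "h \<in> carrier H"
  shows "C.sweedler P (h \<odot>\<^bsub>C\<^esub> c) b
    = C.sweedler P c (\<lambda>p q. H.sweedler P h (\<lambda>r s. b (r \<odot>\<^bsub>C\<^esub> p) (s \<odot>\<^bsub>C\<^esub> q)))"
  unfolding C.comult_act[OF assms(3,4)]
  by (rule lift_tensor_map2(1)[OF Ck_module Ck_module H.H_module H.H_module Ck_module Ck_module assms(1,2)])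
    (simp_all add: assms C.comult_closed H.comult_closed)

subsection \<open>The Hopf module \<open>C \<otimes> H\<close>\<close>

definition CH_hopf :: "('u, 'u) module" where
  "CH_hopf = CH\<lparr>smult := \<lambda>h. tensor_map k Ck H (\<lambda>c. c) (\<lambda>g. h \<otimes>\<^bsub>H\<^esub> g)\<rparr>"

abbreviation CHC :: "('u, 'u) module" where "CHC \<equiv> tensor k CH Ck"

text \<open>In Sweedler notation c \<otimes> h goes to (c1 \<otimes> h1) \<otimes> c2 h2. With the
  action of \<open>CH_hopf\<close> this is the Hopf module induced from the comodule
  \<open>C\<close>, at which the equivalence will be evaluated.\<close>

definition CH_coact :: "'u \<Rightarrow> 'u" where
  "CH_coact = tensor_lift CHC (\<lambda>c h. C.sweedler CHC c (\<lambda>a b. H.sweedler CHC h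
    (\<lambda>p q. pure k CH Ck (pure k Ck H a p) (q \<odot>\<^bsub>C\<^esub> b))))"

lemmas CHC_module = tensor_module[OF CH_module Ck_module]

lemma CH_hopf_simps [simp]:
  "carrier CH_hopf = carrier CH" "add CH_hopf = add CH" "zero CH_hopf = zero CH"
  "smult CH_hopf = (\<lambda>h. tensor_map k Ck H (\<lambda>c. c) (\<lambda>g. h \<otimes>\<^bsub>H\<^esub> g))"
  by (simp_all add: CH_hopf_def)

lemma linear_mult: "h \<in> carrier H \<Longrightarrow> (\<lambda>g. h \<otimes>\<^bsub>H\<^esub> g) \<in> linear_maps k H H"
  by (rule H.linear_mult_right[OF linear_ident])

lemma linear_CH_act:
  "h \<in> carrier H \<Longrightarrow> tensor_map k Ck H (\<lambda>c. c) (\<lambda>g. h \<otimes>\<^bsub>H\<^esub> g) \<in> linear_maps k CH CH"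
  by (rule linear_tensor_map[OF Ck_module H.H_module Ck_module H.H_module linear_ident linear_mult])

lemma CH_act_pure [simp]:
  "h \<in> carrier H \<Longrightarrow> c \<in> carrier C \<Longrightarrow> g \<in> carrier H \<Longrightarrow>
    tensor_map k Ck H (\<lambda>c. c) (\<lambda>g. h \<otimes>\<^bsub>H\<^esub> g) (pure k Ck H c g) = pure k Ck H c (h \<otimes>\<^bsub>H\<^esub> g)"
  using tensor_map_pure[OF Ck_module H.H_module Ck_module H.H_module linear_ident linear_mult] by simp

lemma same_module_CH_hopf: "same_module k (restrict_unit H CH_hopf) CH"
  unfolding CH_hopf_def
  by (rule H.same_module_second_action[OF Ck_module H.H_module linear_mult])
    (simp_all add: H.smult_one_mult)

lemma CH_hopf_module: "Module.module H CH_hopf"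
proof (rule moduleI)
  interpret CH: Module.module k CH by (rule CH_module)
  show "cring H" by (rule H.M_cring)
  show "abelian_group CH_hopf"
    by (rule abelian_group_cong[OF CH.abelian_group_axioms]) simp_all
  fix a x assume a: "a \<in> carrier H" and x: "x \<in> carrier CH_hopf"
  show "a \<odot>\<^bsub>CH_hopf\<^esub> x \<in> carrier CH_hopf"
    using linear_mapsD(1)[OF linear_CH_act[OF a]] x by simp
  show "a \<odot>\<^bsub>CH_hopf\<^esub> (x \<oplus>\<^bsub>CH_hopf\<^esub> y) = a \<odot>\<^bsub>CH_hopf\<^esub> x \<oplus>\<^bsub>CH_hopf\<^esub> a \<odot>\<^bsub>CH_hopf\<^esub> y"
    if "y \<in> carrier CH_hopf" for y
    using linear_mapsD(2)[OF linear_CH_act[OF a]] x that by simp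
  show "(a \<oplus>\<^bsub>H\<^esub> b) \<odot>\<^bsub>CH_hopf\<^esub> x = a \<odot>\<^bsub>CH_hopf\<^esub> x \<oplus>\<^bsub>CH_hopf\<^esub> b \<odot>\<^bsub>CH_hopf\<^esub> x"
    if b: "b \<in> carrier H" for b
    using a b x unfolding CH_hopf_simps
    by (intro tensor_ext[OF Ck_module H.H_module CH_module linear_CH_act[OF H.M.add.m_closed[OF a b]]
        linear_add[OF linear_CH_act[OF a] linear_CH_act[OF b] CH_module] _ x[unfolded CH_hopf_simps]])
      (simp add: H.l_distr pure_add_right[OF Ck_module H.H_module])
  show "(a \<otimes>\<^bsub>H\<^esub> b) \<odot>\<^bsub>CH_hopf\<^esub> x = a \<odot>\<^bsub>CH_hopf\<^esub> (b \<odot>\<^bsub>CH_hopf\<^esub> x)" if b: "b \<in> carrier H" for b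
    using a b unfolding CH_hopf_simps
    by (intro tensor_ext[OF Ck_module H.H_module CH_module linear_CH_act[OF H.m_closed[OF a b]]
        linear_comp[OF linear_CH_act[OF a] linear_CH_act[OF b]] _ x[unfolded CH_hopf_simps]])
      (simp add: H.m_assoc)
next
  fix x assume x: "x \<in> carrier CH_hopf"
  show "\<one>\<^bsub>H\<^esub> \<odot>\<^bsub>CH_hopf\<^esub> x = x"
    unfolding CH_hopf_simps
    by (intro tensor_ext[OF Ck_module H.H_module CH_module linear_CH_act[OF H.one_closed] linear_ident
        _ x[unfolded CH_hopf_simps]]) simp
qed

lemma CH_coact_bilinear:
  "(\<lambda>c h. C.sweedler CHC c (\<lambda>a b. H.sweedler CHC h
    (\<lambda>p q. pure k CH Ck (pure k Ck H a p) (q \<odot>\<^bsub>C\<^esub> b)))) \<in> bilinear_maps k Ck H CHC"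
proof -
  note M = Ck_module H.H_module CH_module CHC_module
  note intros = linear_pure_left linear_pure_right linear_act_left linear_act_right linear_ident
    H.linear_sweedler_param H.linear_sweedler_arg C.linear_sweedler_param C.linear_sweedler_arg
  show ?thesis
    by (rule bilinear_mapsI; (intro bilinear_mapsI intros M)?)
      (simp_all add: pure_closed M)
qed

lemma linear_CH_coact: "CH_coact \<in> linear_maps k CH CHC"
  unfolding CH_coact_def
  by (rule linear_tensor_lift[OF Ck_module H.H_module CHC_module CH_coact_bilinear])

lemma CH_coact_pure:
  "c \<in> carrier C \<Longrightarrow> h \<in> carrier H \<Longrightarrow> CH_coact (pure k Ck H c h) =
    C.sweedler CHC c (\<lambda>a b. H.sweedler CHC h (\<lambda>p q. pure k CH Ck (pure k Ck H a p) (q \<odot>\<^bsub>C\<^esub> b)))"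
  unfolding CH_coact_def
  using tensor_lift_pure[OF Ck_module H.H_module CHC_module CH_coact_bilinear] by simp

lemmas linear_intros = linear_pure_left linear_pure_right linear_act_left linear_act_right linear_ident
  linear_smult linear_scalar
  H.linear_mult_left H.linear_mult_right H.linear_antipode
  H.linear_sweedler_param H.linear_sweedler_arg C.linear_sweedler_param C.linear_sweedler_arg
  linear_comp[OF H.counit_linear] linear_comp[OF C.counit_linear] H.counit_linear C.counit_linear

lemmas module_facts = Ck_module H.H_module CH_module CC_module CHC_module H.module_k

lemma linear_of_CH_coact:
  assumes g: "g \<in> linear_maps k CHC P" and P: "Module.module k P"
    and c: "c \<in> carrier C" and h: "h \<in> carrier H"
  shows "g (CH_coact (pure k Ck H c h)) =
    C.sweedler P c (\<lambda>a b. H.sweedler P h (\<lambda>p q. g (pure k CH Ck (pure k Ck H a p) (q \<odot>\<^bsub>C\<^esub> b))))"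
proof -
  have cl: "pure k CH Ck (pure k Ck H a p) (q \<odot>\<^bsub>C\<^esub> b) \<in> carrier CHC"
    if "a \<in> carrier C" "b \<in> carrier C" "p \<in> carrier H" "q \<in> carrier H" for a b p q
    using that by (simp add: pure_closed module_facts)
  have "g (CH_coact (pure k Ck H c h)) = C.sweedler P c (\<lambda>a b. g (H.sweedler CHC h
      (\<lambda>p q. pure k CH Ck (pure k Ck H a p) (q \<odot>\<^bsub>C\<^esub> b))))"
    unfolding CH_coact_pure[OF c h]
    by (rule C.linear_of_sweedler[OF g CHC_module P])
      (simp_all add: c h cl H.sweedler_closed[OF CHC_module])
  also have "\<dots> = C.sweedler P c (\<lambda>a b. H.sweedler P h
      (\<lambda>p q. g (pure k CH Ck (pure k Ck H a p) (q \<odot>\<^bsub>C\<^esub> b))))"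
    by (intro C.sweedler_cong H.linear_of_sweedler[OF g CHC_module P]) (simp_all add: c h cl)
  finally show ?thesis .
qed

lemma lift_CH_coact:
  assumes b: "b \<in> bilinear_maps k CH Ck P" and P: "Module.module k P"
    and c: "c \<in> carrier C" and h: "h \<in> carrier H"
  shows "tensor_lift P b (CH_coact (pure k Ck H c h)) =
    C.sweedler P c (\<lambda>x y. H.sweedler P h (\<lambda>p q. b (pure k Ck H x p) (q \<odot>\<^bsub>C\<^esub> y)))"
  unfolding linear_of_CH_coact[OF linear_tensor_lift[OF CH_module Ck_module P b] P c h]
  by (intro C.sweedler_cong H.sweedler_cong)
    (simp_all add: c h tensor_lift_pure[OF CH_module Ck_module P b] pure_closed module_facts)

text \<open>Both sides are the sum of (c1 \<otimes> h1) \<otimes> (c2 h2 \<otimes> c3 h3), reached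
  through different bracketings. On the right side the module coalgebra law splits the coproduct of
  c2 h2 before \<open>sweedler_coassoc2\<close> applies.\<close>

lemma CH_coact_coassoc:
  assumes m: "m \<in> carrier CH"
  shows "tensor_assoc k CH Ck Ck (tensor_map k CHC Ck CH_coact (\<lambda>c. c) (CH_coact m))
    = tensor_map k CH CC (\<lambda>m. m) \<Delta>\<^sub>C (CH_coact m)"
proof -
  let ?T = "tensor k CH CC"
  note T = tensor_module[OF CH_module CC_module]
  let ?L = "\<lambda>x. tensor_assoc k CH Ck Ck (tensor_map k CHC Ck CH_coact (\<lambda>c. c) x)"
  let ?R = "tensor_map k CH CC (\<lambda>m. m) \<Delta>\<^sub>C"
  let ?G = "\<lambda>a1 a2 a3 p1 p2 p3.
    pure k CH CC (pure k Ck H a1 p1) (pure k Ck Ck (p2 \<odot>\<^bsub>C\<^esub> a2) (p3 \<odot>\<^bsub>C\<^esub> a3))"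
  have L: "?L \<in> linear_maps k CHC ?T"
    by (rule linear_comp[OF linear_tensor_assoc[OF CH_module Ck_module Ck_module]
          linear_tensor_map[OF CH_module Ck_module CHC_module Ck_module linear_CH_coact linear_ident]])
  have R: "?R \<in> linear_maps k CHC ?T"
    by (rule linear_tensor_map[OF CH_module Ck_module CH_module CC_module linear_ident C.comult_linear])
  have L_pure: "?L (pure k CH Ck (pure k Ck H a p) d)
      = C.sweedler ?T a (\<lambda>a1 a2. H.sweedler ?T p (\<lambda>p1 p2.
        pure k CH CC (pure k Ck H a1 p1) (pure k Ck Ck (p2 \<odot>\<^bsub>C\<^esub> a2) d)))"
    if "a \<in> carrier C" "p \<in> carrier H" "d \<in> carrier C" for a p d
  proof -
    have lin: "(\<lambda>t. tensor_assoc k CH Ck Ck (pure k CHC Ck t d)) \<in> linear_maps k CHC ?T"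
      using that
      by (intro linear_comp[OF linear_tensor_assoc[OF CH_module Ck_module Ck_module]]
          linear_pure_left CHC_module Ck_module linear_ident) simp
    have "?L (pure k CH Ck (pure k Ck H a p) d)
        = tensor_assoc k CH Ck Ck (pure k CHC Ck (CH_coact (pure k Ck H a p)) d)"
      using that tensor_map_pure[OF CH_module Ck_module CHC_module Ck_module linear_CH_coact linear_ident]
      by (simp add: pure_closed module_facts)
    also have "\<dots> = C.sweedler ?T a (\<lambda>a1 a2. H.sweedler ?T p (\<lambda>p1 p2. tensor_assoc k CH Ck Ck
        (pure k CHC Ck (pure k CH Ck (pure k Ck H a1 p1) (p2 \<odot>\<^bsub>C\<^esub> a2)) d)))"
      by (rule linear_of_CH_coact[OF lin T that(1,2)])
    also have "\<dots> = C.sweedler ?T a (\<lambda>a1 a2. H.sweedler ?T p (\<lambda>p1 p2.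
        pure k CH CC (pure k Ck H a1 p1) (pure k Ck Ck (p2 \<odot>\<^bsub>C\<^esub> a2) d)))"
      using that
      by (intro C.sweedler_cong H.sweedler_cong tensor_assoc_pure[OF CH_module Ck_module Ck_module])
        (simp_all add: pure_closed module_facts)
    finally show ?thesis .
  qed
  have R_pure: "?R (pure k CH Ck (pure k Ck H a p) (q \<odot>\<^bsub>C\<^esub> b))
      = C.sweedler ?T b (\<lambda>b1 b2. H.sweedler ?T q (\<lambda>q1 q2. ?G a b1 b2 p q1 q2))"
    if "a \<in> carrier C" "b \<in> carrier C" "p \<in> carrier H" "q \<in> carrier H" for a b p q
  proof -
    have lin: "(\<lambda>t. pure k CH CC (pure k Ck H a p) t) \<in> linear_maps k CC ?T"
      using that by (intro linear_pure_right linear_ident CH_module CC_module)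
        (simp add: pure_closed module_facts)
    have "?R (pure k CH Ck (pure k Ck H a p) (q \<odot>\<^bsub>C\<^esub> b))
        = pure k CH CC (pure k Ck H a p) (\<Delta>\<^sub>C (q \<odot>\<^bsub>C\<^esub> b))"
      using that tensor_map_pure[OF CH_module Ck_module CH_module CC_module linear_ident C.comult_linear]
      by (simp add: pure_closed module_facts)
    also have "\<Delta>\<^sub>C (q \<odot>\<^bsub>C\<^esub> b) = C.sweedler CC (q \<odot>\<^bsub>C\<^esub> b) (\<lambda>x y. pure k Ck Ck x y)"
      using that by (simp add: C.sweedler_pure)
    also have "pure k CH CC (pure k Ck H a p) \<dots>
        = C.sweedler ?T (q \<odot>\<^bsub>C\<^esub> b) (\<lambda>x y. pure k CH CC (pure k Ck H a p) (pure k Ck Ck x y))"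
      using that by (intro C.linear_of_sweedler[OF lin CC_module T])
        (simp_all add: pure_closed module_facts)
    also have "\<dots> = C.sweedler ?T b (\<lambda>b1 b2. H.sweedler ?T q (\<lambda>q1 q2. ?G a b1 b2 p q1 q2))"
      using that
      by (intro sweedler_act[OF T] bilinear_mapsI linear_intros module_facts)
        (simp_all add: pure_closed module_facts)
    finally show ?thesis .
  qed
  have "?L (CH_coact (pure k Ck H c h)) = ?R (CH_coact (pure k Ck H c h))"
    if c: "c \<in> carrier C" and h: "h \<in> carrier H" for c h
  proof -
    have "?L (CH_coact (pure k Ck H c h)) = C.sweedler ?T c (\<lambda>a b. H.sweedler ?T h (\<lambda>p q.
        C.sweedler ?T a (\<lambda>a1 a2. H.sweedler ?T p (\<lambda>p1 p2. ?G a1 a2 b p1 p2 q))))"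
      unfolding linear_of_CH_coact[OF L T c h]
      by (intro C.sweedler_cong H.sweedler_cong L_pure) (simp_all add: c h)
    also have "\<dots> = C.sweedler ?T c (\<lambda>a b. H.sweedler ?T h (\<lambda>p q.
        C.sweedler ?T b (\<lambda>b1 b2. H.sweedler ?T q (\<lambda>q1 q2. ?G a b1 b2 p q1 q2))))"
      by (intro C.sweedler_coassoc2[OF T _ H.coalgebra_axioms] linear_intros module_facts)
        (simp_all add: c h pure_closed module_facts)
    also have "\<dots> = ?R (CH_coact (pure k Ck H c h))"
      unfolding linear_of_CH_coact[OF R T c h]
      by (intro C.sweedler_cong H.sweedler_cong R_pure[symmetric]) (simp_all add: c h)
    finally show ?thesis .
  qed
  then show ?thesis
    by (intro tensor_ext[OF Ck_module H.H_module T linear_comp[OF L linear_CH_coact]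
          linear_comp[OF R linear_CH_coact] _ m]) simp
qed

lemma bilinear_counit_smult:
  "Module.module k P \<Longrightarrow> (\<lambda>m c. \<epsilon>\<^sub>C c \<odot>\<^bsub>P\<^esub> m) \<in> bilinear_maps k P Ck P"
  by (intro bilinear_mapsI linear_intros) (simp_all add: C.counit_closed)

lemma CH_coact_counit:
  assumes m: "m \<in> carrier CH"
  shows "tensor_lift CH (\<lambda>m c. \<epsilon>\<^sub>C c \<odot>\<^bsub>CH\<^esub> m) (CH_coact m) = m"
proof (rule tensor_ext[OF Ck_module H.H_module CH_module _ _ _ m])
  interpret CH: Module.module k CH by (rule CH_module)
  let ?b = "\<lambda>m c. \<epsilon>\<^sub>C c \<odot>\<^bsub>CH\<^esub> m"
  note b = bilinear_counit_smult[OF CH_module]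
  show "(\<lambda>m. tensor_lift CH ?b (CH_coact m)) \<in> linear_maps k CH CH"
    by (rule linear_comp[OF linear_tensor_lift[OF CH_module Ck_module CH_module b] linear_CH_coact])
  show "(\<lambda>m. m) \<in> linear_maps k CH CH" by (rule linear_ident)
  fix c h assume "c \<in> carrier Ck" and h: "h \<in> carrier H"
  then have c: "c \<in> carrier C" by simp
  have "tensor_lift CH ?b (CH_coact (pure k Ck H c h))
    = C.sweedler CH c (\<lambda>x y. H.sweedler CH h (\<lambda>p q. \<epsilon>\<^sub>H q \<odot>\<^bsub>CH\<^esub> (\<epsilon>\<^sub>C y \<odot>\<^bsub>CH\<^esub> pure k Ck H x p)))"
    unfolding lift_CH_coact[OF b CH_module c h]
    by (intro C.sweedler_cong H.sweedler_cong)
      (simp_all add: c h C.counit_act C.counit_closed H.counit_closed pure_closed module_facts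
        CH.smult_assoc1 CH.smult_left_commute)
  also have "\<dots> = C.sweedler CH c (\<lambda>x y. \<epsilon>\<^sub>C y \<odot>\<^bsub>CH\<^esub> pure k Ck H x h)"
    by (intro C.sweedler_cong H.sweedler_counit_right[OF CH_module] linear_intros module_facts)
      (simp_all add: c h C.counit_closed)
  also have "\<dots> = pure k Ck H c h"
    by (intro C.sweedler_counit_right[OF CH_module] linear_intros module_facts) (simp_all add: c h)
  finally show "tensor_lift CH ?b (CH_coact (pure k Ck H c h)) = pure k Ck H c h" .
qed

text \<open>Multiplicativity of the coproduct of \<open>H\<close>; afterwards the sums over
  \<open>g\<close> and \<open>h\<close> are interchanged to match the order in which the lift of
  \<open>?b\<close> takes them.\<close>

lemma CH_coact_act:
  assumes m: "m \<in> carrier CH" and g: "g \<in> carrier H"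
  shows "CH_coact (g \<odot>\<^bsub>CH_hopf\<^esub> m)
    = tensor_map2 k CH Ck (\<lambda>m h. h \<odot>\<^bsub>CH_hopf\<^esub> m) (\<lambda>c h. h \<odot>\<^bsub>C\<^esub> c) (CH_coact m) (\<Delta>\<^sub>H g)"
proof -
  let ?act = "\<lambda>h. tensor_map k Ck H (\<lambda>c. c) (\<lambda>g. h \<otimes>\<^bsub>H\<^esub> g)"
  let ?b = "\<lambda>m c. H.sweedler CHC g (\<lambda>r s. pure k CH Ck (?act r m) (s \<odot>\<^bsub>C\<^esub> c))"
  note act_closed = linear_mapsD(1)[OF linear_CH_act]
  have b: "?b \<in> bilinear_maps k CH Ck CHC"
    using g by (intro bilinear_mapsI linear_intros linear_CH_act module_facts) (simp_all add: act_closed)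
  have "CH_coact (?act g m) = tensor_lift CHC ?b (CH_coact m)"
  proof (rule tensor_ext[OF Ck_module H.H_module CHC_module _ _ _ m])
    show "(\<lambda>m. CH_coact (?act g m)) \<in> linear_maps k CH CHC"
      by (rule linear_comp[OF linear_CH_coact linear_CH_act[OF g]])
    show "(\<lambda>m. tensor_lift CHC ?b (CH_coact m)) \<in> linear_maps k CH CHC"
      by (rule linear_comp[OF linear_tensor_lift[OF CH_module Ck_module CHC_module b] linear_CH_coact])
    fix c h assume "c \<in> carrier Ck" and h: "h \<in> carrier H"
    then have c: "c \<in> carrier C" by simp
    have "CH_coact (?act g (pure k Ck H c h)) = C.sweedler CHC c (\<lambda>x y. H.sweedler CHC (g \<otimes>\<^bsub>H\<^esub> h)
        (\<lambda>p q. pure k CH Ck (pure k Ck H x p) (q \<odot>\<^bsub>C\<^esub> y)))"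
      using g h c by (simp add: CH_coact_pure)
    also have "\<dots> = C.sweedler CHC c (\<lambda>x y. H.sweedler CHC g (\<lambda>r s. H.sweedler CHC h (\<lambda>p q.
        pure k CH Ck (pure k Ck H x (r \<otimes>\<^bsub>H\<^esub> p)) ((s \<otimes>\<^bsub>H\<^esub> q) \<odot>\<^bsub>C\<^esub> y))))"
      using g h c
      by (intro C.sweedler_cong H.sweedler_mult[OF CHC_module] bilinear_mapsI linear_intros module_facts)
        (simp_all add: pure_closed module_facts)
    also have "\<dots> = C.sweedler CHC c (\<lambda>x y. H.sweedler CHC h (\<lambda>p q. H.sweedler CHC g (\<lambda>r s.
        pure k CH Ck (pure k Ck H x (r \<otimes>\<^bsub>H\<^esub> p)) ((s \<otimes>\<^bsub>H\<^esub> q) \<odot>\<^bsub>C\<^esub> y))))"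
      using g h c
      by (intro C.sweedler_cong H.sweedler_swap[OF CHC_module _ H.coalgebra_axioms])
        (simp_all add: pure_closed module_facts)
    also have "\<dots> = tensor_lift CHC ?b (CH_coact (pure k Ck H c h))"
      unfolding lift_CH_coact[OF b CHC_module c h] using g h c
      by (intro C.sweedler_cong H.sweedler_cong) (simp_all add: C.act.smult_assoc1)
    finally show "CH_coact (?act g (pure k Ck H c h)) = tensor_lift CHC ?b (CH_coact (pure k Ck H c h))" .
  qed
  also have "\<dots> = tensor_map2 k CH Ck (\<lambda>m h. ?act h m) (\<lambda>c h. h \<odot>\<^bsub>C\<^esub> c) (CH_coact m) (\<Delta>\<^sub>H g)"
    using m g
    by (intro tensor_map2_lift[symmetric, OF CH_module Ck_module H.H_module H.H_module CH_module Ck_module])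
      (simp_all add: linear_mapsD(1)[OF linear_CH_coact] H.comult_closed act_closed)
  finally show ?thesis by simp
qed

text \<open>\<open>hopf_module\<close> speaks of \<open>restrict_unit H CH_hopf\<close>, the
  calculations above of \<open>CH\<close>; what remains is the comparison by
  \<open>same_module_CH_hopf\<close>.\<close>

lemma CH_is_hopf_module: "hopf_module k H \<Delta>\<^sub>H C \<Delta>\<^sub>C \<epsilon>\<^sub>C CH_hopf CH_coact"
proof -
  let ?R = "restrict_unit H CH_hopf"
  note sm = same_module_CH_hopf
  note refl = same_module_refl[of k Ck]
  note smC = same_module_tensor[OF sm refl CH_module Ck_module]
  have 1: "CH_coact \<in> linear_maps k ?R (tensor k ?R Ck)"
    using linear_CH_coact linear_maps_same_module[OF sm smC] by simp
  have 2: "tensor_assoc k ?R Ck Ck (tensor_map k (tensor k ?R Ck) Ck CH_coact (\<lambda>c. c) (CH_coact m))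
      = tensor_map k ?R CC (\<lambda>m. m) \<Delta>\<^sub>C (CH_coact m)" if "m \<in> carrier CH" for m
    using CH_coact_coassoc[OF that]
    by (simp add: tensor_assoc_same_module(1)[OF sm refl refl CH_module Ck_module Ck_module]
        tensor_map_same_module[OF smC refl CHC_module Ck_module]
        tensor_map_same_module[OF sm same_module_refl CH_module CC_module])
  have 3: "tensor_lift CH_hopf (\<lambda>m c. \<epsilon>\<^sub>C c \<odot>\<^bsub>?R\<^esub> m) (CH_coact m) = m" if m: "m \<in> carrier CH" for m
  proof -
    have "tensor_lift CH_hopf (\<lambda>m c. \<epsilon>\<^sub>C c \<odot>\<^bsub>?R\<^esub> m) (CH_coact m)
        = tensor_lift CH (\<lambda>m c. \<epsilon>\<^sub>C c \<odot>\<^bsub>?R\<^esub> m) (CH_coact m)"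
      by (simp add: tensor_lift_def)
    also have "\<dots> = tensor_lift CH (\<lambda>m c. \<epsilon>\<^sub>C c \<odot>\<^bsub>CH\<^esub> m) (CH_coact m)"
      using sm m by (intro tensor_lift_cong[OF CH_module Ck_module])
        (auto simp del: restrict_unit_simps(4) simp: same_module_def C.counit_closed linear_mapsD(1)[OF linear_CH_coact])
    also have "\<dots> = m" by (rule CH_coact_counit[OF m])
    finally show ?thesis .
  qed
  have 4: "CH_coact (g \<odot>\<^bsub>CH_hopf\<^esub> m)
      = tensor_map2 k ?R Ck (\<lambda>m h. h \<odot>\<^bsub>CH_hopf\<^esub> m) (\<lambda>c h. h \<odot>\<^bsub>C\<^esub> c) (CH_coact m) (\<Delta>\<^sub>H g)"
    if "m \<in> carrier CH" "g \<in> carrier H" for m g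
    unfolding tensor_map2_same_module[OF sm refl] by (rule CH_coact_act[OF that])
  show ?thesis
    by (intro hopf_module.intro hopf_module_axioms.intro CH_hopf_module)
      (use 1 2 3 4 in simp_all)
qed

end

section \<open>Components of an equivalence and free Hopf modules\<close>

lemma isomorphismsE:
  assumes "f \<in> isomorphisms \<A> X Y"
  obtains g where "f \<in> homs \<A> X Y" "g \<in> homs \<A> Y X"
    "\<And>x. x \<in> pts \<A> X \<Longrightarrow> g (f x) = x" "\<And>y. y \<in> pts \<A> Y \<Longrightarrow> f (g y) = y"
  using assms by (auto simp: isomorphisms_def eq_on_def)

lemma naturally_isomorphicE:
  assumes "naturally_isomorphic \<A> \<B> F G"
  obtains \<phi> where "\<And>X. X \<in> obj \<A> \<Longrightarrow> \<phi> X \<in> isomorphisms \<B> (on_obj F X) (on_obj G X)"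
  using assms unfolding naturally_isomorphic_def by blast

context hopf_module_coalgebra
begin

abbreviation free_module :: "('u, 'u) module \<Rightarrow> ('u, 'u) module" where
  "free_module N \<equiv> (tensor k N Ck)\<lparr>smult := \<lambda>h. tensor_map k N Ck (\<lambda>n. n) (\<lambda>c. h \<odot>\<^bsub>C\<^esub> c)\<rparr>"

abbreviation free_coact :: "('u, 'u) module \<Rightarrow> 'u \<Rightarrow> 'u" where
  "free_coact N \<equiv> \<lambda>x. tensor_assoc_inv k N Ck Ck (tensor_map k N CC (\<lambda>n. n) \<Delta>\<^sub>C x)"

lemma same_module_free:
  "Module.module k N \<Longrightarrow> same_module k (restrict_unit H (free_module N)) (tensor k N Ck)"
  by (rule H.same_module_second_action[OF _ Ck_module linear_act]) simp_all

lemma linear_free_act: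
  "Module.module k N \<Longrightarrow> h \<in> carrier H \<Longrightarrow>
    tensor_map k N Ck (\<lambda>n. n) (\<lambda>c. h \<odot>\<^bsub>C\<^esub> c) \<in> linear_maps k (tensor k N Ck) (tensor k N Ck)"
  by (rule linear_tensor_map[OF _ Ck_module _ Ck_module linear_ident linear_act])

lemma free_act_pure:
  assumes "Module.module k N" "h \<in> carrier H" "n \<in> carrier N" "c \<in> carrier C"
  shows "tensor_map k N Ck (\<lambda>n. n) (\<lambda>c. h \<odot>\<^bsub>C\<^esub> c) (pure k N Ck n c) = pure k N Ck n (h \<odot>\<^bsub>C\<^esub> c)"
  using tensor_map_pure[OF assms(1) Ck_module assms(1) Ck_module linear_ident linear_act[OF assms(2)]]
    assms by simp

lemma free_coact_pure:
  assumes N: "Module.module k N" and "n \<in> carrier N" "c \<in> carrier C"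
  shows "free_coact N (pure k N Ck n c)
    = C.sweedler (tensor k (tensor k N Ck) Ck) c (\<lambda>a b. pure k (tensor k N Ck) Ck (pure k N Ck n a) b)"
  using tensor_map_pure[OF N Ck_module N CC_module linear_ident C.comult_linear, of n c]
    tensor_assoc_inv_pure[OF N Ck_module Ck_module, of n "\<Delta>\<^sub>C c"] assms
  by (simp add: C.comult_closed)

subsection \<open>Functionals on \<open>C\<close> that are equivariant along the counit\<close>

text \<open>
  From \<open>C \<otimes>\<^sub>H k \<cong> k\<close> as \<open>k\<close>-modules, by an isomorphism of which nothing else is known, it follows that the
  counit of \<open>C\<close> itself induces such an isomorphism, and splits.
\<close>

lemma counit_section:
  fixes g \<psi>
  defines "K \<equiv> regular_module k" and "E \<equiv> counit_module k \<epsilon>\<^sub>H"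
  defines "T \<equiv> tensor H (free_module K) E"
  assumes free: "Module.module H (free_module K)"
    and \<psi>: "\<psi> \<in> linear_maps k (restrict_unit H T) K" and g: "g \<in> linear_maps k K (restrict_unit H T)"
    and g\<psi>: "\<And>x. x \<in> carrier T \<Longrightarrow> g (\<psi> x) = x" and \<psi>g: "\<And>r. r \<in> carrier k \<Longrightarrow> \<psi> (g r) = r"
  shows "\<exists>u\<in>carrier C. \<epsilon>\<^sub>C u = \<one>\<^bsub>k\<^esub> \<and> (\<forall>X :: ('u, 'u) module. \<forall>f\<in>linear_maps k Ck X.
    Module.module k X \<longrightarrow>
    (\<forall>h\<in>carrier H. \<forall>c\<in>carrier C. f (h \<odot>\<^bsub>C\<^esub> c) = \<epsilon>\<^sub>H h \<odot>\<^bsub>X\<^esub> f c) \<longrightarrow>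
    (\<forall>c\<in>carrier C. f c = \<epsilon>\<^sub>C c \<odot>\<^bsub>X\<^esub> f u))"
proof -
  have K: "Module.module k K" unfolding K_def by (rule H.module_k)
  have E: "Module.module H E" unfolding E_def by (rule H.counit_module)
  note KC = tensor_module[OF K Ck_module]
  note sm = same_module_free[OF K]
  have T: "Module.module H T" unfolding T_def by (rule tensor_module[OF free E])
  have K_simps [simp]: "carrier K = carrier k" "add K = add k" "zero K = zero k" "smult K = mult k"
    by (simp_all add: K_def)
  have E_simps [simp]: "carrier E = carrier k" "add E = add k" "zero E = zero k"
    "h \<odot>\<^bsub>E\<^esub> a = \<epsilon>\<^sub>H h \<otimes>\<^bsub>k\<^esub> a" for h a
    by (simp_all add: E_def)
  note [simp] = H.R.one_closed C.counit_closed H.counit_closed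
  interpret E: Module.module H E by (rule E)
  interpret T: Module.module H T by (rule T)
  interpret KC: Module.module k "tensor k K Ck" by (rule KC)
  \<comment> \<open>The canonical map from \<open>C\<close> to (k \<otimes> C) \<otimes>_H k, shown
    to be surjective below.\<close>
  define j where "j c = pure H (free_module K) E (pure k K Ck \<one>\<^bsub>k\<^esub> c) \<one>\<^bsub>k\<^esub>" for c
  have pure1: "pure k K Ck \<one>\<^bsub>k\<^esub> c \<in> carrier (tensor k K Ck)" if "c \<in> carrier C" for c
    using that by (simp add: pure_closed K Ck_module)
  have j_closed: "j c \<in> carrier T" if "c \<in> carrier C" for c
    unfolding j_def T_def using that by (simp add: pure_closed free E pure1)
  have j_add: "j (c \<oplus>\<^bsub>C\<^esub> d) = j c \<oplus>\<^bsub>T\<^esub> j d" if "c \<in> carrier C" "d \<in> carrier C" for c d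
    unfolding j_def T_def using that pure_add_right[OF K Ck_module] pure_add_left[OF free E]
    by (simp add: pure1)
  have j_act: "j (h \<odot>\<^bsub>C\<^esub> c) = h \<odot>\<^bsub>T\<^esub> j c" if "c \<in> carrier C" "h \<in> carrier H" for c h
    unfolding j_def T_def
    using that pure_smult_left[OF free E that(2), of "pure k K Ck \<one>\<^bsub>k\<^esub> c" "\<one>\<^bsub>k\<^esub>"]
    by (simp add: pure1 free_act_pure[OF K])
  have j_linear: "j \<in> linear_maps k Ck (restrict_unit H T)"
    by (rule linear_mapsI) (simp_all add: j_closed j_add j_act)
  have j_zero: "j \<zero>\<^bsub>C\<^esub> = \<zero>\<^bsub>T\<^esub>"
    using j_add[of "\<zero>\<^bsub>C\<^esub>" "\<zero>\<^bsub>C\<^esub>"] j_closed[of "\<zero>\<^bsub>C\<^esub>"] T.M.add.l_cancel_one' by simp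
  have KC_pure: "\<exists>c\<in>carrier C. x = pure k K Ck \<one>\<^bsub>k\<^esub> c" if "x \<in> carrier (tensor k K Ck)" for x
    using K Ck_module that
  proof (induction rule: tensor_module_induct)
    case zero
    have "pure k K Ck \<one>\<^bsub>k\<^esub> \<zero>\<^bsub>C\<^esub> = \<zero>\<^bsub>tensor k K Ck\<^esub>"
      using linear_map_zero[OF linear_pure_right[OF K Ck_module _ linear_ident] Ck_module KC, of "\<one>\<^bsub>k\<^esub>"]
      by simp
    then show ?case by (intro bexI[of _ "\<zero>\<^bsub>C\<^esub>"]) auto
  next
    case (pure r c)
    then show ?case using pure_balanced[OF K Ck_module, of r "\<one>\<^bsub>k\<^esub>" c]
      by (intro bexI[of _ "r \<odot>\<^bsub>Ck\<^esub> c"]) simp_all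
  next
    case (add x y)
    then obtain c d where "c \<in> carrier C" "d \<in> carrier C" "x = pure k K Ck \<one>\<^bsub>k\<^esub> c" "y = pure k K Ck \<one>\<^bsub>k\<^esub> d"
      by blast
    then show ?case using pure_add_right[OF K Ck_module, of "\<one>\<^bsub>k\<^esub>" c d]
      by (intro bexI[of _ "c \<oplus>\<^bsub>C\<^esub> d"]) simp_all
  qed
  have j_surj: "\<exists>c\<in>carrier C. x = j c" if "x \<in> carrier T" for x
    using free E that[unfolded T_def]
  proof (induction rule: tensor_module_induct)
    case zero
    then show ?case using j_zero by (intro bexI[of _ "\<zero>\<^bsub>C\<^esub>"]) (simp_all add: T_def)
  next
    case (pure y a)
    then obtain c where c: "c \<in> carrier C" "y = pure k K Ck \<one>\<^bsub>k\<^esub> c" using KC_pure by auto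
    \<comment> \<open>The scalar \<open>a\<close> in the last factor is the counit of
      \<open>?h\<close>, so it can be moved across the tensor product over \<open>H\<close> and
      absorbed into \<open>c\<close>.\<close>
    let ?h = "a \<odot>\<^bsub>H\<^esub> \<one>\<^bsub>H\<^esub>"
    have "pure H (free_module K) E y a = pure H (free_module K) E y (?h \<odot>\<^bsub>E\<^esub> \<one>\<^bsub>k\<^esub>)"
      using pure by (simp add: H.counit_smult_one)
    also have "\<dots> = ?h \<odot>\<^bsub>T\<^esub> j c"
      unfolding j_def T_def c(2)[symmetric] using pure
        pure_balanced[OF free E, of ?h y "\<one>\<^bsub>k\<^esub>"] pure_smult_left[OF free E, of ?h y "\<one>\<^bsub>k\<^esub>"]
      by simp
    also have "\<dots> = j (?h \<odot>\<^bsub>C\<^esub> c)" using pure c by (simp add: j_act)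
    finally show ?case using pure c by (intro bexI[of _ "?h \<odot>\<^bsub>C\<^esub> c"]) simp_all
  next
    case (add x y)
    then obtain c d where "c \<in> carrier C" "d \<in> carrier C" "x = j c" "y = j d" by blast
    then show ?case using j_add[of c d] by (intro bexI[of _ "c \<oplus>\<^bsub>C\<^esub> d"]) (simp_all add: T_def)
  qed
  \<comment> \<open>The functional on \<open>C\<close> that the given isomorphism induces. As
    \<open>T\<close> is generated by the image of 1 under \<open>g\<close>, written
    \<open>j w\<close> below, \<chi> is also the coordinate of \<open>j c\<close> with respect to
    this generator.\<close>
  define \<chi> where "\<chi> c = \<psi> (j c)" for c
  have \<chi>: "\<chi> \<in> linear_maps k Ck K" unfolding \<chi>_def by (rule linear_comp[OF \<psi> j_linear])
  have \<chi>_closed [simp]: "\<chi> c \<in> carrier k" if "c \<in> carrier C" for c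
    using linear_mapsD(1)[OF \<chi>] that by simp
  obtain w where w: "w \<in> carrier C" "g \<one>\<^bsub>k\<^esub> = j w"
    using j_surj[of "g \<one>\<^bsub>k\<^esub>"] linear_mapsD(1)[OF g, of "\<one>\<^bsub>k\<^esub>"] by auto
  have \<chi>w: "\<chi> w = \<one>\<^bsub>k\<^esub>" unfolding \<chi>_def w(2)[symmetric] by (rule \<psi>g) simp
  have j_eq: "j c = (\<chi> c \<odot>\<^bsub>H\<^esub> \<one>\<^bsub>H\<^esub>) \<odot>\<^bsub>T\<^esub> j w" if c: "c \<in> carrier C" for c
  proof -
    have "j c = g (\<chi> c)" unfolding \<chi>_def by (rule g\<psi>[symmetric, OF j_closed[OF c]])
    also have "\<dots> = g (\<chi> c \<odot>\<^bsub>K\<^esub> \<one>\<^bsub>k\<^esub>)" using c by simp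
    also have "\<dots> = (\<chi> c \<odot>\<^bsub>H\<^esub> \<one>\<^bsub>H\<^esub>) \<odot>\<^bsub>T\<^esub> g \<one>\<^bsub>k\<^esub>"
      using linear_mapsD(3)[OF g, of "\<chi> c" "\<one>\<^bsub>k\<^esub>"] c by simp
    finally show ?thesis by (simp add: w)
  qed
  \<comment> \<open>An equivariant \<open>f\<close> factors through \<open>j\<close> as an
    \<open>H\<close>-linear map \<open>?F\<close> into \<open>X\<close> pulled back along the
    counit, so \<open>j_eq\<close> forces it to be \<chi> times its value at
    \<open>w\<close>.\<close>
  have main: "f c = \<chi> c \<odot>\<^bsub>X\<^esub> f w"
    if X: "Module.module k X" and f: "f \<in> linear_maps k Ck X"
      and fact: "\<And>h c. h \<in> carrier H \<Longrightarrow> c \<in> carrier C \<Longrightarrow> f (h \<odot>\<^bsub>C\<^esub> c) = \<epsilon>\<^sub>H h \<odot>\<^bsub>X\<^esub> f c"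
      and c: "c \<in> carrier C" for X :: "('u, 'u) module" and f c
  proof -
    interpret X: Module.module k X by (rule X)
    let ?X = "X\<lparr>smult := (\<lambda>h x. \<epsilon>\<^sub>H h \<odot>\<^bsub>X\<^esub> x)\<rparr>"
    have HX: "Module.module H ?X" by (rule H.counit_pullback_module[OF X])
    have f_closed: "f c \<in> carrier X" if "c \<in> carrier C" for c using linear_mapsD(1)[OF f] that by simp
    let ?b = "\<lambda>r c. r \<odot>\<^bsub>X\<^esub> f c"
    have b: "?b \<in> bilinear_maps k K Ck X"
      unfolding K_def by (intro bilinear_mapsI linear_smult linear_scalar linear_ident f X)
        (simp_all add: f_closed)
    let ?f = "tensor_lift X ?b"
    have fl: "?f \<in> linear_maps k (tensor k K Ck) X" by (rule linear_tensor_lift[OF K Ck_module X b])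
    have fl_pure: "?f (pure k K Ck r c) = r \<odot>\<^bsub>X\<^esub> f c" if "r \<in> carrier k" "c \<in> carrier C" for r c
      using tensor_lift_pure[OF K Ck_module X b] that by simp
    have fl_act: "?f (tensor_map k K Ck (\<lambda>n. n) (\<lambda>c. h \<odot>\<^bsub>C\<^esub> c) x) = \<epsilon>\<^sub>H h \<odot>\<^bsub>X\<^esub> ?f x"
      if h: "h \<in> carrier H" and x: "x \<in> carrier (tensor k K Ck)" for h x
      by (rule tensor_ext[OF K Ck_module X linear_comp[OF fl linear_free_act[OF K h]]
          linear_smult[OF fl H.counit_closed[OF h] X] _ x])
        (simp add: h free_act_pure[OF K h] fl_pure fact f_closed X.smult_left_commute)
    let ?F = "tensor_lift ?X (\<lambda>x a. a \<odot>\<^bsub>X\<^esub> ?f x)"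
    have Fb: "(\<lambda>x a. a \<odot>\<^bsub>X\<^esub> ?f x) \<in> bilinear_maps H (free_module K) E ?X"
      using linear_mapsD[OF fl]
      by (intro bilinear_mapsI linear_mapsI)
        (simp_all add: fl_act X.smult_l_distr X.smult_r_distr X.smult_assoc1 X.smult_left_commute)
    have F: "?F \<in> linear_maps H T ?X" unfolding T_def by (rule linear_tensor_lift[OF free E HX Fb])
    have Fj: "?F (j c) = f c" if "c \<in> carrier C" for c
      unfolding j_def using that
      by (simp add: tensor_lift_pure[OF free E HX Fb] pure1 fl_pure f_closed)
    have "f c = ?F ((\<chi> c \<odot>\<^bsub>H\<^esub> \<one>\<^bsub>H\<^esub>) \<odot>\<^bsub>T\<^esub> j w)" using c by (simp add: Fj j_eq[symmetric])
    also have "\<dots> = \<chi> c \<odot>\<^bsub>X\<^esub> f w"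
      using linear_mapsD(3)[OF F, of "\<chi> c \<odot>\<^bsub>H\<^esub> \<one>\<^bsub>H\<^esub>" "j w"] c w
      by (simp add: j_closed Fj H.counit_smult_one)
    finally show ?thesis .
  qed
  define s where "s = \<epsilon>\<^sub>C w"
  have s [simp]: "s \<in> carrier k" using w by (simp add: s_def)
  have \<epsilon>: "\<epsilon>\<^sub>C c = \<chi> c \<otimes>\<^bsub>k\<^esub> s" if "c \<in> carrier C" for c
    using main[OF K _ _ that, of \<epsilon>\<^sub>C] C.counit_linear C.counit_act w
    by (simp add: s_def K_def H.R.m_comm)
  \<comment> \<open>The functional \<chi> applied to the left leg of the coproduct of
    \<open>w\<close>. Since the counit of \<open>C\<close> is s \<chi>, the counit law reads w = s
    v, and \<chi>(w) = 1 becomes s \<chi>(v) = 1: the scalar \<open>s\<close> is invertible.\<close>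
  define v where "v = C.sweedler Ck w (\<lambda>a b. \<chi> a \<odot>\<^bsub>Ck\<^esub> b)"
  have cl: "\<chi> a \<odot>\<^bsub>Ck\<^esub> b \<in> carrier Ck" if "a \<in> carrier C" "b \<in> carrier C" for a b
    using that by simp
  have v: "v \<in> carrier C"
    using C.sweedler_closed[OF Ck_module, of w "\<lambda>a b. \<chi> a \<odot>\<^bsub>Ck\<^esub> b"] w cl by (simp add: v_def)
  have "w = C.sweedler Ck w (\<lambda>a b. \<epsilon>\<^sub>C a \<odot>\<^bsub>Ck\<^esub> b)" using C.counit_left w by simp
  also have "\<dots> = C.sweedler Ck w (\<lambda>a b. s \<odot>\<^bsub>Ck\<^esub> (\<chi> a \<odot>\<^bsub>Ck\<^esub> b))"
    by (intro C.sweedler_cong)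
      (use w in \<open>simp_all del: restrict_unit_simps(4) add: \<epsilon> C.smult_assoc1 C.smult_left_commute\<close>)
  also have "\<dots> = s \<odot>\<^bsub>Ck\<^esub> v"
    unfolding v_def
    by (rule C.linear_of_sweedler[symmetric, OF linear_smult[OF linear_ident s Ck_module] Ck_module Ck_module])
      (use w cl in simp_all)
  finally have "\<chi> w = \<chi> (s \<odot>\<^bsub>Ck\<^esub> v)" by simp
  then have sv: "s \<otimes>\<^bsub>k\<^esub> \<chi> v = \<one>\<^bsub>k\<^esub>"
    using linear_mapsD(3)[OF \<chi> s, of v] v \<chi>w by simp
  \<comment> \<open>Dividing \<open>w\<close> by \<open>s\<close> normalises its counit to 1, and
    with \<open>u\<close> in place of \<open>w\<close> the counit takes over the role of \<chi> in
    \<open>main\<close>.\<close>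
  define u where "u = \<chi> v \<odot>\<^bsub>Ck\<^esub> w"
  have u: "u \<in> carrier C" using v w by (simp add: u_def)
  show ?thesis
  proof (intro bexI[of _ u] conjI allI ballI impI u)
    show "\<epsilon>\<^sub>C u = \<one>\<^bsub>k\<^esub>"
      using linear_mapsD(3)[OF C.counit_linear, of "\<chi> v" w] v w sv
      by (simp del: restrict_unit_simps(4) add: u_def H.R.m_comm flip: s_def)
    fix X :: "('u, 'u) module" and f c
    assume X: "Module.module k X" and f: "f \<in> linear_maps k Ck X"
      and fact: "\<forall>h\<in>carrier H. \<forall>c\<in>carrier C. f (h \<odot>\<^bsub>C\<^esub> c) = \<epsilon>\<^sub>H h \<odot>\<^bsub>X\<^esub> f c"
      and c: "c \<in> carrier C"
    interpret X: Module.module k X by (rule X)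
    have fw: "f w \<in> carrier X" using linear_mapsD(1)[OF f] w by simp
    have "\<epsilon>\<^sub>C c \<odot>\<^bsub>X\<^esub> f u = (\<chi> c \<otimes>\<^bsub>k\<^esub> s) \<odot>\<^bsub>X\<^esub> (\<chi> v \<odot>\<^bsub>X\<^esub> f w)"
      using linear_mapsD(3)[OF f, of "\<chi> v" w] v w c
      by (simp del: restrict_unit_simps(4) add: u_def \<epsilon>)
    also have "\<dots> = (\<chi> c \<otimes>\<^bsub>k\<^esub> (s \<otimes>\<^bsub>k\<^esub> \<chi> v)) \<odot>\<^bsub>X\<^esub> f w"
      using v c fw by (simp add: X.smult_assoc1[symmetric] H.R.m_assoc)
    also have "\<dots> = f c" using main[OF X f _ c] fact c by (simp add: sv)
    finally show "f c = \<epsilon>\<^sub>C c \<odot>\<^bsub>X\<^esub> f u" by simp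
  qed
qed

subsection \<open>Bijectivity of the Galois map\<close>

abbreviation \<delta> :: "'u \<Rightarrow> 'u" where "\<delta> \<equiv> galois_map k H C \<Delta>\<^sub>C"

lemma galois_map_lift:
  "\<delta> = tensor_lift CC (\<lambda>c h. C.sweedler CC c (\<lambda>a b. pure k Ck Ck a (h \<odot>\<^bsub>C\<^esub> b)))"
  by (simp add: galois_map_def tensor_map_def Let_def)

lemma galois_map_bilinear:
  "(\<lambda>c h. C.sweedler CC c (\<lambda>a b. pure k Ck Ck a (h \<odot>\<^bsub>C\<^esub> b))) \<in> bilinear_maps k Ck H CC"
  by (intro bilinear_mapsI linear_intros module_facts) (simp_all add: pure_closed module_facts)

lemma linear_galois_map: "\<delta> \<in> linear_maps k CH CC"
  unfolding galois_map_lift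
  by (rule linear_tensor_lift[OF Ck_module H.H_module CC_module galois_map_bilinear])

lemma galois_map_pure:
  "c \<in> carrier C \<Longrightarrow> h \<in> carrier H \<Longrightarrow>
    \<delta> (pure k Ck H c h) = C.sweedler CC c (\<lambda>a b. pure k Ck Ck a (h \<odot>\<^bsub>C\<^esub> b))"
  unfolding galois_map_lift
  using tensor_lift_pure[OF Ck_module H.H_module CC_module galois_map_bilinear] by simp

text \<open>The tensor product of the identity of \<open>C\<close> with the counit of
  \<open>H\<close>. It plays the part of the quotient map from C \<otimes> H to (C \<otimes> H)
  \<otimes>_H k, identified with \<open>C\<close>.\<close>

abbreviation CH_proj :: "'u \<Rightarrow> 'u" where
  "CH_proj \<equiv> tensor_lift Ck (\<lambda>c h. \<epsilon>\<^sub>H h \<odot>\<^bsub>Ck\<^esub> c)"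

lemma CH_proj_bilinear: "(\<lambda>c h. \<epsilon>\<^sub>H h \<odot>\<^bsub>Ck\<^esub> c) \<in> bilinear_maps k Ck H Ck"
  by (intro bilinear_mapsI linear_smult linear_scalar linear_ident H.counit_linear Ck_module
      H.counit_closed)

lemma linear_CH_proj: "CH_proj \<in> linear_maps k CH Ck"
  by (rule linear_tensor_lift[OF Ck_module H.H_module Ck_module CH_proj_bilinear])

lemma CH_proj_pure:
  "c \<in> carrier C \<Longrightarrow> h \<in> carrier H \<Longrightarrow> CH_proj (pure k Ck H c h) = \<epsilon>\<^sub>H h \<odot>\<^bsub>Ck\<^esub> c"
  using tensor_lift_pure[OF Ck_module H.H_module Ck_module CH_proj_bilinear] by simp

lemma CH_proj_act:
  assumes "h \<in> carrier H" "x \<in> carrier CH"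
  shows "CH_proj (h \<odot>\<^bsub>CH_hopf\<^esub> x) = \<epsilon>\<^sub>H h \<odot>\<^bsub>Ck\<^esub> CH_proj x"
  unfolding CH_hopf_simps
  by (rule tensor_ext[OF Ck_module H.H_module Ck_module linear_comp[OF linear_CH_proj linear_CH_act]
        linear_smult[OF linear_CH_proj _ Ck_module] _ assms(2)])
    (use assms(1) in \<open>simp_all del: restrict_unit_simps(4)
      add: CH_proj_pure H.counit_mult C.smult_assoc1 H.counit_closed\<close>)

text \<open>In the coaction, the counit removes the leg h1 and leaves c1 \<otimes> c2 h. In this
  form \<delta> can be carried across a colinear isomorphism.\<close>

lemma galois_map_coact:
  assumes "x \<in> carrier CH"
  shows "\<delta> x = tensor_map k Ck Ck CH_proj (\<lambda>c. c) (CH_coact x)"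
proof -
  have P: "tensor_map k Ck Ck CH_proj (\<lambda>c. c) \<in> linear_maps k CHC CC"
    by (rule linear_tensor_map[OF CH_module Ck_module Ck_module Ck_module linear_CH_proj linear_ident])
  show ?thesis
  proof (rule tensor_ext[OF Ck_module H.H_module CC_module linear_galois_map
        linear_comp[OF P linear_CH_coact] _ assms])
    fix c h assume "c \<in> carrier Ck" and h: "h \<in> carrier H"
    then have c: "c \<in> carrier C" by simp
    have "tensor_map k Ck Ck CH_proj (\<lambda>c. c) (CH_coact (pure k Ck H c h))
      = C.sweedler CC c (\<lambda>a b. H.sweedler CC h (\<lambda>p q. \<epsilon>\<^sub>H p \<odot>\<^bsub>CC\<^esub> pure k Ck Ck a (q \<odot>\<^bsub>C\<^esub> b)))"
      unfolding linear_of_CH_coact[OF P CC_module c h]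
      using tensor_map_pure[OF CH_module Ck_module Ck_module Ck_module linear_CH_proj linear_ident]
      by (intro C.sweedler_cong H.sweedler_cong)
        (simp_all del: restrict_unit_simps(4) add: c h CH_proj_pure pure_closed module_facts
          pure_smult_left[OF Ck_module Ck_module] H.counit_closed)
    also have "\<dots> = C.sweedler CC c (\<lambda>a b. pure k Ck Ck a (h \<odot>\<^bsub>C\<^esub> b))"
      by (intro C.sweedler_cong H.sweedler_counit_left[OF CC_module] linear_intros module_facts)
        (simp_all add: c h)
    also have "\<dots> = \<delta> (pure k Ck H c h)" using c h by (simp add: galois_map_pure)
    finally show "\<delta> (pure k Ck H c h) = tensor_map k Ck Ck CH_proj (\<lambda>c. c) (CH_coact (pure k Ck H c h))"
      by simp
  qed
qed

text \<open>
  The unit of the adjunction at \<open>C \<otimes> H\<close> is the Galois map. As \<open>C \<otimes> H\<close> is isomorphic to some free Hopf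
  module \<open>N \<otimes> C\<close>, it is enough to identify the composite \<open>N \<otimes> C \<rightarrow> C \<otimes> C\<close>, and this is \<open>p \<otimes> C\<close> for an
  isomorphism \<open>p\<close>.
\<close>

lemma galois_map_bij_of_free:
  assumes u: "u \<in> carrier C" "\<epsilon>\<^sub>C u = \<one>\<^bsub>k\<^esub>"
    and factor: "\<And>f c. \<lbrakk>f \<in> linear_maps k Ck Ck;
      \<And>h c. h \<in> carrier H \<Longrightarrow> c \<in> carrier C \<Longrightarrow> f (h \<odot>\<^bsub>C\<^esub> c) = \<epsilon>\<^sub>H h \<odot>\<^bsub>Ck\<^esub> f c; c \<in> carrier C\<rbrakk>
      \<Longrightarrow> f c = \<epsilon>\<^sub>C c \<odot>\<^bsub>Ck\<^esub> f u"
    and N: "Module.module k N"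
    and \<theta>H: "\<theta> \<in> linear_maps H (free_module N) CH_hopf"
    and \<xi>H: "\<xi> \<in> linear_maps H CH_hopf (free_module N)"
    and \<xi>\<theta>: "\<And>x. x \<in> carrier (tensor k N Ck) \<Longrightarrow> \<xi> (\<theta> x) = x"
    and \<theta>\<xi>: "\<And>x. x \<in> carrier CH \<Longrightarrow> \<theta> (\<xi> x) = x"
    and colinear: "\<And>x. x \<in> carrier (tensor k N Ck) \<Longrightarrow>
      CH_coact (\<theta> x) = tensor_map k CH Ck \<theta> (\<lambda>c. c) (free_coact N x)"
  shows "bij_betw \<delta> (carrier CH) (carrier CC)"
proof -
  interpret N: Module.module k N by (rule N)
  let ?NC = "tensor k N Ck"
  note NC = tensor_module[OF N Ck_module]
  note NCC = tensor_module[OF NC Ck_module]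
  note M = N NC NCC module_facts
  note [simp] = H.counit_closed C.counit_closed
  note restrict_unit_simps(4)[simp del]
  have \<theta>: "\<theta> \<in> linear_maps k ?NC CH"
    using H.linear_maps_restrict_unit[OF \<theta>H]
      linear_maps_same_module[OF same_module_free[OF N] same_module_CH_hopf] by simp
  have \<xi>: "\<xi> \<in> linear_maps k CH ?NC"
    using H.linear_maps_restrict_unit[OF \<xi>H]
      linear_maps_same_module[OF same_module_CH_hopf same_module_free[OF N]] by simp
  have \<theta>_act: "\<theta> (pure k N Ck n (h \<odot>\<^bsub>C\<^esub> c)) = h \<odot>\<^bsub>CH_hopf\<^esub> \<theta> (pure k N Ck n c)"
    if "n \<in> carrier N" "c \<in> carrier C" "h \<in> carrier H" for n c h
    using linear_mapsD(3)[OF \<theta>H that(3), of "pure k N Ck n c"] that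
    by (simp add: free_act_pure[OF N] pure_closed M)
  \<comment> \<open>The counterpart of \<open>CH_proj\<close> for N \<otimes> C.\<close>
  define e where "e = tensor_lift N (\<lambda>n c. \<epsilon>\<^sub>C c \<odot>\<^bsub>N\<^esub> n)"
  have eb: "(\<lambda>n c. \<epsilon>\<^sub>C c \<odot>\<^bsub>N\<^esub> n) \<in> bilinear_maps k N Ck N" by (rule bilinear_counit_smult[OF N])
  have e: "e \<in> linear_maps k ?NC N" unfolding e_def by (rule linear_tensor_lift[OF N Ck_module N eb])
  have e_pure: "e (pure k N Ck n c) = \<epsilon>\<^sub>C c \<odot>\<^bsub>N\<^esub> n" if "n \<in> carrier N" "c \<in> carrier C" for n c
    unfolding e_def using tensor_lift_pure[OF N Ck_module N eb] that by simp
  have e_act: "e (tensor_map k N Ck (\<lambda>n. n) (\<lambda>c. h \<odot>\<^bsub>C\<^esub> c) x) = \<epsilon>\<^sub>H h \<odot>\<^bsub>N\<^esub> e x"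
    if h: "h \<in> carrier H" and x: "x \<in> carrier ?NC" for h x
    by (rule tensor_ext[OF N Ck_module N linear_comp[OF e linear_free_act[OF N h]]
          linear_smult[OF e H.counit_closed[OF h] N] _ x])
      (use h in \<open>simp add: free_act_pure[OF N] e_pure C.counit_act N.smult_assoc1 N.smult_left_commute\<close>)
  \<comment> \<open>\<open>p\<close> and \<open>q\<close> are the maps that \<theta> and \<xi>
    induce between the quotients \<open>N\<close> and \<open>C\<close>; elements are lifted back to
    N \<otimes> C by \<open>u\<close>, whose counit is 1, and to C \<otimes> H by the unit of
    \<open>H\<close>.\<close>
  define p where "p n = CH_proj (\<theta> (pure k N Ck n u))" for n
  define q where "q c = e (\<xi> (pure k Ck H c \<one>\<^bsub>H\<^esub>))" for c
  have p: "p \<in> linear_maps k N Ck"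
    unfolding p_def using u
    by (intro linear_comp[OF linear_CH_proj] linear_comp[OF \<theta>] linear_pure_left linear_ident M) simp
  have q: "q \<in> linear_maps k Ck N"
    unfolding q_def
    by (intro linear_comp[OF e] linear_comp[OF \<xi>] linear_pure_left linear_ident M) simp
  \<comment> \<open>For fixed \<open>n\<close> the left side is equivariant along the counit in
    \<open>c\<close>, so \<open>factor\<close> makes it the counit of \<open>c\<close> times its
    value at \<open>u\<close>, which is \<open>p n\<close>.\<close>
  have proj_\<theta>_pure: "CH_proj (\<theta> (pure k N Ck n c)) = \<epsilon>\<^sub>C c \<odot>\<^bsub>Ck\<^esub> p n"
    if n: "n \<in> carrier N" and c: "c \<in> carrier C" for n c
    unfolding p_def
  proof (rule factor[of "\<lambda>c. CH_proj (\<theta> (pure k N Ck n c))"])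
    show "(\<lambda>c. CH_proj (\<theta> (pure k N Ck n c))) \<in> linear_maps k Ck Ck"
      by (intro linear_comp[OF linear_CH_proj] linear_comp[OF \<theta>] linear_pure_right linear_ident M n)
    show "CH_proj (\<theta> (pure k N Ck n (h \<odot>\<^bsub>C\<^esub> c))) = \<epsilon>\<^sub>H h \<odot>\<^bsub>Ck\<^esub> CH_proj (\<theta> (pure k N Ck n c))"
      if "h \<in> carrier H" "c \<in> carrier C" for h c
      unfolding \<theta>_act[OF n that(2,1)]
      by (intro CH_proj_act) (use that n in \<open>simp_all add: linear_mapsD(1)[OF \<theta>] pure_closed M\<close>)
  qed (fact c)
  have proj_\<theta>: "CH_proj (\<theta> y) = p (e y)" if y: "y \<in> carrier ?NC" for y
    by (rule tensor_ext[OF N Ck_module Ck_module linear_comp[OF linear_CH_proj \<theta>] linear_comp[OF p e] _ y])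
      (simp add: proj_\<theta>_pure e_pure linear_mapsD(3)[OF p])
  have e_\<xi>: "e (\<xi> m) = q (CH_proj m)" if m: "m \<in> carrier CH" for m
  proof (rule tensor_ext[OF Ck_module H.H_module N linear_comp[OF e \<xi>] linear_comp[OF q linear_CH_proj] _ m])
    fix c h assume c: "c \<in> carrier Ck" and h: "h \<in> carrier H"
    have "pure k Ck H c h = h \<odot>\<^bsub>CH_hopf\<^esub> pure k Ck H c \<one>\<^bsub>H\<^esub>" using c h by simp
    also have "e (\<xi> \<dots>) = \<epsilon>\<^sub>H h \<odot>\<^bsub>N\<^esub> q c"
      using linear_mapsD(3)[OF \<xi>H h, of "pure k Ck H c \<one>\<^bsub>H\<^esub>"] c h
      by (simp add: q_def e_act linear_mapsD(1)[OF \<xi>] pure_closed M del: CH_act_pure)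
    finally show "e (\<xi> (pure k Ck H c h)) = q (CH_proj (pure k Ck H c h))"
      using c h by (simp add: CH_proj_pure linear_mapsD(3)[OF q])
  qed
  have pq: "p (q c) = c" if c: "c \<in> carrier C" for c
  proof -
    have "p (q c) = CH_proj (\<theta> (\<xi> (pure k Ck H c \<one>\<^bsub>H\<^esub>)))"
      unfolding q_def using c by (intro proj_\<theta>[symmetric] linear_mapsD(1)[OF \<xi>]) (simp add: pure_closed M)
    also have "\<dots> = c" using c by (simp add: \<theta>\<xi> pure_closed M CH_proj_pure H.counit_one)
    finally show ?thesis .
  qed
  have qp: "q (p n) = n" if n: "n \<in> carrier N" for n
  proof -
    have "q (p n) = e (\<xi> (\<theta> (pure k N Ck n u)))"
      unfolding p_def using n u by (intro e_\<xi>[symmetric] linear_mapsD(1)[OF \<theta>]) (simp add: pure_closed M)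
    also have "\<dots> = n" using n u by (simp add: \<xi>\<theta> pure_closed M e_pure)
    finally show ?thesis .
  qed
  let ?p = "tensor_map k Ck Ck p (\<lambda>c. c)" and ?q = "tensor_map k N Ck q (\<lambda>c. c)"
  have pC: "?p \<in> linear_maps k ?NC CC"
    by (rule linear_tensor_map[OF N Ck_module Ck_module Ck_module p linear_ident])
  have qC: "?q \<in> linear_maps k CC ?NC"
    by (rule linear_tensor_map[OF Ck_module Ck_module N Ck_module q linear_ident])
  have p_pure: "?p (pure k N Ck n c) = pure k Ck Ck (p n) c" if "n \<in> carrier N" "c \<in> carrier C" for n c
    using tensor_map_pure[OF N Ck_module Ck_module Ck_module p linear_ident] that by simp
  have q_pure: "?q (pure k Ck Ck d c) = pure k N Ck (q d) c" if "d \<in> carrier C" "c \<in> carrier C" for d c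
    using tensor_map_pure[OF Ck_module Ck_module N Ck_module q linear_ident] that by simp
  have pqC: "?p (?q z) = z" if z: "z \<in> carrier CC" for z
    by (rule tensor_ext[OF Ck_module Ck_module CC_module linear_comp[OF pC qC] linear_ident _ z])
      (use linear_mapsD(1)[OF q] in \<open>simp add: q_pure p_pure pq\<close>)
  have qpC: "?q (?p y) = y" if y: "y \<in> carrier ?NC" for y
    by (rule tensor_ext[OF N Ck_module NC linear_comp[OF qC pC] linear_ident _ y])
      (use linear_mapsD(1)[OF p] in \<open>simp add: q_pure p_pure qp\<close>)
  let ?\<pi> = "tensor_map k Ck Ck CH_proj (\<lambda>c. c)" and ?\<theta> = "tensor_map k CH Ck \<theta> (\<lambda>c. c)"
  have \<pi>\<theta>C: "(\<lambda>x. ?\<pi> (?\<theta> x)) \<in> linear_maps k (tensor k ?NC Ck) CC"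
    by (rule linear_comp[OF
          linear_tensor_map[OF CH_module Ck_module Ck_module Ck_module linear_CH_proj linear_ident]
          linear_tensor_map[OF NC Ck_module CH_module Ck_module \<theta> linear_ident]])
  \<comment> \<open>Colinearity turns the coaction on \<theta>(n \<otimes> c) into the free one, (n
    \<otimes> c1) \<otimes> c2; projecting the first factor gives \<epsilon>(c1) p(n) \<otimes> c2,
    and the counit law removes c1.\<close>
  have \<delta>\<theta>: "\<delta> (\<theta> y) = ?p y" if y: "y \<in> carrier ?NC" for y
  proof (rule tensor_ext[OF N Ck_module CC_module linear_comp[OF linear_galois_map \<theta>] pC _ y])
    fix n c assume n: "n \<in> carrier N" and "c \<in> carrier Ck"
    then have c: "c \<in> carrier C" by simp
    have lin: "(\<lambda>d. pure k Ck Ck (p n) d) \<in> linear_maps k Ck CC"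
      using linear_mapsD(1)[OF p n] by (intro linear_pure_right M linear_ident)
    have "\<delta> (\<theta> (pure k N Ck n c)) = ?\<pi> (?\<theta> (free_coact N (pure k N Ck n c)))"
      using n c by (simp add: galois_map_coact linear_mapsD(1)[OF \<theta>] pure_closed M colinear)
    also have "\<dots> = C.sweedler CC c (\<lambda>a b. ?\<pi> (?\<theta> (pure k ?NC Ck (pure k N Ck n a) b)))"
      unfolding free_coact_pure[OF N n c]
      using n c by (intro C.linear_of_sweedler[OF \<pi>\<theta>C NCC CC_module]) (simp_all add: pure_closed M)
    also have "\<dots> = C.sweedler CC c (\<lambda>a b. \<epsilon>\<^sub>C a \<odot>\<^bsub>CC\<^esub> pure k Ck Ck (p n) b)"
    proof (intro C.sweedler_cong c)
      fix a b assume ab: "a \<in> carrier Ck" "b \<in> carrier Ck"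
      have "?\<pi> (?\<theta> (pure k ?NC Ck (pure k N Ck n a) b)) = pure k Ck Ck (CH_proj (\<theta> (pure k N Ck n a))) b"
        using n ab linear_mapsD(1)[OF \<theta>]
          tensor_map_pure[OF NC Ck_module CH_module Ck_module \<theta> linear_ident]
          tensor_map_pure[OF CH_module Ck_module Ck_module Ck_module linear_CH_proj linear_ident]
        by (simp add: pure_closed M)
      then show "?\<pi> (?\<theta> (pure k ?NC Ck (pure k N Ck n a) b)) = \<epsilon>\<^sub>C a \<odot>\<^bsub>CC\<^esub> pure k Ck Ck (p n) b"
        using n ab linear_mapsD(1)[OF p n]
        by (simp add: proj_\<theta>_pure pure_smult_left[OF Ck_module Ck_module])
    qed (simp add: c)
    also have "\<dots> = pure k Ck Ck (p n) c"
      using c by (intro C.sweedler_counit_left[OF CC_module lin]) simp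
    finally show "\<delta> (\<theta> (pure k N Ck n c)) = ?p (pure k N Ck n c)" using n c by (simp add: p_pure)
  qed
  show ?thesis
  proof (rule bij_betw_byWitness[where f' = "\<lambda>z. \<theta> (?q z)"])
    show "\<forall>m\<in>carrier CH. \<theta> (?q (\<delta> m)) = m"
      using \<delta>\<theta>[OF linear_mapsD(1)[OF \<xi>]] by (metis \<theta>\<xi> qpC linear_mapsD(1)[OF \<xi>])
    show "\<forall>z\<in>carrier CC. \<delta> (\<theta> (?q z)) = z"
      using \<delta>\<theta>[OF linear_mapsD(1)[OF qC]] pqC by simp
    show "\<delta> ` carrier CH \<subseteq> carrier CC" using linear_mapsD(1)[OF linear_galois_map] by blast
    show "(\<lambda>z. \<theta> (?q z)) ` carrier CC \<subseteq> carrier CH"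
      using linear_mapsD(1)[OF linear_comp[OF \<theta> qC]] by blast
  qed
qed

text \<open>The composite through Hopf modules is evaluated at \<open>k\<close>, the composite
  through \<open>k\<close>-modules at C \<otimes> H.\<close>

lemma galois_map_bij:
  assumes "inverse_equivalences (module_category k) (hopf_module_category k H \<Delta>\<^sub>H C \<Delta>\<^sub>C \<epsilon>\<^sub>C)
      (free_hopf_module_functor k H C \<Delta>\<^sub>C) (coinvariant_functor k H \<epsilon>\<^sub>H)"
  shows "bij_betw \<delta> (carrier CH) (carrier CC)"
proof -
  let ?\<A> = "module_category k" and ?\<B> = "hopf_module_category k H \<Delta>\<^sub>H C \<Delta>\<^sub>C \<epsilon>\<^sub>C"
  let ?F = "free_hopf_module_functor k H C \<Delta>\<^sub>C" and ?G = "coinvariant_functor k H \<epsilon>\<^sub>H"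
  have F_obj: "on_obj ?F N = (free_module N, free_coact N)" for N
    by (simp add: free_hopf_module_functor_def Let_def)
  have G_obj: "on_obj ?G (M, \<rho>) = restrict_unit H (tensor H M (counit_module k \<epsilon>\<^sub>H))" for M \<rho>
    by (simp add: coinvariant_functor_def)
  from assms have F: "is_functor ?\<A> ?\<B> ?F" and G: "is_functor ?\<B> ?\<A> ?G"
    and GF: "naturally_isomorphic ?\<A> ?\<A> (comp_functor ?G ?F) id_functor"
    and FG: "naturally_isomorphic ?\<B> ?\<B> (comp_functor ?F ?G) id_functor"
    by (simp_all add: inverse_equivalences_def)
  let ?K = "regular_module k" and ?T = "tensor H (free_module (regular_module k)) (counit_module k \<epsilon>\<^sub>H)"
  have K: "?K \<in> obj ?\<A>" by (simp add: module_category_def H.module_k)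
  \<comment> \<open>That k \<otimes> C is an \<open>H\<close>-module is read off from the functor,
    whose values are Hopf modules.\<close>
  then have "on_obj ?F ?K \<in> obj ?\<B>" using F unfolding is_functor_def by blast
  then have free: "Module.module H (free_module ?K)"
    by (simp add: F_obj hopf_module_category_def hopf_module_def)
  obtain \<phi> where "\<phi> ?K \<in> isomorphisms ?\<A> (on_obj (comp_functor ?G ?F) ?K) ?K"
    using GF K by (elim naturally_isomorphicE) (auto simp: id_functor_def)
  then have "\<phi> ?K \<in> isomorphisms ?\<A> (restrict_unit H ?T) ?K"
    by (simp add: comp_functor_def F_obj G_obj)
  then obtain g where "\<phi> ?K \<in> homs ?\<A> (restrict_unit H ?T) ?K" "g \<in> homs ?\<A> ?K (restrict_unit H ?T)"
    "\<And>x. x \<in> pts ?\<A> (restrict_unit H ?T) \<Longrightarrow> g (\<phi> ?K x) = x"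
    "\<And>r. r \<in> pts ?\<A> ?K \<Longrightarrow> \<phi> ?K (g r) = r"
    by (elim isomorphismsE) blast
  then have "\<phi> ?K \<in> linear_maps k (restrict_unit H ?T) ?K" "g \<in> linear_maps k ?K (restrict_unit H ?T)"
    "\<And>x. x \<in> carrier ?T \<Longrightarrow> g (\<phi> ?K x) = x" "\<And>r. r \<in> carrier k \<Longrightarrow> \<phi> ?K (g r) = r"
    by (simp_all add: module_category_def)
  from counit_section[OF free this] obtain u where u: "u \<in> carrier C" "\<epsilon>\<^sub>C u = \<one>\<^bsub>k\<^esub>"
    and factor: "\<forall>X :: ('u, 'u) module. \<forall>f\<in>linear_maps k Ck X. Module.module k X \<longrightarrow>
      (\<forall>h\<in>carrier H. \<forall>c\<in>carrier C. f (h \<odot>\<^bsub>C\<^esub> c) = \<epsilon>\<^sub>H h \<odot>\<^bsub>X\<^esub> f c) \<longrightarrow>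
      (\<forall>c\<in>carrier C. f c = \<epsilon>\<^sub>C c \<odot>\<^bsub>X\<^esub> f u)" by auto
  let ?M = "(CH_hopf, CH_coact)"
  define N where "N = on_obj ?G ?M"
  have M: "?M \<in> obj ?\<B>" by (simp add: hopf_module_category_def CH_is_hopf_module)
  then have "N \<in> obj ?\<A>" using G unfolding is_functor_def N_def by blast
  then have N: "Module.module k N" by (simp add: module_category_def)
  obtain \<phi> where "\<phi> ?M \<in> isomorphisms ?\<B> (on_obj (comp_functor ?F ?G) ?M) ?M"
    using FG M by (elim naturally_isomorphicE) (auto simp: id_functor_def)
  then have "\<phi> ?M \<in> isomorphisms ?\<B> (free_module N, free_coact N) ?M"
    by (simp add: comp_functor_def F_obj N_def)
  then obtain \<xi> where "\<phi> ?M \<in> homs ?\<B> (free_module N, free_coact N) ?M"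
    "\<xi> \<in> homs ?\<B> ?M (free_module N, free_coact N)"
    "\<And>x. x \<in> pts ?\<B> (free_module N, free_coact N) \<Longrightarrow> \<xi> (\<phi> ?M x) = x"
    "\<And>y. y \<in> pts ?\<B> ?M \<Longrightarrow> \<phi> ?M (\<xi> y) = y"
    by (elim isomorphismsE) blast
  then have \<theta>: "\<phi> ?M \<in> linear_maps H (free_module N) CH_hopf"
    "\<xi> \<in> linear_maps H CH_hopf (free_module N)"
    "\<And>x. x \<in> carrier (tensor k N Ck) \<Longrightarrow> \<xi> (\<phi> ?M x) = x"
    "\<And>x. x \<in> carrier CH \<Longrightarrow> \<phi> ?M (\<xi> x) = x"
    and "\<And>x. x \<in> carrier (tensor k N Ck) \<Longrightarrow>
      CH_coact (\<phi> ?M x) = tensor_map k (restrict_unit H CH_hopf) Ck (\<phi> ?M) (\<lambda>c. c) (free_coact N x)"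
    by (simp_all add: hopf_module_category_def)
  then have "CH_coact (\<phi> ?M x) = tensor_map k CH Ck (\<phi> ?M) (\<lambda>c. c) (free_coact N x)"
    if "x \<in> carrier (tensor k N Ck)" for x
    using that by (simp add: tensor_map_same_module[OF same_module_CH_hopf same_module_refl CH_module Ck_module])
  with galois_map_bij_of_free[OF u factor[rule_format, OF _ Ck_module] N \<theta>] show ?thesis
    by blast
qed

end

section \<open>The evaluation map\<close>

locale hopf_galois_coobject = hopf_module_coalgebra k H \<Delta>\<^sub>H \<epsilon>\<^sub>H S C \<Delta>\<^sub>C \<epsilon>\<^sub>C
  for k :: "'u::infinite ring" and H :: "('u, 'u) module"
    and \<Delta>\<^sub>H \<epsilon>\<^sub>H S :: "'u \<Rightarrow> 'u" and C :: "('u, 'u) module" and \<Delta>\<^sub>C \<epsilon>\<^sub>C :: "'u \<Rightarrow> 'u" +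
  assumes galois_bij: "bij_betw (galois_map k H C \<Delta>\<^sub>C) (carrier (tensor k (restrict_unit H C) H))
    (carrier (tensor k (restrict_unit H C) (restrict_unit H C)))"
begin

abbreviation ev :: "'u \<Rightarrow> 'u" where "ev \<equiv> galois_ev k H C \<Delta>\<^sub>C \<epsilon>\<^sub>C"

abbreviation evp :: "'u \<Rightarrow> 'u \<Rightarrow> 'u" where "evp c d \<equiv> ev (pure k Ck Ck c d)"

text \<open>The extension principle for C \<otimes> C, with the elements \<delta> (c \<otimes> h) in
  place of the pure tensors.\<close>

lemma linear_galois_ext:
  assumes P: "Module.module k P" and f: "f \<in> linear_maps k CC P" and g: "g \<in> linear_maps k CC P"
    and eq: "\<And>c h. c \<in> carrier C \<Longrightarrow> h \<in> carrier H \<Longrightarrow> f (\<delta> (pure k Ck H c h)) = g (\<delta> (pure k Ck H c h))"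
    and z: "z \<in> carrier CC"
  shows "f z = g z"
proof -
  obtain x where x: "x \<in> carrier CH" "z = \<delta> x"
    using galois_bij z by (auto simp: bij_betw_def)
  have "f (\<delta> x) = g (\<delta> x)"
    by (rule tensor_ext[OF Ck_module H.H_module P linear_comp[OF f linear_galois_map]
          linear_comp[OF g linear_galois_map] _ x(1)]) (simp add: eq)
  then show ?thesis by (simp add: x)
qed

lemma linear_of_galois:
  assumes f: "f \<in> linear_maps k CC P" and P: "Module.module k P"
    and "c \<in> carrier C" "h \<in> carrier H"
  shows "f (\<delta> (pure k Ck H c h)) = C.sweedler P c (\<lambda>a b. f (pure k Ck Ck a (h \<odot>\<^bsub>C\<^esub> b)))"
  unfolding galois_map_pure[OF assms(3,4)]
  by (rule C.linear_of_sweedler[OF f CC_module P])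
    (use assms(3,4) in \<open>simp_all add: pure_closed module_facts\<close>)

lemma lift_galois:
  assumes b: "b \<in> bilinear_maps k Ck Ck P" and P: "Module.module k P"
    and "c \<in> carrier C" "h \<in> carrier H"
  shows "tensor_lift P b (\<delta> (pure k Ck H c h)) = C.sweedler P c (\<lambda>x y. b x (h \<odot>\<^bsub>C\<^esub> y))"
  unfolding linear_of_galois[OF linear_tensor_lift[OF Ck_module Ck_module P b] P assms(3,4)]
  using assms(3,4)
  by (intro C.sweedler_cong) (simp_all add: tensor_lift_pure[OF Ck_module Ck_module P b])

lemma counit_H_bilinear: "(\<lambda>c h. \<epsilon>\<^sub>C c \<odot>\<^bsub>H\<^esub> h) \<in> bilinear_maps k Ck H H"
  by (intro bilinear_mapsI linear_intros module_facts) (simp_all add: C.counit_closed)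

lemma linear_ev: "ev \<in> linear_maps k CC H"
proof -
  have "(\<lambda>z. tensor_lift H (\<lambda>c h. \<epsilon>\<^sub>C c \<odot>\<^bsub>H\<^esub> h) (inv_into (carrier CH) \<delta> z)) \<in> linear_maps k CC H"
    by (rule linear_comp[OF linear_tensor_lift[OF Ck_module H.H_module H.H_module counit_H_bilinear]
          linear_inv_into[OF linear_galois_map galois_bij CH_module]])
  then show ?thesis by (simp add: galois_ev_def comp_def)
qed

lemma ev_galois:
  assumes "c \<in> carrier C" "h \<in> carrier H"
  shows "ev (\<delta> (pure k Ck H c h)) = \<epsilon>\<^sub>C c \<odot>\<^bsub>H\<^esub> h"
proof -
  have "inv_into (carrier CH) \<delta> (\<delta> (pure k Ck H c h)) = pure k Ck H c h"
    using galois_bij assms by (simp add: bij_betw_def pure_closed module_facts)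
  then show ?thesis
    using tensor_lift_pure[OF Ck_module H.H_module H.H_module counit_H_bilinear] assms
    by (simp add: galois_ev_def)
qed

lemma bilinear_ev: "(\<lambda>c d. evp c d) \<in> bilinear_maps k Ck Ck H"
  by (intro bilinear_mapsI linear_comp[OF linear_ev] linear_intros module_facts)

lemma ev_closed [simp]: "c \<in> carrier C \<Longrightarrow> d \<in> carrier C \<Longrightarrow> evp c d \<in> carrier H"
  using bilinear_mapsD(3)[OF bilinear_ev] by simp

lemmas linear_ev_intros = linear_bilinear_left[OF bilinear_ev] linear_bilinear_right[OF bilinear_ev]

text \<open>As \<delta> is surjective, this property characterises the linear map ev; the identities
  below rest on it.\<close>

lemma sweedler_ev:
  assumes "c \<in> carrier C" "h \<in> carrier H"
  shows "C.sweedler H c (\<lambda>a b. evp a (h \<odot>\<^bsub>C\<^esub> b)) = \<epsilon>\<^sub>C c \<odot>\<^bsub>H\<^esub> h"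
  using linear_of_galois[OF linear_ev H.H_module assms] ev_galois[OF assms] by simp

lemma ev_comult:
  assumes "c \<in> carrier C"
  shows "C.sweedler H c evp = \<epsilon>\<^sub>C c \<odot>\<^bsub>H\<^esub> \<one>\<^bsub>H\<^esub>" and "ev (\<Delta>\<^sub>C c) = \<epsilon>\<^sub>C c \<odot>\<^bsub>H\<^esub> \<one>\<^bsub>H\<^esub>"
proof -
  have "C.sweedler H c evp = C.sweedler H c (\<lambda>a b. evp a (\<one>\<^bsub>H\<^esub> \<odot>\<^bsub>C\<^esub> b))"
    by (intro C.sweedler_cong) (simp_all add: assms)
  then show 1: "C.sweedler H c evp = \<epsilon>\<^sub>C c \<odot>\<^bsub>H\<^esub> \<one>\<^bsub>H\<^esub>" using sweedler_ev[OF assms H.one_closed] by simp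
  have "ev (C.sweedler CC c (\<lambda>a b. pure k Ck Ck a b)) = C.sweedler H c evp"
    by (rule C.linear_of_sweedler[OF linear_ev CC_module H.H_module])
      (simp_all add: assms pure_closed module_facts)
  then show "ev (\<Delta>\<^sub>C c) = \<epsilon>\<^sub>C c \<odot>\<^bsub>H\<^esub> \<one>\<^bsub>H\<^esub>" using 1 assms by (simp add: C.sweedler_pure)
qed

lemma smult_act:
  "r \<in> carrier k \<Longrightarrow> h \<in> carrier H \<Longrightarrow> c \<in> carrier C \<Longrightarrow> (r \<odot>\<^bsub>H\<^esub> h) \<odot>\<^bsub>C\<^esub> c = r \<odot>\<^bsub>Ck\<^esub> (h \<odot>\<^bsub>C\<^esub> c)"
  using linear_mapsD(3)[OF linear_act_left[OF linear_ident]] .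

text \<open>\<delta> carries multiplication on \<open>H\<close> to the action on the second factor
  of C \<otimes> C, so its inverse carries the action back to multiplication.\<close>

lemma ev_act_right:
  assumes g: "g \<in> carrier H" and c: "c \<in> carrier C" and d: "d \<in> carrier C"
  shows "evp c (g \<odot>\<^bsub>C\<^esub> d) = g \<otimes>\<^bsub>H\<^esub> evp c d"
proof -
  let ?b = "\<lambda>c d. evp c (g \<odot>\<^bsub>C\<^esub> d)"
  have b: "?b \<in> bilinear_maps k Ck Ck H"
    by (intro bilinear_mapsI linear_ev_intros linear_intros g) (simp_all add: g)
  have "tensor_lift H ?b z = g \<otimes>\<^bsub>H\<^esub> ev z" if "z \<in> carrier CC" for z
  proof (rule linear_galois_ext[OF H.H_module linear_tensor_lift[OF Ck_module Ck_module H.H_module b]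
        H.linear_mult_right[OF linear_ev g] _ that])
    fix c h assume c: "c \<in> carrier C" and h: "h \<in> carrier H"
    have "tensor_lift H ?b (\<delta> (pure k Ck H c h)) = C.sweedler H c (\<lambda>x y. evp x ((g \<otimes>\<^bsub>H\<^esub> h) \<odot>\<^bsub>C\<^esub> y))"
      unfolding lift_galois[OF b H.H_module c h]
      by (intro C.sweedler_cong) (simp_all add: c h g C.act.smult_assoc1)
    also have "\<dots> = g \<otimes>\<^bsub>H\<^esub> ev (\<delta> (pure k Ck H c h))"
      using c h g by (simp add: sweedler_ev ev_galois H.mult_smult C.counit_closed)
    finally show "tensor_lift H ?b (\<delta> (pure k Ck H c h)) = g \<otimes>\<^bsub>H\<^esub> ev (\<delta> (pure k Ck H c h))" .
  qed
  from this[of "pure k Ck Ck c d"] show ?thesis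
    using c d tensor_lift_pure[OF Ck_module Ck_module H.H_module b] by (simp add: pure_closed module_facts)
qed

text \<open>Tested on \<delta> (c \<otimes> g), the left side becomes the sum of ev (a \<otimes> b
  g) over the coproduct of c h, by the module coalgebra law; \<open>sweedler_ev\<close> evaluates it
  as \<epsilon>(c h) g.\<close>

lemma sweedler_ev_act:
  assumes h: "h \<in> carrier H" and c: "c \<in> carrier C" and d: "d \<in> carrier C"
  shows "H.sweedler H h (\<lambda>p q. evp (p \<odot>\<^bsub>C\<^esub> c) (q \<odot>\<^bsub>C\<^esub> d)) = \<epsilon>\<^sub>H h \<odot>\<^bsub>H\<^esub> evp c d"
proof -
  let ?b = "\<lambda>c d. H.sweedler H h (\<lambda>p q. evp (p \<odot>\<^bsub>C\<^esub> c) (q \<odot>\<^bsub>C\<^esub> d))"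
  have b: "?b \<in> bilinear_maps k Ck Ck H"
    by (intro bilinear_mapsI linear_ev_intros linear_intros h H.H_module) simp_all
  have "tensor_lift H ?b z = \<epsilon>\<^sub>H h \<odot>\<^bsub>H\<^esub> ev z" if "z \<in> carrier CC" for z
  proof (rule linear_galois_ext[OF H.H_module linear_tensor_lift[OF Ck_module Ck_module H.H_module b]
        linear_smult[OF linear_ev H.counit_closed[OF h] H.H_module] _ that])
    fix c g assume c: "c \<in> carrier C" and g: "g \<in> carrier H"
    have bg: "(\<lambda>a b. evp a (g \<odot>\<^bsub>C\<^esub> b)) \<in> bilinear_maps k Ck Ck H"
      by (intro bilinear_mapsI linear_ev_intros linear_intros g) (simp_all add: g)
    have "tensor_lift H ?b (\<delta> (pure k Ck H c g)) = C.sweedler H (h \<odot>\<^bsub>C\<^esub> c) (\<lambda>a b. evp a (g \<odot>\<^bsub>C\<^esub> b))"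
      unfolding lift_galois[OF b H.H_module c g] sweedler_act[OF H.H_module bg c h]
      by (intro C.sweedler_cong H.sweedler_cong) (simp_all add: c h g C.act.smult_left_commute)
    also have "\<dots> = \<epsilon>\<^sub>H h \<odot>\<^bsub>H\<^esub> ev (\<delta> (pure k Ck H c g))"
      using c h g
      by (simp add: sweedler_ev ev_galois C.counit_act H.counit_closed C.counit_closed H.smult_assoc1
          H.smult_left_commute)
    finally show "tensor_lift H ?b (\<delta> (pure k Ck H c g)) = \<epsilon>\<^sub>H h \<odot>\<^bsub>H\<^esub> ev (\<delta> (pure k Ck H c g))" .
  qed
  from this[of "pure k Ck Ck c d"] show ?thesis
    using c d tensor_lift_pure[OF Ck_module Ck_module H.H_module b] by (simp add: pure_closed module_facts)
qed

text \<open>Inserting \<epsilon>(h2) = h2 S(h3) in the second argument turns ev (c h \<otimes> d)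
  into the sum of S(h3) ev (c h1 \<otimes> d h2), and \<open>sweedler_ev_act\<close> absorbs h1 and
  h2.\<close>

lemma ev_act_left:
  assumes h: "h \<in> carrier H" and c: "c \<in> carrier C" and d: "d \<in> carrier C"
  shows "evp (h \<odot>\<^bsub>C\<^esub> c) d = S h \<otimes>\<^bsub>H\<^esub> evp c d"
proof -
  let ?f = "\<lambda>p q r. evp (p \<odot>\<^bsub>C\<^esub> c) ((q \<otimes>\<^bsub>H\<^esub> S r) \<odot>\<^bsub>C\<^esub> d)"
  have "evp (h \<odot>\<^bsub>C\<^esub> c) d = H.sweedler H h (\<lambda>p q. \<epsilon>\<^sub>H q \<odot>\<^bsub>H\<^esub> evp (p \<odot>\<^bsub>C\<^esub> c) d)"
    by (intro H.sweedler_counit_right[symmetric] H.H_module linear_ev_intros linear_intros)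
      (simp_all add: h c d)
  also have "\<dots> = H.sweedler H h (\<lambda>a b. H.sweedler H b (\<lambda>q r. ?f a q r))"
  proof (intro H.sweedler_cong h)
    fix a b assume ab: "a \<in> carrier H" "b \<in> carrier H"
    have lin: "(\<lambda>x. evp (a \<odot>\<^bsub>C\<^esub> c) (x \<odot>\<^bsub>C\<^esub> d)) \<in> linear_maps k H H"
      by (intro linear_ev_intros linear_intros) (simp_all add: ab c d)
    show "\<epsilon>\<^sub>H b \<odot>\<^bsub>H\<^esub> evp (a \<odot>\<^bsub>C\<^esub> c) d = H.sweedler H b (\<lambda>q r. ?f a q r)"
      using H.linear_of_sweedler[OF lin H.H_module H.H_module ab(2), of "\<lambda>q r. q \<otimes>\<^bsub>H\<^esub> S r"]
        linear_mapsD(3)[OF lin, of "\<epsilon>\<^sub>H b" "\<one>\<^bsub>H\<^esub>"] ab c d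
      by (simp add: H.antipode_right H.counit_closed)
  qed
  also have "\<dots> = H.sweedler H h (\<lambda>a b. H.sweedler H a (\<lambda>p q. ?f p q b))"
    by (intro H.sweedler_coassoc[symmetric] H.H_module h linear_ev_intros linear_intros)
      (simp_all add: c d)
  also have "\<dots> = H.sweedler H h (\<lambda>a b. \<epsilon>\<^sub>H a \<odot>\<^bsub>H\<^esub> (S b \<otimes>\<^bsub>H\<^esub> evp c d))"
  proof (intro H.sweedler_cong h)
    fix a b assume ab: "a \<in> carrier H" "b \<in> carrier H"
    have "H.sweedler H a (\<lambda>p q. ?f p q b)
        = H.sweedler H a (\<lambda>p q. S b \<otimes>\<^bsub>H\<^esub> evp (p \<odot>\<^bsub>C\<^esub> c) (q \<odot>\<^bsub>C\<^esub> d))"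
      using ab c d by (intro H.sweedler_cong)
        (simp_all add: ev_act_right H.m_comm[of _ "S b"] C.act.smult_assoc1 del: H.m_comm)
    also have "\<dots> = S b \<otimes>\<^bsub>H\<^esub> H.sweedler H a (\<lambda>p q. evp (p \<odot>\<^bsub>C\<^esub> c) (q \<odot>\<^bsub>C\<^esub> d))"
      using ab c d
      by (intro H.linear_of_sweedler[symmetric, OF H.linear_mult_right[OF linear_ident] H.H_module H.H_module])
        simp_all
    also have "\<dots> = \<epsilon>\<^sub>H a \<odot>\<^bsub>H\<^esub> (S b \<otimes>\<^bsub>H\<^esub> evp c d)"
      using ab c d by (simp add: sweedler_ev_act H.mult_smult H.counit_closed)
    finally show "H.sweedler H a (\<lambda>p q. ?f p q b) = \<epsilon>\<^sub>H a \<odot>\<^bsub>H\<^esub> (S b \<otimes>\<^bsub>H\<^esub> evp c d)" .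
  qed
  also have "\<dots> = S h \<otimes>\<^bsub>H\<^esub> evp c d"
    by (intro H.sweedler_counit_left H.H_module linear_intros) (simp_all add: h c d)
  finally show ?thesis .
qed

text \<open>On \<delta> (c \<otimes> h) the left side is the sum of c1 ev (c2 \<otimes> c3 h), which
  \<open>sweedler_ev\<close> turns into c1 \<epsilon>(c2) h, and the right side is \<epsilon>(c1) c2
  h. Both are c h.\<close>

lemma sweedler_act_ev:
  assumes c: "c \<in> carrier C" and d: "d \<in> carrier C"
  shows "C.sweedler Ck c (\<lambda>a b. evp b d \<odot>\<^bsub>C\<^esub> a) = \<epsilon>\<^sub>C c \<odot>\<^bsub>Ck\<^esub> d"
proof -
  let ?b = "\<lambda>c d. C.sweedler Ck c (\<lambda>a b. evp b d \<odot>\<^bsub>C\<^esub> a)" and ?e = "\<lambda>c d. \<epsilon>\<^sub>C c \<odot>\<^bsub>Ck\<^esub> d"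
  have b: "?b \<in> bilinear_maps k Ck Ck Ck"
    by (intro bilinear_mapsI linear_intros linear_ev_intros Ck_module) simp_all
  have e: "?e \<in> bilinear_maps k Ck Ck Ck"
    by (intro bilinear_mapsI linear_smult linear_scalar linear_ident C.counit_linear Ck_module
        C.counit_closed)
  have "tensor_lift Ck ?b z = tensor_lift Ck ?e z" if "z \<in> carrier CC" for z
  proof (rule linear_galois_ext[OF Ck_module linear_tensor_lift[OF Ck_module Ck_module Ck_module b]
        linear_tensor_lift[OF Ck_module Ck_module Ck_module e] _ that])
    fix c h assume c: "c \<in> carrier C" and h: "h \<in> carrier H"
    have "tensor_lift Ck ?b (\<delta> (pure k Ck H c h))
        = C.sweedler Ck c (\<lambda>a b. C.sweedler Ck a (\<lambda>p q. evp q (h \<odot>\<^bsub>C\<^esub> b) \<odot>\<^bsub>C\<^esub> p))"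
      by (rule lift_galois[OF b Ck_module c h])
    also have "\<dots> = C.sweedler Ck c (\<lambda>a b. C.sweedler Ck b (\<lambda>q r. evp q (h \<odot>\<^bsub>C\<^esub> r) \<odot>\<^bsub>C\<^esub> a))"
      by (intro C.sweedler_coassoc[OF Ck_module] linear_ev_intros linear_intros) (simp_all add: c h)
    also have "\<dots> = C.sweedler Ck c (\<lambda>a b. \<epsilon>\<^sub>C b \<odot>\<^bsub>Ck\<^esub> (h \<odot>\<^bsub>C\<^esub> a))"
    proof (intro C.sweedler_cong)
      fix a b assume ab: "a \<in> carrier Ck" "b \<in> carrier Ck"
      have "C.sweedler Ck b (\<lambda>q r. evp q (h \<odot>\<^bsub>C\<^esub> r) \<odot>\<^bsub>C\<^esub> a)
          = C.sweedler H b (\<lambda>q r. evp q (h \<odot>\<^bsub>C\<^esub> r)) \<odot>\<^bsub>C\<^esub> a"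
        using ab h by (intro C.linear_of_sweedler[symmetric, OF linear_act_left[OF linear_ident]
            H.H_module Ck_module]) simp_all
      then show "C.sweedler Ck b (\<lambda>q r. evp q (h \<odot>\<^bsub>C\<^esub> r) \<odot>\<^bsub>C\<^esub> a) = \<epsilon>\<^sub>C b \<odot>\<^bsub>Ck\<^esub> (h \<odot>\<^bsub>C\<^esub> a)"
        using ab h by (simp add: sweedler_ev smult_act C.counit_closed del: restrict_unit_simps(4))
    qed (simp add: c)
    also have "\<dots> = h \<odot>\<^bsub>C\<^esub> c"
      by (intro C.sweedler_counit_right[OF Ck_module linear_act] h) (simp add: c)
    also have "\<dots> = C.sweedler Ck c (\<lambda>a b. \<epsilon>\<^sub>C a \<odot>\<^bsub>Ck\<^esub> (h \<odot>\<^bsub>C\<^esub> b))"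
      by (intro C.sweedler_counit_left[symmetric, OF Ck_module linear_act] h) (simp add: c)
    also have "\<dots> = tensor_lift Ck ?e (\<delta> (pure k Ck H c h))"
      by (rule lift_galois[symmetric, OF e Ck_module c h])
    finally show "tensor_lift Ck ?b (\<delta> (pure k Ck H c h)) = tensor_lift Ck ?e (\<delta> (pure k Ck H c h))" .
  qed
  from this[of "pure k Ck Ck c d"] show ?thesis
    using c d tensor_lift_pure[OF Ck_module Ck_module Ck_module b]
      tensor_lift_pure[OF Ck_module Ck_module Ck_module e]
    by (simp add: pure_closed module_facts del: restrict_unit_simps(4))
qed

text \<open>With \<open>y\<close> fixed, x \<otimes> z is tested on \<delta> (c \<otimes> h). On the
  right, \<open>ev_act_left\<close> extracts S(h) from ev (c2 h \<otimes> y), and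
  \<open>sweedler_act_ev\<close> reduces the rest to \<epsilon>(c) y; the left side is S(h)
  \<epsilon>(c) y at once.\<close>

lemma ev_exchange:
  assumes x: "x \<in> carrier C" and y: "y \<in> carrier C" and z: "z \<in> carrier C"
  shows "S (evp x z) \<odot>\<^bsub>C\<^esub> y = evp z y \<odot>\<^bsub>C\<^esub> x"
proof -
  let ?b = "\<lambda>x z. evp z y \<odot>\<^bsub>C\<^esub> x"
  have b: "?b \<in> bilinear_maps k Ck Ck Ck"
    by (intro bilinear_mapsI linear_intros linear_ev_intros) (simp_all add: y)
  have "S (ev t) \<odot>\<^bsub>C\<^esub> y = tensor_lift Ck ?b t" if "t \<in> carrier CC" for t
  proof (rule linear_galois_ext[OF Ck_module _ linear_tensor_lift[OF Ck_module Ck_module Ck_module b] _ that])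
    show "(\<lambda>t. S (ev t) \<odot>\<^bsub>C\<^esub> y) \<in> linear_maps k CC Ck"
      by (intro linear_act_left H.linear_antipode linear_ev y)
    fix c h assume c: "c \<in> carrier C" and h: "h \<in> carrier H"
    have "tensor_lift Ck ?b (\<delta> (pure k Ck H c h)) = C.sweedler Ck c (\<lambda>a b. S h \<odot>\<^bsub>C\<^esub> (evp b y \<odot>\<^bsub>C\<^esub> a))"
      unfolding lift_galois[OF b Ck_module c h]
      by (intro C.sweedler_cong) (simp_all add: c h y ev_act_left C.act.smult_assoc1)
    also have "\<dots> = S h \<odot>\<^bsub>C\<^esub> C.sweedler Ck c (\<lambda>a b. evp b y \<odot>\<^bsub>C\<^esub> a)"
      by (intro C.linear_of_sweedler[symmetric, OF linear_act Ck_module Ck_module]) (simp_all add: c h y)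
    also have "\<dots> = S (ev (\<delta> (pure k Ck H c h))) \<odot>\<^bsub>C\<^esub> y"
      using c h y linear_mapsD(3)[OF linear_act[OF H.antipode_closed[OF h]], of "\<epsilon>\<^sub>C c" y]
        linear_mapsD(3)[OF H.antipode_linear, of "\<epsilon>\<^sub>C c" h]
      by (simp add: sweedler_act_ev ev_galois C.counit_closed smult_act del: restrict_unit_simps(4))
    finally show "S (ev (\<delta> (pure k Ck H c h))) \<odot>\<^bsub>C\<^esub> y = tensor_lift Ck ?b (\<delta> (pure k Ck H c h))" by simp
  qed
  from this[of "pure k Ck Ck x z"] show ?thesis
    using x z tensor_lift_pure[OF Ck_module Ck_module Ck_module b] by (simp add: pure_closed module_facts)
qed

end

section \<open>The herd\<close>

text \<open>The antipode is multiplicative here, so twisting an action by its inverse gives an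
  action again. This is the module behind the hat bimodule.\<close>

lemma (in commutative_hopf_algebra) antipode_pullback_module:
  fixes X :: "('u, 'u, 'x) module_scheme"
  assumes "Module.module H X"
  shows "Module.module H (X\<lparr>smult := (\<lambda>h x. inv_into (carrier H) S h \<odot>\<^bsub>X\<^esub> x)\<rparr>)"
proof -
  interpret X: Module.module H X by fact
  have "abelian_group (X\<lparr>smult := (\<lambda>h x. inv_into (carrier H) S h \<odot>\<^bsub>X\<^esub> x)\<rparr>)"
    by (rule abelian_group_cong[OF X.abelian_group_axioms]) simp_all
  then show ?thesis
    by (intro moduleI M_cring)
      (simp_all add: inv_antipode antipode_mult antipode_one linear_mapsD(2)[OF antipode_linear]
        X.smult_l_distr X.smult_r_distr X.smult_assoc1)
qed

context hopf_galois_coobject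
begin

abbreviation D3 :: "('u, 'u) module" where "D3 \<equiv> tensor k Ck CC"
abbreviation D4 :: "('u, 'u) module" where "D4 \<equiv> tensor k Ck D3"
abbreviation D5 :: "('u, 'u) module" where "D5 \<equiv> tensor k Ck D4"

lemmas D3_module = tensor_module[OF Ck_module CC_module]
lemmas D4_module = tensor_module[OF Ck_module D3_module]
lemmas D5_module = tensor_module[OF Ck_module D4_module]
lemmas HC_module = tensor_module[OF H.H_module Ck_module]

lemmas herd_modules = module_facts D3_module D4_module D5_module HC_module

abbreviation \<gamma> :: "'u \<Rightarrow> 'u" where "\<gamma> \<equiv> iterated_comult_right k Ck \<Delta>\<^sub>C"

lemma linear_shepherd: "\<gamma> \<in> linear_maps k Ck D3"
  unfolding iterated_comult_right_def
  by (rule linear_comp[OF linear_tensor_map[OF Ck_module Ck_module Ck_module CC_module linear_ident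
        C.comult_linear] C.comult_linear])

lemma shepherd_sweedler:
  "\<gamma> x = C.sweedler D3 x (\<lambda>a b. pure k Ck CC a (\<Delta>\<^sub>C b))"
  by (simp add: iterated_comult_right_def tensor_map_def)

lemma linear_of_shepherd:
  assumes "f \<in> linear_maps k D3 P" "Module.module k P" "x \<in> carrier C"
  shows "f (\<gamma> x) = C.sweedler P x (\<lambda>a b. f (pure k Ck CC a (\<Delta>\<^sub>C b)))"
  unfolding shepherd_sweedler
  by (rule C.linear_of_sweedler[OF assms(1) D3_module assms(2)])
    (use assms(3) in \<open>simp_all add: pure_closed herd_modules C.comult_closed\<close>)

text \<open>The sum of S(ev (c1 \<otimes> c2)) \<otimes> c3 is rebracketed so that c1 and c2 come
  from one coproduct; then ev after the coproduct is the counit, and S fixes scalars.\<close>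

lemma counit_shepherd_left:
  assumes x: "x \<in> carrier C"
  shows "tensor_map k H Ck (S \<circ> ev) (\<lambda>t. t) (tensor_assoc_inv k Ck Ck Ck (\<gamma> x)) = pure k H Ck \<one>\<^bsub>H\<^esub> x"
proof -
  let ?HC = "tensor k H Ck" and ?E = "tensor_map k H Ck (S \<circ> ev) (\<lambda>t. t)"
  have S_ev: "S \<circ> ev \<in> linear_maps k CC H"
    unfolding comp_def by (rule H.linear_antipode[OF linear_ev])
  note E = linear_tensor_map[OF CC_module Ck_module H.H_module Ck_module S_ev linear_ident]
  note CCC_module = tensor_module[OF CC_module Ck_module]
  note L = linear_comp[OF E linear_tensor_assoc_inv[OF Ck_module Ck_module Ck_module]]
  have "?E (tensor_assoc_inv k Ck Ck Ck (pure k Ck CC a (\<Delta>\<^sub>C b)))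
      = C.sweedler ?HC b (\<lambda>p q. pure k H Ck (S (evp a p)) q)"
    if "a \<in> carrier C" "b \<in> carrier C" for a b
  proof -
    have "?E (tensor_assoc_inv k Ck Ck Ck (pure k Ck CC a (\<Delta>\<^sub>C b)))
        = C.sweedler ?HC b (\<lambda>p q. ?E (pure k CC Ck (pure k Ck Ck a p) q))"
      using that C.linear_of_sweedler[OF E CCC_module HC_module]
      by (simp add: tensor_assoc_inv_pure[OF Ck_module Ck_module Ck_module] C.comult_closed
          pure_closed herd_modules)
    also have "\<dots> = C.sweedler ?HC b (\<lambda>p q. pure k H Ck (S (evp a p)) q)"
      using that tensor_map_pure[OF CC_module Ck_module H.H_module Ck_module S_ev linear_ident]
      by (intro C.sweedler_cong) (simp_all add: pure_closed herd_modules)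
    finally show ?thesis .
  qed
  then have "?E (tensor_assoc_inv k Ck Ck Ck (\<gamma> x))
      = C.sweedler ?HC x (\<lambda>a b. C.sweedler ?HC b (\<lambda>p q. pure k H Ck (S (evp a p)) q))"
    unfolding linear_of_shepherd[OF L HC_module x] by (intro C.sweedler_cong) (simp_all add: x)
  also have "\<dots> = C.sweedler ?HC x (\<lambda>a b. C.sweedler ?HC a (\<lambda>p q. pure k H Ck (S (evp p q)) b))"
    by (intro C.sweedler_coassoc[symmetric, OF HC_module] linear_intros linear_ev_intros herd_modules)
      (simp_all add: x)
  also have "\<dots> = C.sweedler ?HC x (\<lambda>a b. \<epsilon>\<^sub>C a \<odot>\<^bsub>?HC\<^esub> pure k H Ck \<one>\<^bsub>H\<^esub> b)"
  proof (intro C.sweedler_cong)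
    fix a b assume ab: "a \<in> carrier Ck" "b \<in> carrier Ck"
    have lin: "(\<lambda>h. pure k H Ck (S h) b) \<in> linear_maps k H ?HC"
      by (intro linear_intros herd_modules ab)
    have "C.sweedler ?HC a (\<lambda>p q. pure k H Ck (S (evp p q)) b) = pure k H Ck (S (C.sweedler H a evp)) b"
      using ab by (intro C.linear_of_sweedler[symmetric, OF lin H.H_module HC_module]) simp_all
    also have "\<dots> = \<epsilon>\<^sub>C a \<odot>\<^bsub>?HC\<^esub> pure k H Ck \<one>\<^bsub>H\<^esub> b"
      using ab by (simp add: ev_comult H.antipode_smult_one C.counit_closed pure_smult_left herd_modules)
    finally show "C.sweedler ?HC a (\<lambda>p q. pure k H Ck (S (evp p q)) b)
      = \<epsilon>\<^sub>C a \<odot>\<^bsub>?HC\<^esub> pure k H Ck \<one>\<^bsub>H\<^esub> b" .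
  qed (simp add: x)
  also have "\<dots> = pure k H Ck \<one>\<^bsub>H\<^esub> x"
    by (intro C.sweedler_counit_left[OF HC_module] linear_intros herd_modules) (simp_all add: x)
  finally show ?thesis .
qed

text \<open>With \<open>\<gamma>\<close> bracketed to the right, ev meets the coproduct of the
  second leg directly, so no rebracketing occurs.\<close>

lemma counit_shepherd_right:
  assumes x: "x \<in> carrier C"
  shows "tensor_map k Ck H (\<lambda>t. t) ev (\<gamma> x) = pure k Ck H x \<one>\<^bsub>H\<^esub>"
proof -
  have "tensor_map k Ck H (\<lambda>t. t) ev (\<gamma> x)
      = C.sweedler CH x (\<lambda>a b. tensor_map k Ck H (\<lambda>t. t) ev (pure k Ck CC a (\<Delta>\<^sub>C b)))"
    by (rule linear_of_shepherd[OF linear_tensor_map[OF Ck_module CC_module Ck_module H.H_module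
            linear_ident linear_ev] CH_module x])
  also have "\<dots> = C.sweedler CH x (\<lambda>a b. \<epsilon>\<^sub>C b \<odot>\<^bsub>CH\<^esub> pure k Ck H a \<one>\<^bsub>H\<^esub>)"
    using x tensor_map_pure[OF Ck_module CC_module Ck_module H.H_module linear_ident linear_ev]
    by (intro C.sweedler_cong)
      (simp_all add: C.comult_closed ev_comult C.counit_closed pure_balanced[OF Ck_module H.H_module]
        pure_smult_left[OF Ck_module H.H_module] del: restrict_unit_simps(4))
  also have "\<dots> = pure k Ck H x \<one>\<^bsub>H\<^esub>"
    by (intro C.sweedler_counit_right[OF CH_module] linear_intros herd_modules) (simp_all add: x)
  finally show ?thesis .
qed

lemma coassoc_shepherd:
  assumes x: "x \<in> carrier C"
  shows "tensor_map k Ck D4 (\<lambda>t. t) (tensor_assoc k Ck Ck CC)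
      (tensor_assoc k Ck CC CC (tensor_map k D3 CC \<gamma> (\<lambda>t. t) (\<gamma> x)))
    = tensor_map k Ck D4 (\<lambda>t. t) (tensor_map k Ck D3 (\<lambda>t. t) \<gamma>) (\<gamma> x)"
proof -
  let ?A = "tensor_assoc k Ck Ck CC" and ?A' = "tensor_assoc k Ck CC CC"
  let ?M = "\<lambda>y. tensor_map k Ck D4 (\<lambda>t. t) ?A (?A' y)"
  let ?L = "\<lambda>y. ?M (tensor_map k D3 CC \<gamma> (\<lambda>t. t) y)"
  let ?N = "tensor_map k Ck D3 (\<lambda>t. t) \<gamma>" and ?R = "tensor_map k Ck D4 (\<lambda>t. t) (tensor_map k Ck D3 (\<lambda>t. t) \<gamma>)"
  \<comment> \<open>Every term on both sides ends in an undivided coproduct, so four variables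
    suffice for five tensor factors.\<close>
  let ?G = "\<lambda>a b c d. pure k Ck D4 a (pure k Ck D3 b (pure k Ck CC c (\<Delta>\<^sub>C d)))"
  note CCCC_module = tensor_module[OF CC_module CC_module]
  note A = linear_tensor_assoc[OF Ck_module Ck_module CC_module]
  note idA = linear_tensor_map[OF Ck_module CCCC_module Ck_module D4_module linear_ident A]
  note M = linear_comp[OF idA linear_tensor_assoc[OF Ck_module CC_module CC_module]]
  note \<gamma>id = linear_tensor_map[OF Ck_module CC_module D3_module CC_module linear_shepherd linear_ident]
  note L = linear_comp[OF M \<gamma>id]
  note N = linear_tensor_map[OF Ck_module Ck_module Ck_module D3_module linear_ident linear_shepherd]
  note R = linear_tensor_map[OF Ck_module CC_module Ck_module D4_module linear_ident N]
  note cl = pure_closed herd_modules CCCC_module C.comult_closed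
  note lin_G = linear_intros linear_comp[OF C.comult_linear] C.comult_linear
  have G_lin: "(\<lambda>a. ?G a b c d) \<in> linear_maps k Ck D5" "(\<lambda>a. ?G b a c d) \<in> linear_maps k Ck D5"
    "(\<lambda>a. ?G b c a d) \<in> linear_maps k Ck D5" "(\<lambda>a. ?G b c d a) \<in> linear_maps k Ck D5"
    if "b \<in> carrier C" "c \<in> carrier C" "d \<in> carrier C" for b c d
    using that by (auto intro!: lin_G herd_modules simp: cl)
  have assoc_comult: "?A (pure k CC CC (\<Delta>\<^sub>C q) t)
      = C.sweedler D4 q (\<lambda>q1 q2. pure k Ck D3 q1 (pure k Ck CC q2 t))"
    if "q \<in> carrier C" "t \<in> carrier CC" for q t
  proof -
    have "?A (pure k CC CC (C.sweedler CC q (\<lambda>a b. pure k Ck Ck a b)) t)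
        = C.sweedler D4 q (\<lambda>q1 q2. ?A (pure k CC CC (pure k Ck Ck q1 q2) t))"
      using that by (intro C.linear_of_sweedler[OF linear_comp[OF A linear_pure_left] CC_module D4_module]
          linear_ident CC_module) (simp_all add: cl)
    also have "\<dots> = C.sweedler D4 q (\<lambda>q1 q2. pure k Ck D3 q1 (pure k Ck CC q2 t))"
      using that by (intro C.sweedler_cong) (simp_all add: tensor_assoc_pure[OF Ck_module Ck_module CC_module])
    finally show ?thesis using that by (simp add: C.sweedler_pure)
  qed
  have M_pure: "?M (pure k D3 CC (pure k Ck CC p (\<Delta>\<^sub>C q)) (\<Delta>\<^sub>C b)) = C.sweedler D5 q (\<lambda>q1 q2. ?G p q1 q2 b)"
    if "p \<in> carrier C" "q \<in> carrier C" "b \<in> carrier C" for p q b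
  proof -
    have "?M (pure k D3 CC (pure k Ck CC p (\<Delta>\<^sub>C q)) (\<Delta>\<^sub>C b))
        = pure k Ck D4 p (?A (pure k CC CC (\<Delta>\<^sub>C q) (\<Delta>\<^sub>C b)))"
      using that tensor_map_pure[OF Ck_module CCCC_module Ck_module D4_module linear_ident A]
      by (simp add: tensor_assoc_pure[OF Ck_module CC_module CC_module] cl)
    also have "\<dots> = C.sweedler D5 q (\<lambda>q1 q2. ?G p q1 q2 b)"
      using that
        C.linear_of_sweedler[OF linear_pure_right[OF Ck_module D4_module _ linear_ident] D4_module D5_module]
      by (simp add: assoc_comult cl)
    finally show ?thesis .
  qed
  have L_pure: "?L (pure k Ck CC a (\<Delta>\<^sub>C b))
      = C.sweedler D5 a (\<lambda>p q. C.sweedler D5 q (\<lambda>q1 q2. ?G p q1 q2 b))"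
    if "a \<in> carrier C" "b \<in> carrier C" for a b
  proof -
    have "?L (pure k Ck CC a (\<Delta>\<^sub>C b)) = ?M (pure k D3 CC (\<gamma> a) (\<Delta>\<^sub>C b))"
      using that tensor_map_pure[OF Ck_module CC_module D3_module CC_module linear_shepherd linear_ident]
      by (simp add: cl)
    also have "\<dots> = C.sweedler D5 a (\<lambda>p q. ?M (pure k D3 CC (pure k Ck CC p (\<Delta>\<^sub>C q)) (\<Delta>\<^sub>C b)))"
      using that
      by (intro linear_of_shepherd[OF linear_comp[OF M linear_pure_left] D5_module] linear_ident)
        (simp_all add: cl)
    also have "\<dots> = C.sweedler D5 a (\<lambda>p q. C.sweedler D5 q (\<lambda>q1 q2. ?G p q1 q2 b))"
      using that by (intro C.sweedler_cong M_pure) simp_all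
    finally show ?thesis .
  qed
  have N_comult: "?N (\<Delta>\<^sub>C b) = C.sweedler D4 b (\<lambda>q r. pure k Ck D3 q (\<gamma> r))"
    if "b \<in> carrier C" for b
    by (simp add: tensor_map_def)
  have R_pure: "?R (pure k Ck CC a (\<Delta>\<^sub>C b))
      = C.sweedler D5 b (\<lambda>q r. C.sweedler D5 r (\<lambda>r1 r2. ?G a q r1 r2))"
    if "a \<in> carrier C" "b \<in> carrier C" for a b
  proof -
    have \<gamma>_closed: "\<gamma> r \<in> carrier D3" if "r \<in> carrier C" for r
      using linear_mapsD(1)[OF linear_shepherd] that by simp
    have "?R (pure k Ck CC a (\<Delta>\<^sub>C b)) = pure k Ck D4 a (C.sweedler D4 b (\<lambda>q r. pure k Ck D3 q (\<gamma> r)))"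
      using that tensor_map_pure[OF Ck_module CC_module Ck_module D4_module linear_ident N]
      by (simp add: cl N_comult)
    also have "\<dots> = C.sweedler D5 b (\<lambda>q r. pure k Ck D4 a (pure k Ck D3 q (\<gamma> r)))"
      using that by (intro C.linear_of_sweedler[OF linear_pure_right D4_module D5_module] linear_ident)
        (simp_all add: cl \<gamma>_closed)
    also have "\<dots> = C.sweedler D5 b (\<lambda>q r. C.sweedler D5 r (\<lambda>r1 r2. ?G a q r1 r2))"
      using that
      by (intro C.sweedler_cong linear_of_shepherd linear_intros herd_modules) (simp_all add: cl)
    finally show ?thesis .
  qed
  have "?L (\<gamma> x) = C.sweedler D5 x (\<lambda>a b. C.sweedler D5 a (\<lambda>p q. C.sweedler D5 q (\<lambda>q1 q2. ?G p q1 q2 b)))"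
    unfolding linear_of_shepherd[OF L D5_module x] by (intro C.sweedler_cong L_pure) (simp_all add: x)
  \<comment> \<open>Coassociativity at \<open>x\<close>, applied to a summand that is itself a sum
    over the coproduct of its middle leg; the next step uses it at \<open>b\<close>. Each time the
    splitting moves one place to the right.\<close>
  also have "\<dots> = C.sweedler D5 x (\<lambda>a b. C.sweedler D5 b (\<lambda>q r. C.sweedler D5 q (\<lambda>q1 q2. ?G a q1 q2 r)))"
    by (intro C.sweedler_coassoc[OF D5_module] C.linear_sweedler_param[OF D5_module]
        C.linear_sweedler_arg[OF D5_module] bilinear_mapsI linear_ident G_lin)
      (simp_all add: x)
  also have "\<dots> = C.sweedler D5 x (\<lambda>a b. C.sweedler D5 b (\<lambda>q r. C.sweedler D5 r (\<lambda>r1 r2. ?G a q r1 r2)))"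
    by (intro C.sweedler_cong C.sweedler_coassoc[OF D5_module] G_lin) (simp_all add: x)
  also have "\<dots> = ?R (\<gamma> x)"
    unfolding linear_of_shepherd[OF R D5_module x]
    by (intro C.sweedler_cong R_pure[symmetric]) (simp_all add: x)
  finally show ?thesis .
qed

section \<open>The bimodules \<open>C\<close> and \<open>C\<close> hat\<close>

abbreviation T :: "'u bimodule" where "T \<equiv> symmetric_bimodule H C"
abbreviation T' :: "'u bimodule" where "T' \<equiv> hat_bimodule H S C"

lemma bimodule_simps [simp]:
  "carrier T = carrier C" "carrier T' = carrier C"
  "lact T h c = h \<odot>\<^bsub>C\<^esub> c" "ract T c h = h \<odot>\<^bsub>C\<^esub> c"
  "lact T' h c = inv_into (carrier H) S h \<odot>\<^bsub>C\<^esub> c" "ract T' c h = inv_into (carrier H) S h \<odot>\<^bsub>C\<^esub> c"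
  by (simp_all add: symmetric_bimodule_def hat_bimodule_def module.defs bimodule.defs)

lemma same_module_T: "same_module k T Ck"
  by (simp add: same_module_def symmetric_bimodule_def module.defs bimodule.defs)

text \<open>The twist affects only the two actions of \<open>H\<close>. Over \<open>k\<close> the
  hat module is \<open>Ck\<close>, so tensor products formed with it have the same elements as those
  formed with \<open>Ck\<close>.\<close>

lemma same_module_T': "same_module k T' Ck"
  by (simp add: same_module_def hat_bimodule_def module.defs bimodule.defs)

lemma is_bimodule_T: "is_bimodule k H T"
proof -
  have C: "Module.module H C" ..
  have "Module.module H (T\<lparr>smult := lact T\<rparr>)"
    by (rule same_module_module[OF _ C])
      (simp add: same_module_def symmetric_bimodule_def module.defs bimodule.defs)
  moreover have "Module.module H (T\<lparr>smult := (\<lambda>h x. ract T x h)\<rparr>)"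
    by (rule same_module_module[OF _ C])
      (simp add: same_module_def symmetric_bimodule_def module.defs bimodule.defs)
  ultimately show ?thesis
    using same_module_module[OF same_module_T Ck_module] same_module_T
    by (simp add: is_bimodule_def C.act.smult_left_commute same_module_def)
qed

text \<open>S fixes the multiples of the unit, so both twisted actions extend the action of
  \<open>k\<close>.\<close>

lemma is_bimodule_T': "is_bimodule k H T'"
proof -
  have "Module.module H C" ..
  note C = H.antipode_pullback_module[OF this]
  have "Module.module H (T'\<lparr>smult := lact T'\<rparr>)"
    by (rule same_module_module[OF _ C])
      (simp add: same_module_def hat_bimodule_def module.defs bimodule.defs)
  moreover have "Module.module H (T'\<lparr>smult := (\<lambda>h x. ract T' x h)\<rparr>)"
    by (rule same_module_module[OF _ C])
      (simp add: same_module_def hat_bimodule_def module.defs bimodule.defs)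
  ultimately show ?thesis
    using same_module_module[OF same_module_T' Ck_module] same_module_T'
    by (simp add: is_bimodule_def C.act.smult_left_commute same_module_def H.inv_antipode
        H.antipode_smult_one)
qed

lemma regular_bimodule_simps [simp]:
  "lact (regular_bimodule H) = mult H" "ract (regular_bimodule H) = mult H"
  by (simp_all add: regular_bimodule_def module.defs bimodule.defs)

lemma same_module_regular_bimodule: "same_module k (regular_bimodule H) H"
  by (simp add: same_module_def regular_bimodule_def module.defs bimodule.defs)

text \<open>A tensor product of bimodules keeps the left action of its first factor and the right
  action of its second; by linearity both conditions are checked on pure tensors of
  \<open>Ck\<close>.\<close>

lemma bimodule_maps_regularI:
  fixes A B :: "'u bimodule"
  assumes A: "same_module k A Ck" and B: "same_module k B Ck"
    and f: "f \<in> linear_maps k CC H"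
    and l_lin: "\<And>h. h \<in> carrier H \<Longrightarrow> (\<lambda>c. lact A h c) \<in> linear_maps k Ck Ck"
    and r_lin: "\<And>h. h \<in> carrier H \<Longrightarrow> (\<lambda>c. ract B c h) \<in> linear_maps k Ck Ck"
    and left: "\<And>h c d. h \<in> carrier H \<Longrightarrow> c \<in> carrier C \<Longrightarrow> d \<in> carrier C \<Longrightarrow>
      f (pure k Ck Ck (lact A h c) d) = h \<otimes>\<^bsub>H\<^esub> f (pure k Ck Ck c d)"
    and right: "\<And>h c d. h \<in> carrier H \<Longrightarrow> c \<in> carrier C \<Longrightarrow> d \<in> carrier C \<Longrightarrow>
      f (pure k Ck Ck c (ract B d h)) = h \<otimes>\<^bsub>H\<^esub> f (pure k Ck Ck c d)"
  shows "f \<in> bimodule_maps k H (tensor_bimodule k A B) (regular_bimodule H)"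
proof -
  note AB = same_module_tensor[OF A B Ck_module Ck_module]
  have sm: "same_module k (tensor_bimodule k A B) CC"
    using AB by (simp add: same_module_def tensor_bimodule_def module.defs bimodule.defs)
  have lact: "lact (tensor_bimodule k A B) h = tensor_map k Ck Ck (lact A h) (\<lambda>u. u)" for h
    by (simp add: tensor_bimodule_def module.defs bimodule.defs
        tensor_map_same_module[OF A B Ck_module Ck_module])
  have ract: "ract (tensor_bimodule k A B) x h = tensor_map k Ck Ck (\<lambda>t. t) (\<lambda>u. ract B u h) x" for x h
    by (simp add: tensor_bimodule_def module.defs bimodule.defs
        tensor_map_same_module[OF A B Ck_module Ck_module])
  have "f (tensor_map k Ck Ck (lact A h) (\<lambda>u. u) x) = h \<otimes>\<^bsub>H\<^esub> f x"
    if h: "h \<in> carrier H" and x: "x \<in> carrier CC" for h x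
    using tensor_map_pure[OF Ck_module Ck_module Ck_module Ck_module l_lin[OF h] linear_ident]
    by (intro tensor_ext[OF Ck_module Ck_module H.H_module
          linear_comp[OF f linear_tensor_map[OF Ck_module Ck_module Ck_module Ck_module l_lin[OF h] linear_ident]]
          H.linear_mult_right[OF f h] _ x]) (simp add: left h)
  moreover have "f (tensor_map k Ck Ck (\<lambda>t. t) (\<lambda>u. ract B u h) x) = f x \<otimes>\<^bsub>H\<^esub> h"
    if h: "h \<in> carrier H" and x: "x \<in> carrier CC" for h x
    using tensor_map_pure[OF Ck_module Ck_module Ck_module Ck_module linear_ident r_lin[OF h]]
    by (intro tensor_ext[OF Ck_module Ck_module H.H_module
          linear_comp[OF f linear_tensor_map[OF Ck_module Ck_module Ck_module Ck_module linear_ident r_lin[OF h]]]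
          H.linear_mult_left[OF f h] _ x])
      (simp add: right h H.m_comm linear_mapsD(1)[OF f] pure_closed herd_modules)
  moreover have "carrier (tensor_bimodule k A B) = carrier CC" using sm by (simp add: same_module_def)
  ultimately show ?thesis
    unfolding bimodule_maps_def linear_maps_same_module[OF sm same_module_regular_bimodule]
    by (simp add: f lact ract)
qed

lemma ev_formal_dual: "formal_dual k H T T' ev (S \<circ> ev)"
proof
  note CT = same_module_T and CT' = same_module_T'
  have lin: "(\<lambda>c. inv_into (carrier H) S h \<odot>\<^bsub>C\<^esub> c) \<in> linear_maps k Ck Ck" if "h \<in> carrier H" for h
    using that by (simp add: H.inv_antipode linear_act)
  show "is_bimodule k H T" by (rule is_bimodule_T)
  show "is_bimodule k H T'" by (rule is_bimodule_T')
  \<comment> \<open>The inverse antipode in the left action of \<open>T'\<close> cancels the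
    antipode of \<open>ev_act_left\<close>; this is what the twist is for.\<close>
  show "ev \<in> bimodule_maps k H (tensor_bimodule k T' T) (regular_bimodule H)"
    by (rule bimodule_maps_regularI[OF CT' CT linear_ev])
      (simp_all add: lin linear_act H.inv_antipode H.antipode_antipode ev_act_left ev_act_right)
  \<comment> \<open>On the left factor the outer S cancels the antipode of
    \<open>ev_act_left\<close>, on the right factor it cancels the twist.\<close>
  show "S \<circ> ev \<in> bimodule_maps k H (tensor_bimodule k T T') (regular_bimodule H)"
    by (rule bimodule_maps_regularI[OF CT CT'])
      (simp_all add: lin linear_act H.inv_antipode H.antipode_antipode ev_act_left ev_act_right
        H.antipode_mult H.linear_antipode[OF linear_ev] comp_def)
  fix x y x' y'
  show "lact T ((S \<circ> ev) (pure k T T' x x')) y = ract T x (ev (pure k T' T x' y))"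
    if "x \<in> carrier T" "y \<in> carrier T" "x' \<in> carrier T'"
    using that by (simp add: tensor_sum_same_module[OF CT CT'] tensor_sum_same_module[OF CT' CT] ev_exchange)
  \<comment> \<open>The twist cancels the antipode on the left and supplies one on the right, which
    gives \<open>ev_exchange\<close> with its two sides interchanged.\<close>
  show "ract T' x' ((S \<circ> ev) (pure k T T' x y')) = lact T' (ev (pure k T' T x' x)) y'"
    if "x \<in> carrier T" "x' \<in> carrier T'" "y' \<in> carrier T'"
    using that
    by (simp add: tensor_sum_same_module[OF CT CT'] tensor_sum_same_module[OF CT' CT] H.inv_antipode
        H.antipode_antipode ev_exchange)
qed

text \<open>The axioms speak of tensor products of the records \<open>T\<close> and
  \<open>T'\<close>. The facts \<open>t2\<close>, \<open>t3\<close>, \<open>t4\<close> replace these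
  by \<open>Ck\<close> one level of nesting at a time, which reduces each axiom to its version over
  \<open>Ck\<close>.\<close>

lemma comult_herd: "herd k H T T' ev (S \<circ> ev) \<gamma>"
proof (intro herd.intro herd_axioms.intro ev_formal_dual)
  note T = same_module_T and T' = same_module_T' and refl = same_module_refl
  note C = Ck_module
  note t2 = same_module_tensor[OF T' T C C]
  note t3 = same_module_tensor[OF T t2 C CC_module]
  note t4 = same_module_tensor[OF T' t3 C D3_module]
  show "\<gamma> \<in> linear_maps k T (tensor k T (tensor k T' T))"
    unfolding linear_maps_same_module[OF T t3] by (rule linear_shepherd)
  fix x assume "x \<in> carrier T"
  then have x: "x \<in> carrier C" by simp
  show "tensor_map k H T (S \<circ> ev) (\<lambda>t. t) (tensor_assoc_inv k T T' T (\<gamma> x)) = pure k H T \<one>\<^bsub>H\<^esub> x"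
    unfolding tensor_map_same_module[OF refl T H.H_module C] tensor_assoc_same_module(2)[OF T T' T C C C]
      tensor_sum_same_module[OF refl T]
    by (rule counit_shepherd_left[OF x])
  show "tensor_map k T H (\<lambda>t. t) ev (\<gamma> x) = pure k T H x \<one>\<^bsub>H\<^esub>"
    unfolding tensor_map_same_module[OF T refl C H.H_module] tensor_sum_same_module[OF T refl]
    by (rule counit_shepherd_right[OF x])
  show "tensor_map k T (tensor k T' (tensor k T (tensor k T' T)))
      (\<lambda>t. t) (tensor_assoc k T' T (tensor k T' T))
      (tensor_assoc k T (tensor k T' T) (tensor k T' T)
        (tensor_map k (tensor k T (tensor k T' T)) (tensor k T' T) \<gamma> (\<lambda>t. t) (\<gamma> x)))
    = tensor_map k T (tensor k T' (tensor k T (tensor k T' T)))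
      (\<lambda>t. t) (tensor_map k T' (tensor k T (tensor k T' T)) (\<lambda>t. t) \<gamma>) (\<gamma> x)"
    unfolding tensor_map_same_module[OF T t4 C D4_module] tensor_map_same_module[OF t3 t2 D3_module CC_module]
      tensor_map_same_module[OF T' t3 C D3_module]
      tensor_assoc_same_module(1)[OF T' T t2 C C CC_module]
      tensor_assoc_same_module(1)[OF T t2 t2 C CC_module CC_module]
    by (rule coassoc_shepherd[OF x])
qed

end

theorem theorem5p2:
  fixes k :: "'u::infinite ring"
    and H C :: "('u, 'u) module"
    and \<Delta>\<^sub>H \<epsilon>\<^sub>H S \<Delta>\<^sub>C \<epsilon>\<^sub>C :: "'u \<Rightarrow> 'u"
  defines "T \<equiv> symmetric_bimodule H C"
    and "T' \<equiv> hat_bimodule H S C"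
    and "ev \<equiv> galois_ev k H C \<Delta>\<^sub>C \<epsilon>\<^sub>C"
    and "\<gamma> \<equiv> iterated_comult_right k (restrict_unit H C) \<Delta>\<^sub>C"
  assumes "commutative_hopf_algebra k H \<Delta>\<^sub>H \<epsilon>\<^sub>H S"
    and "faithfully_flat k H"
    and "galois_coobject k H \<Delta>\<^sub>H \<epsilon>\<^sub>H C \<Delta>\<^sub>C \<epsilon>\<^sub>C"
  shows "formal_dual k H T T' ev (S \<circ> ev)
    \<and> (\<forall>c\<in>carrier C. iterated_comult_left k (restrict_unit H C) \<Delta>\<^sub>C c = \<gamma> c)
    \<and> herd k H T T' ev (S \<circ> ev) \<gamma>"
proof -
  interpret HC: hopf_module_coalgebra k H \<Delta>\<^sub>H \<epsilon>\<^sub>H S C \<Delta>\<^sub>C \<epsilon>\<^sub>C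
    using assms(5,7) by (simp add: hopf_module_coalgebra_def galois_coobject_def)
  interpret G: hopf_galois_coobject k H \<Delta>\<^sub>H \<epsilon>\<^sub>H S C \<Delta>\<^sub>C \<epsilon>\<^sub>C
    by unfold_locales (use assms(7) HC.galois_map_bij in \<open>simp add: galois_coobject_def\<close>)
  \<comment> \<open>The equality of the two iterated coproducts is coassociativity of
    \<open>C\<close> with the definitions unfolded.\<close>
  show ?thesis
    using G.ev_formal_dual G.comult_herd HC.C.coassoc
    by (simp add: T_def T'_def ev_def \<gamma>_def iterated_comult_left_def iterated_comult_right_def)
qed

end
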